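(* Let $T$ be a linear operator, simultaneously defined on all the spaces $L^p(\sigma)$ below, such that for every $p\in(1,\infty)$ and all weights $\sigma,\lambda\in A_p$, $T$ is bounded from $L^{p}(\sigma)$ to $L^{p}(\lambda)$. Suppose moreover that $T$ is compact on $L^q(w)$ for some $q\in(1,\infty)$ and some $w\in A_q$. Then $T$ is compact from $L^{p}(\sigma)$ to $L^{p}(\lambda)$ for all $p\in(1,\infty)$ and all $\sigma,\lambda\in A_p$.
   Context: A weight on $\mathbb{R}^d$ is a locally integrable function positive almost everywhere. For $p\in(1,\infty)$, $L^p(w)$ is the space of measurable $f:\mathbb{R}^d\to\mathbb{C}$ with $\|f\|_{L^p(w)}=(\int_{\mathbb{R}^d}|f|^pw)^{1/p}<\infty$. For $p\in(1,\infty)$, $w\in A_p$ means $[w]_{A_p}:=\sup_Q \langle w\rangle_Q\langle w^{1-p'}\rangle_Q^{p-1}<\infty$, where the supremum is over all cubes $Q\subset\mathbb{R}^d$, $\langle w\rangle_Q=|Q|^{-1}\int_Q w$, and $p'=p/(p-1)$. "Simultaneously defined" means $T$ is a single linear operator defined on a common vector space of measurable functions containing all the spaces involved, acting consistently on them. *)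

theory Defs
  imports "HOL-Analysis.Analysis"
begin

text \<open>R^d is modelled by an arbitrary Euclidean space 'a (dimension DIM('a)),
  with Lebesgue measure. Functions are complex-valued; weights are real-valued.\<close>

definition cube :: "'a::euclidean_space \<Rightarrow> real \<Rightarrow> 'a set" where
  "cube a l = cbox a (a + l *\<^sub>R One)"

definition is_cube :: "'a::euclidean_space set \<Rightarrow> bool" where
  "is_cube Q \<longleftrightarrow> (\<exists>a l. l > 0 \<and> Q = cube a l)"

definition weight :: "('a::euclidean_space \<Rightarrow> real) \<Rightarrow> bool" where
  "weight w \<longleftrightarrow> w \<in> borel_measurable lebesgue
     \<and> (\<forall>K. compact K \<longrightarrow> set_integrable lebesgue K w)
     \<and> (AE x in lebesgue. w x > 0)"

definition int_over :: "('a::euclidean_space \<Rightarrow> real) \<Rightarrow> 'a set \<Rightarrow> ennreal" where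
  "int_over g Q = (\<integral>\<^sup>+ x\<in>Q. ennreal (g x) \<partial>lebesgue)"

definition avg :: "('a::euclidean_space \<Rightarrow> real) \<Rightarrow> 'a set \<Rightarrow> real" where
  "avg g Q = enn2real (int_over g Q) / measure lebesgue Q"

definition conj_exp :: "real \<Rightarrow> real" where
  "conj_exp p = p / (p - 1)"

definition Ap :: "real \<Rightarrow> ('a::euclidean_space \<Rightarrow> real) \<Rightarrow> bool" where
  "Ap p w \<longleftrightarrow> weight w \<and>
     (\<exists>C::real. \<forall>Q. is_cube Q \<longrightarrow>
        int_over w Q < \<infinity> \<and>
        int_over (\<lambda>x. w x powr (1 - conj_exp p)) Q < \<infinity> \<and>
        avg w Q * (avg (\<lambda>x. w x powr (1 - conj_exp p)) Q) powr (p - 1) \<le> C)"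

definition Lp_int :: "real \<Rightarrow> ('a::euclidean_space \<Rightarrow> real) \<Rightarrow> ('a \<Rightarrow> complex) \<Rightarrow> ennreal" where
  "Lp_int p w f = (\<integral>\<^sup>+ x. ennreal (norm (f x) powr p * w x) \<partial>lebesgue)"

definition Lp :: "real \<Rightarrow> ('a::euclidean_space \<Rightarrow> real) \<Rightarrow> ('a \<Rightarrow> complex) set" where
  "Lp p w = {f. f \<in> borel_measurable lebesgue \<and> Lp_int p w f < \<infinity>}"

definition Lp_norm :: "real \<Rightarrow> ('a::euclidean_space \<Rightarrow> real) \<Rightarrow> ('a \<Rightarrow> complex) \<Rightarrow> real" where
  "Lp_norm p w f = enn2real (Lp_int p w f) powr (1 / p)"

definition bounded_op :: "(('a::euclidean_space \<Rightarrow> complex) \<Rightarrow> ('a \<Rightarrow> complex)) \<Rightarrow>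
    real \<Rightarrow> ('a \<Rightarrow> real) \<Rightarrow> ('a \<Rightarrow> real) \<Rightarrow> bool" where
  "bounded_op T p s l \<longleftrightarrow>
     (\<exists>C. \<forall>f \<in> Lp p s. T f \<in> Lp p l \<and> Lp_norm p l (T f) \<le> C * Lp_norm p s f)"

definition compact_op :: "(('a::euclidean_space \<Rightarrow> complex) \<Rightarrow> ('a \<Rightarrow> complex)) \<Rightarrow>
    real \<Rightarrow> ('a \<Rightarrow> real) \<Rightarrow> ('a \<Rightarrow> real) \<Rightarrow> bool" where
  "compact_op T p s l \<longleftrightarrow>
     (\<forall>f \<in> Lp p s. T f \<in> Lp p l) \<and>
     (\<forall>F::nat \<Rightarrow> ('a \<Rightarrow> complex). (\<forall>n. F n \<in> Lp p s \<and> Lp_norm p s (F n) \<le> 1) \<longrightarrow>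
        (\<exists>r g. strict_mono r \<and> g \<in> Lp p l \<and>
           (\<lambda>n. Lp_norm p l (\<lambda>x. T (F (r n)) x - g x)) \<longlonglongrightarrow> 0))"

end

theory Submission
  imports Defs "HOL-Library.Diagonal_Subsequence"
begin

text \<open>
  For small \<open>\<alpha> > 0\<close> and \<open>\<beta> = 1 - \<alpha>\<close> put \<open>p\<^sub>1 = (p - \<alpha> q) / \<beta>\<close>, \<open>\<sigma>\<^sub>1 = \<sigma>\<^bsup>1/\<beta>\<^esup> w\<^bsup>-\<alpha>/\<beta>\<^esup>\<close> and likewise
  \<open>\<lambda>\<^sub>1\<close>. The reverse Hoelder inequality shows \<open>\<sigma>\<^sub>1, \<lambda>\<^sub>1 \<in> A\<^bsub>p\<^sub>1\<^esub>\<close>, so \<open>L\<^sup>p(\<sigma>)\<close> and \<open>L\<^sup>p(\<lambda>)\<close> lie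
  between \<open>L\<^sup>q(w)\<close>, where \<open>T\<close> is compact, and \<open>L\<^bsup>p\<^sub>1\<^esup>(\<sigma>\<^sub>1)\<close>, \<open>L\<^bsup>p\<^sub>1\<^esup>(\<lambda>\<^sub>1)\<close>, between which \<open>T\<close> is bounded.
  The averages \<open>P\<^sub>n\<close> over finitely many dyadic cubes are uniformly bounded on every \<open>L\<^sup>p(u)\<close> with
  \<open>u \<in> A\<^sub>p\<close> and converge strongly to the identity. Compactness on \<open>L\<^sup>q(w)\<close> therefore gives
  \<open>\<parallel>T - P\<^sub>n T\<parallel> \<rightarrow> 0\<close> there, and real interpolation transports this to \<open>L\<^sup>p(\<sigma>) \<rightarrow> L\<^sup>p(\<lambda>)\<close>. Since \<open>P\<^sub>n T\<close> has
  finite rank, \<open>T\<close> is compact.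
\<close>

section \<open>Hoelder inequality and the real interpolation kernel\<close>

text \<open>The exponents are interpolated linearly, p = \<alpha> q + \<beta> p_1, and not through
  their reciprocals, because the argument works with p-th powers of norms: |f|^p \<sigma> is
  pointwise the geometric mean, with exponents \<alpha> and \<beta>, of |f|^q w and |f|^{p_1}
  \<sigma>_1. This identity dictates p_1, \<sigma>_1 and \<lambda>_1. Both weights are perturbed
  with the same \<alpha>, so that source and target share the one endpoint (q, w) at which
  compactness is given. The obstacle is that nothing but boundedness is known at the other endpoint.
  Compactness is therefore first made quantitative: if T - P_n T has bound E at (q, w) and bound N
  at the far endpoint, the bound in between is a constant times E^\<alpha> N^\<beta>. Here n is
  chosen after E, so N must not depend on n; hence the A_{p_1} condition for \<lambda>_1 serves
  twice, for the bound of T and for the uniform bound of P_n. Since E is arbitrarily small with N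
  fixed, the constants lost in real interpolation and in the quasi-triangle inequality are
  harmless.\<close>

lemma nn_integral_Hoelder_le:
  fixes f g :: "'b \<Rightarrow> real"
  assumes [measurable]: "f \<in> borel_measurable M" "g \<in> borel_measurable M"
    and f0: "AE x in M. 0 \<le> f x" and g0: "AE x in M. 0 \<le> g x"
    and ab: "0 < a" "0 < b" "a + b = 1"
    and fA: "(\<integral>\<^sup>+x. ennreal (f x) \<partial>M) \<le> ennreal A" and gB: "(\<integral>\<^sup>+x. ennreal (g x) \<partial>M) \<le> ennreal B"
    and AB: "0 \<le> A" "0 \<le> B"
  shows "(\<integral>\<^sup>+x. ennreal (f x powr a * g x powr b) \<partial>M) \<le> ennreal (A powr a * B powr b)"
\<comment> \<open>Young's inequality is applied after division by \<open>A\<close> and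
  \<open>B\<close>, so a vanishing bound is treated apart; it forces one of the functions to vanish
  almost everywhere.\<close>
proof (cases "A = 0 \<or> B = 0")
  case True
  have "AE x in M. ennreal (f x) = 0 \<or> ennreal (g x) = 0"
  proof (cases "A = 0")
    case True
    then have "(\<integral>\<^sup>+x. ennreal (f x) \<partial>M) = 0" using fA by simp
    then have "AE x in M. ennreal (f x) = 0" by (subst (asm) nn_integral_0_iff_AE) auto
    then show ?thesis by eventually_elim auto
  next
    case False
    then have "(\<integral>\<^sup>+x. ennreal (g x) \<partial>M) = 0" using gB True by simp
    then have "AE x in M. ennreal (g x) = 0" by (subst (asm) nn_integral_0_iff_AE) auto
    then show ?thesis by eventually_elim auto
  qed
  with f0 g0 have "AE x in M. ennreal (f x powr a * g x powr b) = 0"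
    by eventually_elim (auto simp: ennreal_eq_0_iff)
  then have "(\<integral>\<^sup>+x. ennreal (f x powr a * g x powr b) \<partial>M) = (\<integral>\<^sup>+x. 0 \<partial>M)"
    by (intro nn_integral_cong_AE) auto
  then show ?thesis by simp
next
  case False
  then have A: "A > 0" and B: "B > 0" using AB by auto
  define k where "k = A powr a * B powr b"
  have k: "k > 0" using A B by (auto simp: k_def)
  \<comment> \<open>Young's inequality for f/A and g/B, multiplied by \<open>k\<close>; after
    integration the two terms add up to k (a + b) = k.\<close>
  have pt: "f powr a * g powr b \<le> k * (a / A) * f + k * (b / B) * g" if "0 \<le> f" "0 \<le> g" for f g :: real
  proof (cases "f = 0 \<or> g = 0")
    case True
    then have "f powr a * g powr b = 0" using ab by auto
    moreover have "0 \<le> k * (a / A) * f + k * (b / B) * g"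
      using that k A B ab by (intro add_nonneg_nonneg mult_nonneg_nonneg divide_nonneg_nonneg) auto
    ultimately show ?thesis by linarith
  next
    case False
    then have "(f/A) powr a * (g/B) powr b \<le> a * (f/A) + b * (g/B)"
      using that A B ab by (intro Youngs_inequality_0) auto
    then have "k * ((f/A) powr a * (g/B) powr b) \<le> k * (a * (f/A) + b * (g/B))"
      using k by (intro mult_left_mono) auto
    moreover have "k * ((f/A) powr a * (g/B) powr b) = f powr a * g powr b"
      using A B that by (simp add: k_def powr_divide)
    ultimately show ?thesis by (simp add: algebra_simps)
  qed
  have "(\<integral>\<^sup>+x. ennreal (f x powr a * g x powr b) \<partial>M)
      \<le> (\<integral>\<^sup>+x. ennreal (k * (a / A)) * ennreal (f x) + ennreal (k * (b / B)) * ennreal (g x) \<partial>M)"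
    using f0 g0
  proof (intro nn_integral_mono_AE, eventually_elim)
    case (elim x)
    have "ennreal (f x powr a * g x powr b) \<le> ennreal (k * (a / A) * f x + k * (b / B) * g x)"
      using pt elim by (intro ennreal_leI) auto
    also have "\<dots> = ennreal (k * (a / A)) * ennreal (f x) + ennreal (k * (b / B)) * ennreal (g x)"
      using elim k A B ab by (simp add: ennreal_mult[symmetric])
    finally show ?case .
  qed
  also have "\<dots> = ennreal (k * (a / A)) * (\<integral>\<^sup>+x. ennreal (f x) \<partial>M) + ennreal (k * (b / B)) * (\<integral>\<^sup>+x. ennreal (g x) \<partial>M)"
    by (simp add: nn_integral_add nn_integral_cmult)
  also have "\<dots> \<le> ennreal (k * (a / A)) * ennreal A + ennreal (k * (b / B)) * ennreal B"
    using fA gB by (intro add_mono mult_left_mono) auto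
  also have "\<dots> = ennreal (k * (a / A) * A + k * (b / B) * B)"
    using A B k ab by (simp add: ennreal_mult[symmetric] ennreal_plus[symmetric] del: ennreal_plus)
  also have "k * (a / A) * A + k * (b / B) * B = k" using A B ab by (simp flip: distrib_left)
  finally show ?thesis by (simp add: k_def)
qed

lemma set_nn_integral_Hoelder_le:
  fixes f g :: "'b \<Rightarrow> real"
  assumes [measurable]: "f \<in> borel_measurable M" "g \<in> borel_measurable M" and Q[measurable]: "Q \<in> sets M"
    and f0: "AE x in M. 0 \<le> f x" and g0: "AE x in M. 0 \<le> g x"
    and ab: "0 < a" "0 < b" "a + b = 1"
    and fA: "(\<integral>\<^sup>+x\<in>Q. ennreal (f x) \<partial>M) \<le> ennreal A" and gB: "(\<integral>\<^sup>+x\<in>Q. ennreal (g x) \<partial>M) \<le> ennreal B"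
    and AB: "0 \<le> A" "0 \<le> B"
  shows "(\<integral>\<^sup>+x\<in>Q. ennreal (f x powr a * g x powr b) \<partial>M) \<le> ennreal (A powr a * B powr b)"
proof -
  have "(\<integral>\<^sup>+x. ennreal ((f x * indicator Q x) powr a * (g x * indicator Q x) powr b) \<partial>M) \<le> ennreal (A powr a * B powr b)"
  proof (rule nn_integral_Hoelder_le[OF _ _ _ _ ab _ _ AB])
    show "AE x in M. 0 \<le> f x * indicator Q x" using f0 by (auto elim!: eventually_mono)
    show "AE x in M. 0 \<le> g x * indicator Q x" using g0 by (auto elim!: eventually_mono)
    show "(\<integral>\<^sup>+x. ennreal (f x * indicator Q x) \<partial>M) \<le> ennreal A"
      using fA by (simp add: ennreal_mult' ennreal_indicator mult.commute[of _ "indicator _ _"])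
    show "(\<integral>\<^sup>+x. ennreal (g x * indicator Q x) \<partial>M) \<le> ennreal B"
      using gB by (simp add: ennreal_mult' ennreal_indicator mult.commute[of _ "indicator _ _"])
  qed auto
  also have "(\<integral>\<^sup>+x. ennreal ((f x * indicator Q x) powr a * (g x * indicator Q x) powr b) \<partial>M)
     = (\<integral>\<^sup>+x\<in>Q. ennreal (f x powr a * g x powr b) \<partial>M)"
    by (intro nn_integral_cong) (auto split: split_indicator)
  finally show ?thesis .
qed

text \<open>The minimum switches branches at t = B/C. Below, the integrand is C t^(-b) and
  contributes 1/a times the product of powers; above, it is B t^(-b-1) and contributes 1/b times the
  same product. This is the kernel by which real interpolation recovers a geometric mean.\<close>

lemma nn_integral_min_powr:
  fixes B C :: real
  assumes BC: "0 \<le> B" "0 \<le> C" and ab: "0 < a" "0 < b" "a + b = 1"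
  shows "(\<integral>\<^sup>+t. ennreal (min B (t * C) * t powr (- b - 1)) * indicator {0..} t \<partial>lborel)
     = ennreal ((1/a + 1/b) * (B powr a * C powr b))"
proof (cases "B = 0 \<or> C = 0")
  case True
  then have "(\<integral>\<^sup>+t. ennreal (min B (t * C) * t powr (- b - 1)) * indicator {0..} t \<partial>lborel) = (\<integral>\<^sup>+t. 0 \<partial>(lborel :: real measure))"
    using BC by (intro nn_integral_cong) (auto split: split_indicator simp: min_def)
  then show ?thesis using True ab by auto
next
  case False
  then have B: "B > 0" and C: "C > 0" using BC by auto
  define r where "r = B / C"
  have r: "r > 0" using B C by (simp add: r_def)
  define h where "h t = min B (t * C) * t powr (- b - 1)" for t
  have "((\<lambda>t. C * t powr (- b)) has_integral (C * (r powr (- b + 1) / (- b + 1)))) {0..r}"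
    using has_integral_powr_from_0[of "-b" r] r ab by (intro has_integral_mult_right) auto
  moreover have "C * t powr (- b) = h t" if "t \<in> {0..r}" for t
  proof (cases "t = 0")
    case False
    then have "t > 0" using that by auto
    moreover have "t * C \<le> B" using that C by (simp add: r_def field_simps)
    ultimately have "h t = C * (t powr 1 * t powr (-b-1))" by (simp add: h_def)
    also have "\<dots> = C * t powr (-b)" by (subst powr_add[symmetric]) simp
    finally show ?thesis by simp
  qed (use ab in \<open>auto simp: h_def\<close>)
  ultimately have 1: "(h has_integral (C * (r powr (- b + 1) / (- b + 1)))) {0..r}"
    by (rule has_integral_eq[rotated])
  have "((\<lambda>t. B * t powr (- b - 1)) has_integral (B * (- (r powr (- b - 1 + 1)) / (- b - 1 + 1)))) {r..}"
    using r ab by (intro has_integral_mult_right has_integral_powr_to_inf) auto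
  moreover have "B * t powr (- b - 1) = h t" if "t \<in> {r..}" for t
    using that C by (auto simp: h_def r_def field_simps min_def)
  ultimately have 2: "(h has_integral (B * (- (r powr (- b - 1 + 1)) / (- b - 1 + 1)))) {r..}"
    by (rule has_integral_eq[rotated])
  have U: "{0..r} \<union> {r..} = {0..}" using r by auto
  have "{0..r} \<inter> {r..} = {r}" using r by auto
  then have "(h has_integral (C * (r powr (- b + 1) / (- b + 1)) + B * (- (r powr (- b - 1 + 1)) / (- b - 1 + 1)))) {0..}"
    using has_integral_Un[OF 1 2] U by auto
  moreover have "C * (r powr (- b + 1) / (- b + 1)) = 1/a * (B powr a * C powr b)"
  proof -
    have e: "- b + 1 = a" using ab by simp
    have "C * r powr a = B powr a * C powr b"
    proof -
      have "C = C powr a * C powr b" using C ab by (subst powr_add[symmetric]) simp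
      then have "C * r powr a = (C powr a * r powr a) * C powr b" by (simp add: mult_ac)
      also have "C powr a * r powr a = B powr a" using B C by (simp add: r_def powr_mult[symmetric])
      finally show ?thesis .
    qed
    then show ?thesis unfolding e by simp
  qed
  moreover have "B * (- (r powr (- b - 1 + 1)) / (- b - 1 + 1)) = 1/b * (B powr a * C powr b)"
  proof -
    have "B * r powr (-b) = B powr a * C powr b"
    proof -
      have "B = B powr a * B powr b" using B ab by (subst powr_add[symmetric]) simp
      then have "B * r powr (-b) = B powr a * (B powr b * r powr (-b))" by (simp add: mult_ac)
      also have "B powr b * r powr (-b) = C powr b" using B C by (simp add: r_def powr_divide powr_minus field_simps)
      finally show ?thesis .
    qed
    then show ?thesis by (simp add: field_simps)
  qed
  ultimately have H: "(h has_integral ((1/a + 1/b) * (B powr a * C powr b))) {0..}"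
    by (simp only: distrib_right)
  have "(\<integral>\<^sup>+t. ennreal (indicator {0..} t * h t) \<partial>lborel) = ennreal ((1/a + 1/b) * (B powr a * C powr b))"
    by (rule nn_integral_has_integral_lebesgue[OF _ H]) (use BC in \<open>auto simp: h_def\<close>)
  also have "(\<integral>\<^sup>+t. ennreal (indicator {0..} t * h t) \<partial>lborel)
     = (\<integral>\<^sup>+t. ennreal (min B (t * C) * t powr (- b - 1)) * indicator {0..} t \<partial>lborel)"
    by (intro nn_integral_cong) (auto simp: h_def split: split_indicator)
  finally show ?thesis .
qed

section \<open>Half-open dyadic cubes\<close>

text \<open>Half-open sides let the dyadic children partition a cube exactly. The closed cubes of
  the A_p condition differ from these by a null set only.\<close>

definition hc :: "'a::euclidean_space \<Rightarrow> real \<Rightarrow> 'a set" where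
  "hc a l = {x. \<forall>b\<in>Basis. a \<bullet> b \<le> x \<bullet> b \<and> x \<bullet> b < a \<bullet> b + l}"

text \<open>Cubes are represented by their lower corners. A subset of the basis lists the
  coordinates in which the corner is shifted by half the side.\<close>

definition children :: "'a::euclidean_space \<Rightarrow> real \<Rightarrow> 'a set" where
  "children a l = (\<lambda>S. a + (l/2) *\<^sub>R \<Sum>S) ` Pow Basis"

text \<open>The recursion splits off the top generation, so that inductions pass from a cube to its
  children, as stopping arguments require. The common side \<open>l / 2^n\<close> stays
  implicit.\<close>

primrec grid :: "nat \<Rightarrow> 'a::euclidean_space \<Rightarrow> real \<Rightarrow> 'a set" where
  "grid 0 a l = {a}"
| "grid (Suc n) a l = (\<Union>c\<in>children a l. grid n c (l/2))"

lemma finite_children [simp]: "finite (children a l)"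
  by (simp add: children_def)

lemma finite_grid [simp]: "finite (grid n a l)"
  by (induction n arbitrary: a l) auto

lemma inner_Sum_Basis:
  assumes "S \<subseteq> Basis" "b \<in> Basis"
  shows "(\<Sum>S) \<bullet> b = (if b \<in> S then 1 else 0)"
proof -
  have "finite S" using assms finite_subset finite_Basis by blast
  have "(\<Sum>S) \<bullet> b = (\<Sum>i\<in>S. i \<bullet> b)" by (simp add: inner_sum_left)
  also have "\<dots> = (\<Sum>i\<in>S. if i = b then 1 else 0)"
    using assms by (intro sum.cong) (auto simp: inner_Basis)
  also have "\<dots> = (if b \<in> S then 1 else 0)" using \<open>finite S\<close> by simp
  finally show ?thesis .
qed

lemma hc_eq_UN_children: "hc a l = (\<Union>c\<in>children a l. hc c (l/2))"
proof (intro set_eqI iffI)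
  fix x assume x: "x \<in> hc a l"
  \<comment> \<open>The coordinates in which \<open>x\<close> lies in the upper half of the
    cube.\<close>
  define S where "S = {b\<in>Basis. a \<bullet> b + l/2 \<le> x \<bullet> b}"
  have S: "S \<subseteq> Basis" by (auto simp: S_def)
  have "x \<in> hc (a + (l/2) *\<^sub>R \<Sum>S) (l/2)"
    using x S by (auto simp: hc_def inner_add_left inner_Sum_Basis) (auto simp: S_def)
  then show "x \<in> (\<Union>c\<in>children a l. hc c (l/2))" using S by (auto simp: children_def)
next
  fix x assume "x \<in> (\<Union>c\<in>children a l. hc c (l/2))"
  then obtain S where S: "S \<subseteq> Basis" "x \<in> hc (a + (l/2) *\<^sub>R \<Sum>S) (l/2)" by (auto simp: children_def)
  show "x \<in> hc a l"
    unfolding hc_def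
  proof (intro CollectI ballI)
    fix b :: 'a assume b: "b \<in> Basis"
    have "a \<bullet> b + (l/2) * (if b \<in> S then 1 else 0) \<le> x \<bullet> b" "x \<bullet> b < a \<bullet> b + (l/2) * (if b \<in> S then 1 else 0) + l/2"
      using S b by (auto simp: hc_def inner_add_left inner_Sum_Basis)
    then show "a \<bullet> b \<le> x \<bullet> b \<and> x \<bullet> b < a \<bullet> b + l" by (auto split: if_splits)
  qed
qed

lemma disjoint_hc_children: "disjoint_family_on (\<lambda>c. hc c (l/2)) (children a l)"
proof -
  have *: "hc (a + (l/2) *\<^sub>R \<Sum>S) (l/2) \<inter> hc (a + (l/2) *\<^sub>R \<Sum>S') (l/2) = {}"
    if S: "S \<subseteq> Basis" "S' \<subseteq> Basis" "b \<in> S" "b \<notin> S'" for S S' and b :: 'a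
  proof -
    have b: "b \<in> Basis" using S by auto
    have "x \<notin> hc (a + (l/2) *\<^sub>R \<Sum>S') (l/2)" if "x \<in> hc (a + (l/2) *\<^sub>R \<Sum>S) (l/2)" for x
    proof -
      have "a \<bullet> b + l/2 \<le> x \<bullet> b" using that S b by (auto simp: hc_def inner_add_left inner_Sum_Basis)
      moreover have "\<not> a \<bullet> b + l/2 \<le> x \<bullet> b" if "x \<in> hc (a + (l/2) *\<^sub>R \<Sum>S') (l/2)"
        using that S b by (force simp: hc_def inner_add_left inner_Sum_Basis)
      ultimately show ?thesis by blast
    qed
    then show ?thesis by auto
  qed
  show ?thesis
    unfolding disjoint_family_on_def children_def
  proof (intro ballI impI)
    fix c c' assume "c \<in> (\<lambda>S. a + (l/2) *\<^sub>R \<Sum>S) ` Pow Basis" "c' \<in> (\<lambda>S. a + (l/2) *\<^sub>R \<Sum>S) ` Pow Basis"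
      and ne: "c \<noteq> c'"
    then obtain S S' where S: "S \<subseteq> Basis" "S' \<subseteq> Basis" "c = a + (l/2) *\<^sub>R \<Sum>S" "c' = a + (l/2) *\<^sub>R \<Sum>S'" by auto
    with ne have "S \<noteq> S'" by auto
    then obtain b where "b \<in> S \<and> b \<notin> S' \<or> b \<in> S' \<and> b \<notin> S" by blast
    then show "hc c (l/2) \<inter> hc c' (l/2) = {}" using *[of S S' b] *[of S' S b] S by blast
  qed
qed

lemma hc_nonempty: "l > 0 \<Longrightarrow> a \<in> hc a l"
  by (simp add: hc_def)

lemma hc_eq_UN_grid: "hc a l = (\<Union>c\<in>grid n a l. hc c (l/2^n))"
proof (induction n arbitrary: a l)
  case (Suc n)
  have "hc a l = (\<Union>c\<in>children a l. hc c (l/2))" by (rule hc_eq_UN_children)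
  also have "\<dots> = (\<Union>c\<in>children a l. \<Union>d\<in>grid n c (l/2). hc d (l/2/2^n))" by (simp only: Suc[symmetric])
  finally show ?case by (simp add: divide_divide_eq_left)
qed simp

lemma grid_subset: "c \<in> grid n a l \<Longrightarrow> hc c (l/2^n) \<subseteq> hc a l"
  using hc_eq_UN_grid[of a l n] by auto

lemma children_subset: "c \<in> children a l \<Longrightarrow> hc c (l/2) \<subseteq> hc a l"
  using hc_eq_UN_children[of a l] by auto

lemma disjoint_hc_grid: "disjoint_family_on (\<lambda>c. hc c (l/2^n)) (grid n a l)"
proof (induction n arbitrary: a l)
  case (Suc n)
  show ?case
    unfolding disjoint_family_on_def
  proof (intro ballI impI)
    fix c c' assume "c \<in> grid (Suc n) a l" "c' \<in> grid (Suc n) a l" and ne: "c \<noteq> c'"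
    then obtain d d' where d: "d \<in> children a l" "d' \<in> children a l" "c \<in> grid n d (l/2)" "c' \<in> grid n d' (l/2)"
      by auto
    have e: "l/2/2^n = l/2^Suc n" by simp
    show "hc c (l/2^Suc n) \<inter> hc c' (l/2^Suc n) = {}"
    proof (cases "d = d'")
      case True
      then show ?thesis using Suc[of "l/2" d] d ne unfolding e by (auto simp: disjoint_family_on_def)
    next
      case False
      then have "hc d (l/2) \<inter> hc d' (l/2) = {}" using disjoint_hc_children[of l a] d by (auto simp: disjoint_family_on_def)
      then show ?thesis using grid_subset[OF d(3)] grid_subset[OF d(4)] unfolding e by blast
    qed
  qed
qed (auto simp: disjoint_family_on_def)

text \<open>No corner is counted twice: for \<open>l > 0\<close> each corner belongs to its own
  half-open cube, and cubes below different children are disjoint.\<close>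

lemma sum_grid_Suc:
  assumes "l > 0"
  shows "(\<Sum>c\<in>grid (Suc n) a l. h c) = (\<Sum>c\<in>children a l. \<Sum>d\<in>grid n c (l/2). h d)"
proof -
  have "grid n c (l/2) \<inter> grid n c' (l/2) = {}" if "c \<in> children a l" "c' \<in> children a l" "c \<noteq> c'" for c c'
  proof (rule ccontr)
    assume "grid n c (l/2) \<inter> grid n c' (l/2) \<noteq> {}"
    then obtain d where d: "d \<in> grid n c (l/2)" "d \<in> grid n c' (l/2)" by auto
    have "d \<in> hc d (l/2/2^n)" using assms by (intro hc_nonempty) auto
    then have "d \<in> hc c (l/2) \<inter> hc c' (l/2)" using grid_subset[OF d(1)] grid_subset[OF d(2)] by blast
    then show False using disjoint_hc_children[of l a] that by (auto simp: disjoint_family_on_def)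
  qed
  then show ?thesis by (subst grid.simps, subst sum.UNION_disjoint) auto
qed

section \<open>Measurability and Lebesgue measure of half-open cubes\<close>

lemma hc_borel [measurable]: "hc a l \<in> sets borel"
proof -
  have "hc a l = (\<Inter>b\<in>Basis. {x. a \<bullet> b \<le> x \<bullet> b} \<inter> {x. x \<bullet> b < a \<bullet> b + l})" by (auto simp: hc_def)
  also have "\<dots> \<in> sets borel" by (intro sets.finite_INT) auto
  finally show ?thesis .
qed

lemma hc_lebesgue [measurable]: "hc a l \<in> sets lebesgue"
  using hc_borel by (simp add: sets_completionI_sets)

lemma hc_subset_cube: "hc a l \<subseteq> cube a l"
  by (auto simp: hc_def cube_def mem_box inner_add_left less_imp_le)

lemma AE_hc_cube: "AE x in lebesgue. x \<in> hc a l \<longleftrightarrow> x \<in> cube a l"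
proof (rule AE_I')
  have "negligible (cube a l - box a (a + l *\<^sub>R One))"
    using negligible_frontier_interval unfolding cube_def by blast
  then show "cube a l - box a (a + l *\<^sub>R One) \<in> null_sets lebesgue" by (simp add: negligible_iff_null_sets)
  have "box a (a + l *\<^sub>R One) \<subseteq> hc a l" by (auto simp: hc_def mem_box inner_add_left less_imp_le)
  then show "{x \<in> space lebesgue. (x \<in> hc a l) \<noteq> (x \<in> cube a l)} \<subseteq> cube a l - box a (a + l *\<^sub>R One)"
    using hc_subset_cube by blast
qed

lemma emeasure_hc: "l \<ge> 0 \<Longrightarrow> emeasure lebesgue (hc a l :: 'a::euclidean_space set) = ennreal (l ^ DIM('a))"
proof -
  assume l: "l \<ge> 0"
  have "emeasure lebesgue (hc a l) = emeasure lebesgue (cube a l)"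
    by (rule emeasure_eq_AE[OF AE_hc_cube]) (auto simp: cube_def)
  also have "\<dots> = ennreal (l ^ DIM('a))"
    using l by (simp add: cube_def emeasure_lborel_cbox inner_add_left algebra_simps)
  finally show ?thesis .
qed

lemma measure_hc: "l \<ge> 0 \<Longrightarrow> measure lebesgue (hc a l :: 'a::euclidean_space set) = l ^ DIM('a)"
  unfolding measure_def by (subst emeasure_hc) auto

lemma measure_cube: "l \<ge> 0 \<Longrightarrow> measure lebesgue (cube a l :: 'a::euclidean_space set) = l ^ DIM('a)"
  by (simp add: cube_def inner_add_left algebra_simps)

lemma nn_integral_cube_eq_hc: "(\<integral>\<^sup>+x\<in>cube a l. f x \<partial>lebesgue) = (\<integral>\<^sup>+x\<in>hc a l. f x \<partial>lebesgue)"
  using AE_hc_cube[of a l] by (intro nn_integral_cong_AE) (auto elim!: eventually_mono split: split_indicator)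

lemma bounded_subset_hc:
  fixes K :: "'a::euclidean_space set"
  assumes "bounded K"
  obtains n :: nat where "K \<subseteq> hc (- (2^n) *\<^sub>R One) (2 * 2^n)"
proof -
  obtain B where B: "\<And>x. x \<in> K \<Longrightarrow> norm x \<le> B" using assms by (auto simp: bounded_iff)
  obtain n :: nat where n: "B < 2^n" using real_arch_pow[of 2 B] by auto
  have "x \<in> hc (- (2^n) *\<^sub>R One) (2 * 2^n)" if "x \<in> K" for x
  proof -
    have "\<bar>x \<bullet> b\<bar> < 2^n" if "b \<in> Basis" for b
      using Basis_le_norm[OF that, of x] B[OF \<open>x \<in> K\<close>] n by linarith
    then show ?thesis by (fastforce simp: hc_def abs_less_iff)
  qed
  then show ?thesis by (intro that) auto
qed

section \<open>Density of continuous functions\<close>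

definition big_cube :: "nat \<Rightarrow> 'a::euclidean_space set" where
  "big_cube n = hc (- (2^n) *\<^sub>R One) (2 * 2^n)"

lemma big_cube_sets [measurable]: "big_cube n \<in> sets lebesgue"
  by (simp add: big_cube_def)

lemma mem_big_cube: "x \<in> big_cube n \<longleftrightarrow> (\<forall>b\<in>Basis. - (2^n) \<le> x \<bullet> b \<and> x \<bullet> b < 2^n)"
  by (auto simp: big_cube_def hc_def)

lemma big_cube_mono: "m \<le> n \<Longrightarrow> big_cube m \<subseteq> big_cube n"
proof
  fix x :: 'a assume mn: "m \<le> n" and x: "x \<in> big_cube m"
  have "(2::real)^m \<le> 2^n" using mn by (intro power_increasing) auto
  moreover have "- (2^m) \<le> x \<bullet> b \<and> x \<bullet> b < 2^m" if "b \<in> Basis" for b using x that by (auto simp: mem_big_cube)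
  ultimately show "x \<in> big_cube n" unfolding mem_big_cube by (meson le_less_trans less_le_trans neg_le_iff_le order_trans)
qed

lemma bounded_subset_big_cube: "bounded K \<Longrightarrow> \<exists>n. K \<subseteq> big_cube n"
  using bounded_subset_hc[of K] unfolding big_cube_def by metis

lemma bounded_big_cube: "bounded (big_cube n)"
  unfolding big_cube_def by (rule bounded_subset[OF _ hc_subset_cube]) (auto simp: cube_def)

section \<open>Powers of weighted norms as extended nonnegative integrals\<close>

abbreviation modular :: "'b measure \<Rightarrow> real \<Rightarrow> ('b \<Rightarrow> real) \<Rightarrow> ('b \<Rightarrow> 'c::real_normed_vector) \<Rightarrow> ennreal" where
  "modular M q w f \<equiv> (\<integral>\<^sup>+x. ennreal (norm (f x) powr q * w x) \<partial>M)"

abbreviation mass :: "('a::euclidean_space \<Rightarrow> real) \<Rightarrow> 'a set \<Rightarrow> ennreal" where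
  "mass u R \<equiv> (\<integral>\<^sup>+x\<in>R. ennreal (u x) \<partial>lebesgue)"

text \<open>The sum is at most twice the larger summand. This substitute for the triangle inequality
  works with powers of norms throughout, at the price of the factor \<open>2 powr q\<close>.\<close>

lemma norm_add_powr_le:
  fixes a b :: "'b::real_normed_vector"
  assumes "q > 0"
  shows "norm (a + b) powr q \<le> 2 powr q * (norm a powr q + norm b powr q)"
proof -
  have *: "norm (a + b) powr q \<le> 2 powr q * (norm a powr q + norm b powr q)" if "norm a \<le> norm b" for a b :: 'b
  proof -
    have "norm (a + b) \<le> 2 * norm b" using norm_triangle_ineq[of a b] that by simp
    then have "norm (a + b) powr q \<le> (2 * norm b) powr q" using assms by (intro powr_mono2) auto
    also have "\<dots> = 2 powr q * norm b powr q" by (simp add: powr_mult)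
    also have "\<dots> \<le> 2 powr q * (norm a powr q + norm b powr q)" by (intro mult_left_mono) auto
    finally show ?thesis .
  qed
  show ?thesis using *[of a b] *[of b a] by (cases "norm a \<le> norm b") (auto simp: add.commute)
qed

lemma nn_integral_norm_add_powr_le:
  fixes f g :: "'c \<Rightarrow> 'b::euclidean_space"
  assumes q: "q > 0" and [measurable]: "f \<in> borel_measurable M" "g \<in> borel_measurable M" "w \<in> borel_measurable M"
    and w: "AE x in M. 0 \<le> w x"
  shows "modular M q w (\<lambda>x. f x + g x)
    \<le> ennreal (2 powr q) * (modular M q w f + modular M q w g)"
proof -
  have "modular M q w (\<lambda>x. f x + g x)
     \<le> (\<integral>\<^sup>+x. ennreal (2 powr q) * (ennreal (norm (f x) powr q * w x) + ennreal (norm (g x) powr q * w x)) \<partial>M)"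
    using w
  proof (intro nn_integral_mono_AE, eventually_elim)
    case (elim x)
    have "norm (f x + g x) powr q * w x \<le> (2 powr q * (norm (f x) powr q + norm (g x) powr q)) * w x"
      using elim norm_add_powr_le[OF q] by (intro mult_right_mono) auto
    also have "\<dots> = 2 powr q * (norm (f x) powr q * w x + norm (g x) powr q * w x)" by (simp add: algebra_simps)
    finally have "ennreal (norm (f x + g x) powr q * w x) \<le> ennreal (2 powr q * (norm (f x) powr q * w x + norm (g x) powr q * w x))"
      by (rule ennreal_leI)
    also have "\<dots> = ennreal (2 powr q) * (ennreal (norm (f x) powr q * w x) + ennreal (norm (g x) powr q * w x))"
      using elim by (subst ennreal_plus[symmetric]) (auto simp: ennreal_mult)
    finally show ?case .
  qed
  also have "\<dots> = ennreal (2 powr q) * (modular M q w f + modular M q w g)"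
    by (subst nn_integral_cmult, measurable, subst nn_integral_add, measurable)
  finally show ?thesis .
qed

lemma ennreal_tendsto_0I:
  fixes f :: "'c \<Rightarrow> ennreal"
  assumes "\<And>e::real. e > 0 \<Longrightarrow> eventually (\<lambda>i. f i \<le> ennreal e) F"
  shows "(f \<longlongrightarrow> 0) F"
proof (rule order_tendstoI)
  fix a :: ennreal assume "0 < a"
  then obtain b where b: "0 < b" "b < a" using dense by blast
  then have "b < top" using less_le_trans top_greatest by blast
  then obtain e where e: "b = ennreal e" "e > 0" using b(1) by (cases b) auto
  show "eventually (\<lambda>i. f i < a) F"
    using assms[OF e(2)] by eventually_elim (use b e in auto)
qed auto

lemma ennreal_tendsto_0D:
  fixes f :: "'c \<Rightarrow> ennreal"
  assumes "(f \<longlongrightarrow> 0) F" "e > 0"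
  shows "eventually (\<lambda>i. f i < ennreal e) F"
  using order_tendstoD(2)[OF assms(1)] assms(2) by simp

text \<open>The common ground of a weight, its dual weight and the constant 1. Nonnegativity is
  imposed almost everywhere only, in keeping with the definition of a weight.\<close>

definition loc_fin :: "('a::euclidean_space \<Rightarrow> real) \<Rightarrow> bool" where
  "loc_fin u \<longleftrightarrow> u \<in> borel_measurable lebesgue \<and> (AE x in lebesgue. 0 \<le> u x) \<and>
     (\<forall>a l. (mass u (hc a l)) < \<infinity>)"

text \<open>\<open>f\<close> is truncated in size and support. Measurability of the truncation then
  yields continuous functions that converge off a negligible set but obey no bound; projecting their
  values onto a ball with \<open>closest_point\<close> and multiplying by a continuous cutoff
  supplies the dominating function and the bounded support without changing the limit.\<close>

lemma continuous_dense_Lp: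
  fixes f :: "'a::euclidean_space \<Rightarrow> 'b::euclidean_space"
  assumes u: "loc_fin u" and q: "q > 0" and f[measurable]: "f \<in> borel_measurable lebesgue"
    and fin: "modular lebesgue q u f < \<infinity>" and e: "e > 0"
  obtains g where "continuous_on UNIV g" "bounded {x. g x \<noteq> 0}"
    "modular lebesgue q u (\<lambda>x. f x - g x) \<le> ennreal e"
proof -
  have [measurable]: "u \<in> borel_measurable lebesgue" and u0: "AE x in lebesgue. 0 \<le> u x"
    and ufin: "\<And>a l. (mass u (hc a l)) < \<infinity>"
    using u by (auto simp: loc_fin_def)
  \<comment> \<open>Truncation and continuous approximation each cost \<open>d\<close>, and adding
    them costs the factor \<open>2 powr q\<close>.\<close>
  define d where "d = e / 2 / 2 powr q"
  have d: "d > 0" using e by (simp add: d_def)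
  define F where "F k x = (if norm (f x) \<le> real k \<and> x \<in> big_cube k then f x else 0)" for k x
  have [measurable]: "F k \<in> borel_measurable lebesgue" for k
    unfolding F_def by measurable
  have "(\<lambda>k. \<integral>\<^sup>+x. ennreal (norm (f x - F k x) powr q * u x) \<partial>lebesgue) \<longlonglongrightarrow> (\<integral>\<^sup>+x. 0 \<partial>(lebesgue :: 'a measure))"
  proof (rule nn_integral_dominated_convergence[where w = "\<lambda>x. ennreal (norm (f x) powr q * u x)"])
    show "AE x in lebesgue. ennreal (norm (f x - F j x) powr q * u x) \<le> ennreal (norm (f x) powr q * u x)" for j
      using u0 by eventually_elim (auto simp: F_def intro!: ennreal_leI mult_right_mono)
    show "AE x in lebesgue. (\<lambda>k. ennreal (norm (f x - F k x) powr q * u x)) \<longlonglongrightarrow> 0"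
    proof (intro AE_I2 tendsto_eventually)
      fix x :: 'a
      obtain n where n: "x \<in> big_cube n" using bounded_subset_big_cube[of "{x}"] by auto
      have "\<forall>\<^sub>F k in sequentially. k \<ge> max n (nat \<lceil>norm (f x)\<rceil>)" by (rule eventually_ge_at_top)
      then show "\<forall>\<^sub>F k in sequentially. ennreal (norm (f x - F k x) powr q * u x) = 0"
      proof eventually_elim
        case (elim k)
        then have "x \<in> big_cube k" "norm (f x) \<le> real k" using n big_cube_mono[of n k] by (auto simp: nat_le_iff ceiling_le_iff)
        then show ?case using q by (simp add: F_def)
      qed
    qed
  qed (use fin in auto)
  then have "(\<lambda>k. \<integral>\<^sup>+x. ennreal (norm (f x - F k x) powr q * u x) \<partial>lebesgue) \<longlonglongrightarrow> 0" by simp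
  from eventually_happens[OF ennreal_tendsto_0D[OF this d]]
  obtain k where k: "modular lebesgue q u (\<lambda>x. f x - F k x) < ennreal d" by auto
  have "F k measurable_on UNIV" by (intro lebesgue_measurable_imp_measurable_on) auto
  then obtain N g where N: "negligible N" and gc: "\<And>n. continuous_on UNIV (g n)"
    and g: "\<And>x. x \<notin> N \<Longrightarrow> (\<lambda>n. g n x) \<longlonglongrightarrow> F k x"
    by (auto simp: measurable_on_def)
  \<comment> \<open>Equal to 1 on \<open>big_cube k\<close>, where the truncation lives, and 0 at
    distance at least 1 from it.\<close>
  define cut where "cut x = max 0 (1 - infdist x (big_cube k))" for x :: 'a
  have cut_c: "continuous_on UNIV cut" unfolding cut_def by (intro continuous_intros)
  have cut1: "cut x = 1" if "x \<in> big_cube k" for x using that by (simp add: cut_def)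
  have cut01: "0 \<le> cut x" "cut x \<le> 1" for x using infdist_nonneg[of x "big_cube k"] by (auto simp: cut_def)
  define G where "G n x = cut x *\<^sub>R closest_point (cball 0 (real k)) (g n x)" for n x
  have Gc: "continuous_on UNIV (G n)" for n
    unfolding G_def
    by (intro continuous_intros cut_c continuous_on_compose2[OF continuous_on_closest_point gc]) auto
  have [measurable]: "G n \<in> borel_measurable lebesgue" for n
    using borel_measurable_continuous_onI[OF Gc] by (simp add: measurable_completion)
  have "bounded {x. cut x \<noteq> 0}"
  proof -
    obtain B where B: "\<And>x. x \<in> (big_cube k :: 'a set) \<Longrightarrow> norm x \<le> B" using bounded_big_cube[of k] by (auto simp: bounded_iff)
    have ne: "big_cube k \<noteq> ({} :: 'a set)" using big_cube_def hc_nonempty by (metis empty_iff mult_pos_pos zero_less_numeral zero_less_power)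
    have "norm x \<le> B + 1" if "cut x \<noteq> 0" for x
    proof -
      have "infdist x (big_cube k) < 1" using that by (auto simp: cut_def max_def split: if_splits)
      then obtain y where "y \<in> big_cube k" "dist x y < 1"
        using ne by (auto simp: infdist_notempty cInf_less_iff)
      then show ?thesis using B[of y] norm_triangle_ineq2[of x y] by (auto simp: dist_norm)
    qed
    then show ?thesis by (auto simp: bounded_iff)
  qed
  then obtain m where m: "{x. cut x \<noteq> 0} \<subseteq> big_cube m" using bounded_subset_big_cube by blast
  have km: "x \<in> big_cube m" if "x \<in> big_cube k" for x :: 'a using cut1[OF that] m by auto
  have Gm: "G n x = 0" if "x \<notin> big_cube m" for n x using that m by (auto simp: G_def)
  have cpk: "norm (closest_point (cball 0 (real k)) y) \<le> real k" for y :: 'b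
    using closest_point_in_set[of "cball 0 (real k)" y] by auto
  have Gb: "norm (G n x) \<le> real k" for n x
  proof -
    have "norm (G n x) \<le> 1 * real k" unfolding G_def norm_scaleR
      using cut01[of x] cpk by (intro mult_mono) auto
    then show ?thesis by simp
  qed
  have "(\<lambda>n. \<integral>\<^sup>+x. ennreal (norm (F k x - G n x) powr q * u x) \<partial>lebesgue) \<longlonglongrightarrow> (\<integral>\<^sup>+x. 0 \<partial>(lebesgue :: 'a measure))"
  proof (rule nn_integral_dominated_convergence[where w = "\<lambda>x. ennreal ((2 * real k) powr q) * (ennreal (u x) * indicator (big_cube m) x)"])
    show "AE x in lebesgue. ennreal (norm (F k x - G j x) powr q * u x) \<le> ennreal ((2 * real k) powr q) * (ennreal (u x) * indicator (big_cube m) x)" for j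
      using u0
    proof eventually_elim
      case (elim x)
      show ?case
      proof (cases "x \<in> big_cube m")
        case True
        have "norm (F k x - G j x) \<le> 2 * real k"
          using norm_triangle_ineq4[of "F k x" "G j x"] Gb[of j x] by (auto simp: F_def split: if_splits)
        then have "norm (F k x - G j x) powr q * u x \<le> (2 * real k) powr q * u x"
          using elim q by (intro mult_right_mono powr_mono2) auto
        then show ?thesis using True by (simp add: ennreal_mult'[symmetric] ennreal_leI elim)
      next
        case False
        then have "F k x = 0" "G j x = 0" using km Gm by (auto simp: F_def)
        then show ?thesis using q by simp
      qed
    qed
    have "(\<integral>\<^sup>+x. ennreal (u x) * indicator (big_cube m) x \<partial>lebesgue) < \<infinity>" using ufin unfolding big_cube_def by blast
    then show "(\<integral>\<^sup>+x. ennreal ((2 * real k) powr q) * (ennreal (u x) * indicator (big_cube m) x) \<partial>lebesgue) < \<infinity>"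
      by (simp add: nn_integral_cmult ennreal_mult_less_top)
    show "AE x in lebesgue. (\<lambda>n. ennreal (norm (F k x - G n x) powr q * u x)) \<longlonglongrightarrow> 0"
    proof -
      have "AE x in lebesgue. x \<notin> N" using N by (intro AE_not_in) (auto simp: negligible_iff_null_sets)
      then show ?thesis
      proof eventually_elim
        case (elim x)
        have cF: "closest_point (cball 0 (real k)) (F k x) = F k x"
          by (rule closest_point_self) (auto simp: F_def)
        have "(\<lambda>n. closest_point (cball 0 (real k)) (g n x)) \<longlonglongrightarrow> closest_point (cball 0 (real k)) (F k x)"
          using g[OF elim] continuous_at_closest_point[of "cball 0 (real k)" "F k x"] isCont_tendsto_compose by fastforce
        then have "(\<lambda>n. G n x) \<longlonglongrightarrow> cut x *\<^sub>R F k x" unfolding G_def cF by (intro tendsto_intros)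
        moreover have "cut x *\<^sub>R F k x = F k x" using cut1 by (auto simp: F_def)
        ultimately have "(\<lambda>n. norm (F k x - G n x)) \<longlonglongrightarrow> norm (F k x - F k x)" by (intro tendsto_intros) auto
        then have "(\<lambda>n. norm (F k x - G n x) powr q) \<longlonglongrightarrow> 0"
          using q by (intro tendsto_zero_powrI[where b = q]) auto
        then have "(\<lambda>n. norm (F k x - G n x) powr q * u x) \<longlonglongrightarrow> 0 * u x" by (intro tendsto_mult tendsto_const)
        then have "(\<lambda>n. ennreal (norm (F k x - G n x) powr q * u x)) \<longlonglongrightarrow> ennreal (0 * u x)" by (rule tendsto_ennrealI)
        then show ?case by simp
      qed
    qed
  qed auto
  then have "(\<lambda>n. \<integral>\<^sup>+x. ennreal (norm (F k x - G n x) powr q * u x) \<partial>lebesgue) \<longlonglongrightarrow> 0" by simp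
  from eventually_happens[OF ennreal_tendsto_0D[OF this d]]
  obtain n where n: "modular lebesgue q u (\<lambda>x. F k x - G n x) < ennreal d" by auto
  have "modular lebesgue q u (\<lambda>x. f x - G n x)
     = modular lebesgue q u (\<lambda>x. (f x - F k x) + (F k x - G n x))" by simp
  also have "\<dots> \<le> ennreal (2 powr q) * (modular lebesgue q u (\<lambda>x. f x - F k x) + modular lebesgue q u (\<lambda>x. F k x - G n x))"
    using q u0 by (intro nn_integral_norm_add_powr_le) auto
  also have "\<dots> \<le> ennreal (2 powr q) * (ennreal d + ennreal d)"
    using k n by (intro mult_left_mono add_mono) auto
  also have "\<dots> = ennreal e" using d by (simp add: ennreal_plus[symmetric] ennreal_mult'[symmetric] d_def field_simps del: ennreal_plus)
  finally have "modular lebesgue q u (\<lambda>x. f x - G n x) \<le> ennreal e" .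
  moreover have "bounded {x. G n x \<noteq> 0}"
    by (rule bounded_subset[OF bounded_big_cube[of m]]) (use Gm in auto)
  ultimately show ?thesis using Gc that by blast
qed

section \<open>Dyadic averages\<close>

definition mean :: "'a::euclidean_space set \<Rightarrow> ('a \<Rightarrow> complex) \<Rightarrow> complex" where
  "mean R f = (LINT y:R|lebesgue. f y) /\<^sub>R measure lebesgue R"

text \<open>The conditional expectation on the n-th dyadic generation inside \<open>hc a l\<close>,
  extended by 0. At every point at most one summand is nonzero.\<close>

definition dyavg :: "nat \<Rightarrow> 'a::euclidean_space \<Rightarrow> real \<Rightarrow> ('a \<Rightarrow> complex) \<Rightarrow> 'a \<Rightarrow> complex" where
  "dyavg n a l f x = (\<Sum>c\<in>grid n a l. if x \<in> hc c (l/2^n) then mean (hc c (l/2^n)) f else 0)"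

text \<open>A local form of the uniform boundedness of dyadic averages: it also covers \<open>q = 1\<close>, \<open>u = 1\<close>, which
  is what the reverse Hoelder inequality needs.\<close>

definition cell_bound :: "real \<Rightarrow> ('a::euclidean_space \<Rightarrow> real) \<Rightarrow> real \<Rightarrow> bool" where
  "cell_bound q u K \<longleftrightarrow> (\<forall>c r f. 0 < r \<longrightarrow> f \<in> borel_measurable lebesgue \<longrightarrow>
     (mass (\<lambda>x. norm (f x :: complex) powr q * u x) (hc c r)) < \<infinity> \<longrightarrow>
     set_integrable lebesgue (hc c r) f \<and>
     ennreal (norm (mean (hc c r) f) powr q) * mass u (hc c r)
       \<le> ennreal K * mass (\<lambda>x. norm (f x) powr q * u x) (hc c r))"

lemma cell_boundD:
  assumes "cell_bound q u K" "0 < r" "f \<in> borel_measurable lebesgue"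
    "mass (\<lambda>x. norm (f x) powr q * u x) (hc c r) < \<infinity>"
  shows "set_integrable lebesgue (hc c r) f"
    and "ennreal (norm (mean (hc c r) f) powr q) * mass u (hc c r)
       \<le> ennreal K * mass (\<lambda>x. norm (f x) powr q * u x) (hc c r)"
  using assms unfolding cell_bound_def by simp_all

lemma sum_grid_if:
  assumes "c \<in> grid n a l" "x \<in> hc c (l/2^n)"
  shows "(\<Sum>d\<in>grid n a l. if x \<in> hc d (l/2^n) then h d else 0) = h c"
proof -
  have "x \<notin> hc d (l/2^n)" if "d \<in> grid n a l" "d \<noteq> c" for d
    using disjoint_hc_grid[of l n a] that assms by (auto simp: disjoint_family_on_def)
  then have "(\<Sum>d\<in>grid n a l. if x \<in> hc d (l/2^n) then h d else 0) = (\<Sum>d\<in>grid n a l. if d = c then h d else 0)"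
    using assms by (intro sum.cong) auto
  then show ?thesis using assms by simp
qed

lemma grid_cases:
  assumes "x \<in> hc a l"
  obtains c where "c \<in> grid n a l" "x \<in> hc c (l/2^n)"
  using assms hc_eq_UN_grid[of a l n] by auto

lemma dyavg_eq_mean: "c \<in> grid n a l \<Longrightarrow> x \<in> hc c (l/2^n) \<Longrightarrow> dyavg n a l f x = mean (hc c (l/2^n)) f"
  unfolding dyavg_def by (rule sum_grid_if)

lemma dyavg_outside: "x \<notin> hc a l \<Longrightarrow> dyavg n a l f x = 0"
  unfolding dyavg_def using grid_subset[of _ n a l] by (intro sum.neutral) auto

lemma dyavg_measurable [measurable]: "dyavg n a l f \<in> borel_measurable lebesgue"
  unfolding dyavg_def by measurable

lemma nn_integral_grid:
  assumes [measurable]: "F \<in> borel_measurable lebesgue"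
  shows "(\<integral>\<^sup>+x\<in>hc a l. F x \<partial>lebesgue) = (\<Sum>c\<in>grid n a l. \<integral>\<^sup>+x\<in>hc c (l/2^n). F x \<partial>lebesgue)"
proof -
  have "(\<integral>\<^sup>+x\<in>hc a l. F x \<partial>lebesgue) = (\<integral>\<^sup>+x. (\<Sum>c\<in>grid n a l. F x * indicator (hc c (l/2^n)) x) \<partial>lebesgue)"
  proof (intro nn_integral_cong)
    fix x :: 'a
    have e: "F x * indicator (hc c (l/2^n)) x = (if x \<in> hc c (l/2^n) then F x else 0)" for c by auto
    show "F x * indicator (hc a l) x = (\<Sum>c\<in>grid n a l. F x * indicator (hc c (l/2^n)) x)"
    proof (cases "x \<in> hc a l")
      case True
      then obtain c where "c \<in> grid n a l" "x \<in> hc c (l/2^n)" by (rule grid_cases)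
      then show ?thesis unfolding e using sum_grid_if[of c n a l x "\<lambda>_. F x"] True by simp
    next
      case False
      then show ?thesis using grid_subset[of _ n a l] by (auto intro!: sum.neutral[symmetric] simp: indicator_def)
    qed
  qed
  also have "\<dots> = (\<Sum>c\<in>grid n a l. \<integral>\<^sup>+x\<in>hc c (l/2^n). F x \<partial>lebesgue)"
    by (rule nn_integral_sum) measurable
  finally show ?thesis .
qed

lemma nn_integral_dyavg_powr:
  assumes [measurable]: "u \<in> borel_measurable lebesgue" and q: "q > 0"
  shows "modular lebesgue q u (dyavg n a l f)
    = (\<Sum>c\<in>grid n a l. ennreal (norm (mean (hc c (l/2^n)) f) powr q) * mass u (hc c (l/2^n)))"
proof -
  have "modular lebesgue q u (dyavg n a l f)
     = mass (\<lambda>x. norm (dyavg n a l f x) powr q * u x) (hc a l)"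
    using q by (intro nn_integral_cong) (auto simp: dyavg_outside indicator_def)
  also have "\<dots> = (\<Sum>c\<in>grid n a l. \<integral>\<^sup>+x\<in>hc c (l/2^n). ennreal (norm (dyavg n a l f x) powr q * u x) \<partial>lebesgue)"
    by (rule nn_integral_grid) measurable
  also have "\<dots> = (\<Sum>c\<in>grid n a l. \<integral>\<^sup>+x. ennreal (norm (mean (hc c (l/2^n)) f) powr q) * (ennreal (u x) * indicator (hc c (l/2^n)) x) \<partial>lebesgue)"
    by (intro sum.cong nn_integral_cong) (auto simp: dyavg_eq_mean ennreal_mult' indicator_def)
  also have "\<dots> = (\<Sum>c\<in>grid n a l. ennreal (norm (mean (hc c (l/2^n)) f) powr q) * mass u (hc c (l/2^n)))"
    by (intro sum.cong refl nn_integral_cmult) measurable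
  finally show ?thesis .
qed

lemma set_nn_integral_less_top_mono:
  assumes "(\<integral>\<^sup>+x\<in>B. F x \<partial>M) < (\<infinity>::ennreal)" "A \<subseteq> B"
  shows "(\<integral>\<^sup>+x\<in>A. F x \<partial>M) < \<infinity>"
  using nn_set_integral_set_mono[OF assms(2)] assms(1) by (rule le_less_trans)

text \<open>The cells are disjoint and the average is constant on each, so the estimate on one cell
  sums up without loss in the constant.\<close>

lemma dyavg_bound:
  assumes cb: "cell_bound q u K" and [measurable]: "u \<in> borel_measurable lebesgue" "f \<in> borel_measurable lebesgue"
    and q: "q > 0" and l: "l > 0"
    and fin: "mass (\<lambda>x. norm (f x) powr q * u x) (hc a l) < \<infinity>"
  shows "modular lebesgue q u (dyavg n a l f)
    \<le> ennreal K * mass (\<lambda>x. norm (f x) powr q * u x) (hc a l)"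
proof -
  have "modular lebesgue q u (dyavg n a l f)
      \<le> (\<Sum>c\<in>grid n a l. ennreal K * mass (\<lambda>x. norm (f x) powr q * u x) (hc c (l/2^n)))"
    unfolding nn_integral_dyavg_powr[OF assms(2) q]
  proof (intro sum_mono)
    fix c assume c: "c \<in> grid n a l"
    have "mass (\<lambda>x. norm (f x) powr q * u x) (hc c (l/2^n)) < \<infinity>"
      by (rule set_nn_integral_less_top_mono[OF fin grid_subset[OF c]])
    then show "ennreal (norm (mean (hc c (l/2^n)) f) powr q) * mass u (hc c (l/2^n))
      \<le> ennreal K * mass (\<lambda>x. norm (f x) powr q * u x) (hc c (l/2^n))"
      using l by (intro cell_boundD[OF cb]) auto
  qed
  also have "\<dots> = ennreal K * mass (\<lambda>x. norm (f x) powr q * u x) (hc a l)"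
    by (subst nn_integral_grid[where n = n]) (auto simp: sum_distrib_left)
  finally show ?thesis .
qed

lemma mean_diff:
  assumes "set_integrable lebesgue R f" "set_integrable lebesgue R g"
  shows "mean R (\<lambda>x. f x - g x) = mean R f - mean R g"
  unfolding mean_def using assms by (simp add: scaleR_diff_right)

lemma dyavg_diff:
  assumes "\<And>c. c \<in> grid n a l \<Longrightarrow> set_integrable lebesgue (hc c (l/2^n)) f"
    and "\<And>c. c \<in> grid n a l \<Longrightarrow> set_integrable lebesgue (hc c (l/2^n)) g"
  shows "dyavg n a l (\<lambda>x. f x - g x) x = dyavg n a l f x - dyavg n a l g x"
  unfolding dyavg_def sum_subtractf[symmetric] using assms by (intro sum.cong) (auto simp: mean_diff)

lemma mean_close:
  fixes g :: "'a::euclidean_space \<Rightarrow> complex"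
  assumes r: "r > 0" and int: "set_integrable lebesgue (hc c r) g"
    and e: "\<And>y. y \<in> hc c r \<Longrightarrow> norm (g y - z) \<le> e"
  shows "norm (mean (hc c r) g - z) \<le> e"
proof -
  let ?R = "hc c r"
  have m: "measure lebesgue ?R = r ^ DIM('a)" using r by (intro measure_hc) auto
  have mp: "measure lebesgue ?R > 0" using r m by simp
  have fin: "emeasure lebesgue ?R < \<infinity>" using r by (subst emeasure_hc) auto
  have ci: "set_integrable lebesgue ?R (\<lambda>_. k)" for k :: complex
    unfolding set_integrable_def using fin by (intro integrable_scaleR_left integrable_real_indicator) auto
  have ci': "set_integrable lebesgue ?R (\<lambda>_. k)" for k :: real
    unfolding set_integrable_def using fin by (intro integrable_scaleR_left integrable_real_indicator) auto
  have "mean ?R (\<lambda>_. z) = z"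
    using mp fin by (simp add: mean_def set_lebesgue_integral_def)
  then have "mean ?R g - z = mean ?R (\<lambda>y. g y - z)" using int ci by (simp add: mean_diff)
  also have "norm \<dots> = norm (LINT y:?R|lebesgue. g y - z) / measure lebesgue ?R"
    using mp by (simp add: mean_def divide_inverse mult.commute)
  also have "norm (LINT y:?R|lebesgue. g y - z) \<le> (LINT y:?R|lebesgue. norm (g y - z))"
    using int ci by (intro set_integral_norm_bound) auto
  also have "(LINT y:?R|lebesgue. norm (g y - z)) \<le> (LINT y:?R|lebesgue. e)"
    using int ci ci' e by (intro set_integral_mono set_integrable_norm) auto
  also have "(LINT y:?R|lebesgue. e) = e * measure lebesgue ?R"
    using fin by (simp add: set_lebesgue_integral_def)
  finally show ?thesis using mp by (simp add: divide_right_mono)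
qed

lemma dist_hc_le:
  fixes c :: "'a::euclidean_space"
  assumes "x \<in> hc c r" "y \<in> hc c r"
  shows "dist x y \<le> r * DIM('a)"
proof -
  have "norm (x - y) \<le> (\<Sum>b\<in>Basis. \<bar>(x - y) \<bullet> b\<bar>)" by (rule norm_le_l1)
  also have "\<dots> \<le> (\<Sum>b\<in>(Basis::'a set). r)"
    using assms by (intro sum_mono) (auto simp: hc_def inner_diff_left abs_le_iff; smt (verit))
  finally show ?thesis by (simp add: dist_norm mult.commute)
qed

text \<open>For a continuous \<open>g\<close> of bounded support the averages converge uniformly as
  the mesh shrinks; the uniform bound \<open>K\<close> on the averages carries this over to
  \<open>f\<close> by density. The cubes themselves may move and grow arbitrarily, which is why the
  integral is taken over the cube of averaging.\<close>

lemma dyavg_tendsto: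
  fixes u :: "'a::euclidean_space \<Rightarrow> real"
  assumes u: "loc_fin u" and q: "q > 0" and cb: "cell_bound q u K" and K: "K \<ge> 0"
    and f[measurable]: "f \<in> borel_measurable lebesgue"
    and fin: "modular lebesgue q u f < \<infinity>"
    and l: "\<And>i. l i > 0" and mesh: "(\<lambda>i. l i / 2 ^ n i) \<longlonglongrightarrow> 0"
  shows "(\<lambda>i. \<integral>\<^sup>+x\<in>hc (a i) (l i). ennreal (norm (dyavg (n i) (a i) (l i) f x - f x) powr q * u x) \<partial>lebesgue) \<longlonglongrightarrow> 0"
proof (rule ennreal_tendsto_0I)
  fix e :: real assume e: "e > 0"
  have um[measurable]: "u \<in> borel_measurable lebesgue" and u0: "AE x in lebesgue. 0 \<le> u x"
    and ufin: "\<And>a l. (mass u (hc a l)) < \<infinity>"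
    using u by (auto simp: loc_fin_def)
  define t where "t = 2 powr q"
  have t: "t > 0" by (simp add: t_def)
  \<comment> \<open>The terms with \<open>f - g\<close> and with its average add up to
    \<open>t * t * (K + 1) * d = e/2\<close>.\<close>
  define d where "d = e / (2 * t * t * (K + 1))"
  have d: "d > 0" using e t K by (simp add: d_def)
  obtain g where gc: "continuous_on UNIV g" and gb: "bounded {x. g x \<noteq> 0}"
    and gd: "modular lebesgue q u (\<lambda>x. f x - g x) \<le> ennreal d"
    using continuous_dense_Lp[OF u q f fin d] by metis
  have [measurable]: "g \<in> borel_measurable lebesgue"
    using borel_measurable_continuous_onI[OF gc] by (simp add: measurable_completion)
  have gint: "set_integrable lebesgue (hc c r) g" for c r
  proof -
    have "set_integrable lebesgue (cube c r) g"
      unfolding cube_def using continuous_on_subset[OF gc] absolutely_integrable_continuous by blast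
    then show ?thesis by (rule set_integrable_subset) (use hc_subset_cube in auto)
  qed
  obtain B where B: "\<And>x. g x \<noteq> 0 \<Longrightarrow> norm x \<le> B" using gb by (auto simp: bounded_iff)
  obtain m where m: "cball 0 (B + 1) \<subseteq> (big_cube m :: 'a set)" using bounded_subset_big_cube[of "cball 0 (B+1)"] by auto
  define U where "U = enn2real (mass u (big_cube m))"
  have U: "mass u (big_cube m) = ennreal U" "U \<ge> 0"
    using ufin unfolding U_def big_cube_def by (auto simp: less_top[symmetric])
  \<comment> \<open>A uniform error \<open>h\<close> on a set of weight \<open>U\<close> then
    contributes at most \<open>e/2\<close>; the 1 in \<open>U + 1\<close> avoids a division by
    zero.\<close>
  define h where "h = (e / (2 * t * (U + 1))) powr (1/q)"
  have h: "h > 0" using e t U by (simp add: h_def)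
  have hq: "h powr q = e / (2 * t * (U + 1))" using q e t U by (simp add: h_def powr_powr)
  have "uniformly_continuous_on (cball 0 (B + 2)) g"
    using gc by (intro compact_uniformly_continuous continuous_on_subset[OF gc]) auto
  then obtain s where s: "s > 0" "\<And>x y. x \<in> cball 0 (B+2) \<Longrightarrow> y \<in> cball 0 (B+2) \<Longrightarrow> dist y x < s \<Longrightarrow> dist (g y) (g x) < h"
    using h unfolding uniformly_continuous_on_def by metis
  have near: "norm (g y - g x) \<le> h" if "dist y x < min s 1" for x y
  proof (cases "norm x \<le> B + 1")
    case True
    then have "norm y \<le> B + 2" using that norm_triangle_ineq2[of y x] by (auto simp: dist_norm)
    then show ?thesis using s(2)[of x y] that True by (auto simp: dist_norm)
  next
    case False
    then have "\<not> norm y \<le> B" "\<not> norm x \<le> B" using that norm_triangle_ineq2[of x y] by (auto simp: dist_norm norm_minus_commute)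
    then have "g x = 0" "g y = 0" using B by blast+
    then show ?thesis using h by simp
  qed
  \<comment> \<open>Two points of a cube of side r are at distance at most r times the
    dimension.\<close>
  define \<delta> where "\<delta> = min s 1 / DIM('a)"
  have "\<delta> > 0" using s by (simp add: \<delta>_def)
  then have "\<forall>\<^sub>F i in sequentially. l i / 2 ^ n i < \<delta>" using order_tendstoD(2)[OF mesh] by blast
  then show "\<forall>\<^sub>F i in sequentially. (mass (\<lambda>x. norm (dyavg (n i) (a i) (l i) f x - f x) powr q * u x) (hc (a i) (l i))) \<le> ennreal e"
  proof eventually_elim
    case (elim i)
    let ?A = "dyavg (n i) (a i) (l i)" and ?Q = "hc (a i) (l i)"
    have rp: "l i / 2 ^ n i > 0" using l by simp
    have fint: "set_integrable lebesgue (hc c (l i / 2 ^ n i)) f" for c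
    proof -
      have "mass (\<lambda>x. norm (f x) powr q * u x) (hc c (l i / 2 ^ n i)) < \<infinity>"
        by (rule set_nn_integral_less_top_mono[OF _ subset_UNIV]) (use fin in simp)
      then show ?thesis by (rule cell_boundD(1)[OF cb rp f])
    qed
    have dist: "dist x y < min s 1" if "x \<in> hc c (l i / 2 ^ n i)" "y \<in> hc c (l i / 2 ^ n i)" for x y c :: 'a
    proof -
      have "dist x y \<le> l i / 2 ^ n i * DIM('a)" using that by (rule dist_hc_le)
      also have "\<dots> < \<delta> * DIM('a)" using elim by (intro mult_strict_right_mono) auto
      also have "\<dots> = min s 1" by (simp add: \<delta>_def)
      finally show ?thesis .
    qed
    have Ag: "norm (?A g x - g x) \<le> h" "x \<notin> big_cube m \<Longrightarrow> ?A g x - g x = 0" if x: "x \<in> ?Q" for x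
    proof -
      obtain c where c: "c \<in> grid (n i) (a i) (l i)" "x \<in> hc c (l i / 2 ^ n i)" using grid_cases[OF x] .
      have eq: "?A g x = mean (hc c (l i / 2 ^ n i)) g" by (rule dyavg_eq_mean[OF c])
      show "norm (?A g x - g x) \<le> h" unfolding eq
        using near dist c(2) by (intro mean_close[OF rp gint]) auto
      assume "x \<notin> big_cube m"
      then have nx: "\<not> norm x \<le> B + 1" using m by auto
      have g0: "g y = 0" if "y \<in> hc c (l i / 2 ^ n i)" for y
      proof -
        have "dist x y < 1" using dist[OF c(2) that] by simp
        then have "\<not> norm y \<le> B" using nx norm_triangle_ineq2[of x y] by (auto simp: dist_norm)
        then show ?thesis using B by blast
      qed
      have "norm (mean (hc c (l i / 2 ^ n i)) g - 0) \<le> 0"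
        using g0 by (intro mean_close[OF rp gint]) auto
      then show "?A g x - g x = 0" using g0[OF c(2)] by (simp add: eq)
    qed
    have fin': "mass (\<lambda>x. norm (f x - g x) powr q * u x) ?Q \<le> ennreal d"
    proof -
      have "mass (\<lambda>x. norm (f x - g x) powr q * u x) ?Q \<le> modular lebesgue q u (\<lambda>x. f x - g x)"
        by (intro nn_integral_mono) (auto simp: indicator_def)
      also note gd
      finally show ?thesis .
    qed
    have I1: "mass (\<lambda>x. norm (?A (\<lambda>x. f x - g x) x) powr q * u x) ?Q \<le> ennreal (K * d)"
    proof -
      have "mass (\<lambda>x. norm (?A (\<lambda>x. f x - g x) x) powr q * u x) ?Q
        \<le> modular lebesgue q u (\<lambda>x. ?A (\<lambda>x. f x - g x) x)"
        by (intro nn_integral_mono) (auto simp: indicator_def)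
      also have "\<dots> \<le> ennreal K * mass (\<lambda>x. norm (f x - g x) powr q * u x) ?Q"
        using fin' by (intro dyavg_bound[OF cb um _ q l]) (auto simp: le_less_trans)
      also have "\<dots> \<le> ennreal K * ennreal d" using fin' by (intro mult_left_mono) auto
      finally show ?thesis using K d by (simp add: ennreal_mult)
    qed
    have I2: "mass (\<lambda>x. norm (?A g x - g x) powr q * u x) ?Q \<le> ennreal (h powr q * U)"
    proof -
      have "mass (\<lambda>x. norm (?A g x - g x) powr q * u x) ?Q
         \<le> (\<integral>\<^sup>+x. ennreal (h powr q) * (ennreal (u x) * indicator (big_cube m) x) \<partial>lebesgue)"
        using u0
      proof (intro nn_integral_mono_AE, eventually_elim)
        case (elim x)
        show ?case
        proof (cases "x \<in> ?Q \<and> x \<in> big_cube m")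
          case True
          then have "norm (?A g x - g x) powr q * u x \<le> h powr q * u x"
            using Ag q elim by (intro mult_right_mono powr_mono2) auto
          then show ?thesis using True elim by (simp add: ennreal_mult'[symmetric] ennreal_leI)
        next
          case False
          then show ?thesis using Ag(2)[of x] q by (auto simp: indicator_def)
        qed
      qed
      also have "\<dots> = ennreal (h powr q * U)" using U by (simp add: nn_integral_cmult ennreal_mult)
      finally show ?thesis .
    qed
    \<comment> \<open>With A the averaging operator, A f - f is split as (A g - g) + A (f - g) + (g
      - f). The indicators keep all three pieces on the cube, where the estimates hold.\<close>
    have "mass (\<lambda>x. norm (?A f x - f x) powr q * u x) ?Q
        = modular lebesgue q u (\<lambda>x. (?A g x - g x) * indicator ?Q x + (?A (\<lambda>x. f x - g x) x * indicator ?Q x + (g x - f x) * indicator ?Q x))"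
      using q by (intro nn_integral_cong) (auto simp: dyavg_diff[OF fint gint] indicator_def algebra_simps)
    also have "\<dots> \<le> ennreal t * (modular lebesgue q u (\<lambda>x. (?A g x - g x) * indicator ?Q x)
       + modular lebesgue q u (\<lambda>x. ?A (\<lambda>x. f x - g x) x * indicator ?Q x + (g x - f x) * indicator ?Q x))"
      unfolding t_def using q u0 by (intro nn_integral_norm_add_powr_le) auto
    also have "\<dots> \<le> ennreal t * (modular lebesgue q u (\<lambda>x. (?A g x - g x) * indicator ?Q x)
       + ennreal t * (modular lebesgue q u (\<lambda>x. ?A (\<lambda>x. f x - g x) x * indicator ?Q x)
         + modular lebesgue q u (\<lambda>x. (g x - f x) * indicator ?Q x)))"
      unfolding t_def using q u0 by (intro mult_left_mono add_mono nn_integral_norm_add_powr_le) auto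
    also have "\<dots> = ennreal t * (mass (\<lambda>x. norm (?A g x - g x) powr q * u x) ?Q
       + ennreal t * (mass (\<lambda>x. norm (?A (\<lambda>x. f x - g x) x) powr q * u x) ?Q
         + mass (\<lambda>x. norm (f x - g x) powr q * u x) ?Q))"
      using q by (intro arg_cong2[where f = "(*)"] arg_cong2[where f = "(+)"] refl nn_integral_cong) (auto simp: indicator_def norm_minus_commute)
    also have "\<dots> \<le> ennreal t * (ennreal (h powr q * U) + ennreal t * (ennreal (K * d) + ennreal d))"
      using I1 I2 fin' by (intro mult_left_mono add_mono) auto
    also have "\<dots> = ennreal (t * (h powr q * U + t * (K * d + d)))"
      using t K d U by (simp add: ennreal_mult[symmetric] ennreal_plus[symmetric] del: ennreal_plus)
    also have "t * (h powr q * U + t * (K * d + d)) = e/2 * (U / (U + 1)) + e/2"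
    proof -
      have "t * (h powr q * U) = e/2 * (U / (U + 1))" unfolding hq using t U(2) by (simp add: divide_simps)
      moreover have "t * (t * (K * d + d)) = e/2"
      proof -
        define N where "N = t * t * (K + 1)"
        have N: "N > 0" using t K by (simp add: N_def)
        have "t * (t * (K * d + d)) = (t * t * (K + 1)) * d" by (simp add: algebra_simps)
        also have "\<dots> = N * (e / (2 * N))" by (simp add: N_def d_def mult_ac)
        also have "\<dots> = e/2" using N by simp
        finally show ?thesis .
      qed
      ultimately show ?thesis by (simp add: distrib_left)
    qed
    also have "ennreal (e/2 * (U / (U + 1)) + e/2) \<le> ennreal e"
    proof (rule ennreal_leI)
      have "U / (U + 1) \<le> 1" using U by simp
      then have "e/2 * (U / (U + 1)) \<le> e/2 * 1" using e by (intro mult_left_mono) auto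
      then show "e/2 * (U / (U + 1)) + e/2 \<le> e" by linarith
    qed
    finally show ?case .
  qed
qed

section \<open>Pairs of dual weights\<close>

text \<open>Defined through a measure, so that additivity and subtraction come from measure theory.
  Being real-valued, it represents the integral faithfully only where that is finite, as on
  measurable subsets of cubes for locally finite \<open>u\<close>.\<close>

definition wt :: "('a::euclidean_space \<Rightarrow> real) \<Rightarrow> 'a set \<Rightarrow> real" where
  "wt u E = measure (density lebesgue (\<lambda>x. ennreal (u x))) E"

section \<open>Weighted measure of subsets of a cube\<close>

lemma loc_finD:
  assumes "loc_fin u"
  shows "u \<in> borel_measurable lebesgue" "AE x in lebesgue. 0 \<le> u x"
    "mass u (hc a l) < \<infinity>"
  using assms by (auto simp: loc_fin_def)

lemma wt_nonneg [simp]: "wt u E \<ge> 0"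
  by (simp add: wt_def)

lemma nn_integral_eq_wt:
  assumes u: "loc_fin u" and E: "E \<in> sets lebesgue" "E \<subseteq> hc a l"
  shows "mass u E = ennreal (wt u E)"
proof -
  have [measurable]: "u \<in> borel_measurable lebesgue" using loc_finD[OF u] by simp
  have "mass u E < \<infinity>"
    by (rule set_nn_integral_less_top_mono[OF loc_finD(3)[OF u] E(2)])
  then show ?thesis
    using E by (simp add: wt_def measure_def emeasure_density less_top[symmetric])
qed

lemma emeasure_density_hc:
  assumes u: "loc_fin u" and E: "E \<in> sets lebesgue" "E \<subseteq> hc a l"
  shows "emeasure (density lebesgue (\<lambda>x. ennreal (u x))) E \<noteq> \<infinity>"
  using nn_integral_eq_wt[OF assms] loc_finD(1)[OF u] E by (simp add: emeasure_density)

lemma wt_mono: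
  assumes "loc_fin u" "E \<in> sets lebesgue" "F \<in> sets lebesgue" "E \<subseteq> F" "F \<subseteq> hc a l"
  shows "wt u E \<le> wt u F"
proof -
  have "ennreal (wt u E) \<le> ennreal (wt u F)"
    using nn_integral_eq_wt[OF assms(1), of E a l] nn_integral_eq_wt[OF assms(1), of F a l] assms
      nn_set_integral_set_mono[OF assms(4), of lebesgue "\<lambda>x. ennreal (u x)"] by auto
  then show ?thesis by simp
qed

lemma wt_UN:
  assumes "loc_fin u" "finite I" "disjoint_family_on E I" "\<And>i. i \<in> I \<Longrightarrow> E i \<in> sets lebesgue"
    "\<And>i. i \<in> I \<Longrightarrow> E i \<subseteq> hc a l"
  shows "wt u (\<Union>i\<in>I. E i) = (\<Sum>i\<in>I. wt u (E i))"
  unfolding wt_def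
  by (rule measure_finite_Union) (use assms emeasure_density_hc[OF assms(1), of _ a l] in auto)

lemma wt_Diff:
  assumes "loc_fin u" "E \<in> sets lebesgue" "E \<subseteq> hc a l"
  shows "wt u (hc a l - E) = wt u (hc a l) - wt u E"
  unfolding wt_def
  by (rule measure_Diff) (use assms emeasure_density_hc[OF assms(1), of "hc a l" a l] in auto)

lemma measure_UN_hc:
  assumes "finite I" "disjoint_family_on E I" "\<And>i. i \<in> I \<Longrightarrow> E i \<in> sets lebesgue"
    "\<And>i. i \<in> I \<Longrightarrow> E i \<subseteq> hc a l" "l > 0"
  shows "measure lebesgue (\<Union>i\<in>I. E i) = (\<Sum>i\<in>I. measure lebesgue (E i))"
proof (rule measure_finite_Union)
  fix i assume i: "i \<in> I"
  have "emeasure lebesgue (E i) \<le> emeasure lebesgue (hc a l)" using assms i by (intro emeasure_mono) auto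
  then show "emeasure lebesgue (E i) \<noteq> \<infinity>"
    using assms(5) by (subst (asm) emeasure_hc) (auto simp: top_unique)
qed (use assms in auto)

text \<open>In applications \<open>v = u\<^bsup>-1/(p-1)\<^esup>\<close>. Keeping \<open>v\<close> as a parameter makes the condition symmetric under
  \<open>u \<leftrightarrow> v\<close>, \<open>p \<leftrightarrow> p'\<close>.\<close>

definition Ap_pair :: "real \<Rightarrow> ('a::euclidean_space \<Rightarrow> real) \<Rightarrow> ('a \<Rightarrow> real) \<Rightarrow> real \<Rightarrow> bool" where
  "Ap_pair p u v K \<longleftrightarrow> 1 < p \<and> loc_fin u \<and> loc_fin v \<and> (AE x in lebesgue. 1 \<le> u x * v x powr (p - 1)) \<and> 0 < K \<and>
     (\<forall>a l. 0 < l \<longrightarrow> wt u (hc a l) * wt v (hc a l) powr (p - 1) \<le> K * (l ^ DIM('a)) powr p)"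

lemma Ap_pair_Hoelder:
  fixes u v :: "'a::euclidean_space \<Rightarrow> real" and f :: "'a \<Rightarrow> complex"
  assumes A: "Ap_pair p u v K" and [measurable]: "f \<in> borel_measurable lebesgue" and E: "E \<in> sets lebesgue" "E \<subseteq> hc a l"
    and F: "mass (\<lambda>x. norm (f x) powr p * u x) E \<le> ennreal F" "F \<ge> 0"
  shows "(\<integral>\<^sup>+x\<in>E. ennreal (norm (f x)) \<partial>lebesgue) \<le> ennreal (F powr (1/p) * wt v E powr (1 - 1/p))"
proof -
  have p: "p > 1" and u: "loc_fin u" and v: "loc_fin v" and uv: "AE x in lebesgue. 1 \<le> u x * v x powr (p - 1)"
    using A by (auto simp: Ap_pair_def)
  have [measurable]: "u \<in> borel_measurable lebesgue" "v \<in> borel_measurable lebesgue" using loc_finD[OF u] loc_finD[OF v] by auto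
  note u0 = loc_finD(2)[OF u] and v0 = loc_finD(2)[OF v]
  have "(\<integral>\<^sup>+x\<in>E. ennreal (norm (f x)) \<partial>lebesgue)
      \<le> mass (\<lambda>x. (norm (f x) powr p * u x) powr (1/p) * v x powr (1 - 1/p)) E"
    using uv u0 v0
  proof (intro nn_integral_mono_AE, eventually_elim)
    case (elim x)
    have "1 \<le> (u x * v x powr (p - 1)) powr (1/p)" using elim p by (intro ge_one_powr_ge_zero) auto
    also have "\<dots> = u x powr (1/p) * v x powr (1 - 1/p)" using elim p by (simp add: powr_mult powr_powr diff_divide_distrib)
    finally have "norm (f x) * 1 \<le> norm (f x) * (u x powr (1/p) * v x powr (1 - 1/p))" by (intro mult_left_mono) auto
    also have "\<dots> = (norm (f x) powr p * u x) powr (1/p) * v x powr (1 - 1/p)"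
      using elim p by (simp add: powr_mult powr_powr)
    finally show ?case by (intro mult_right_mono ennreal_leI) auto
  qed
  also have "\<dots> \<le> ennreal (F powr (1/p) * wt v E powr (1 - 1/p))"
  proof (rule set_nn_integral_Hoelder_le)
    show "AE x in lebesgue. 0 \<le> norm (f x) powr p * u x" using u0 by eventually_elim auto
    show "mass v E \<le> ennreal (wt v E)" using nn_integral_eq_wt[OF v E] by simp
  qed (use p E F v0 in auto)
  finally show ?thesis .
qed

lemma mean_bound:
  fixes f :: "'a::euclidean_space \<Rightarrow> complex"
  assumes [measurable]: "f \<in> borel_measurable lebesgue" and l: "l > 0"
    and A: "(\<integral>\<^sup>+x\<in>hc a l. ennreal (norm (f x)) \<partial>lebesgue) \<le> ennreal A" "A \<ge> 0"
  shows "set_integrable lebesgue (hc a l) f" "norm (mean (hc a l) f) * l ^ DIM('a) \<le> A"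
proof -
  have eq: "(\<integral>\<^sup>+x. ennreal (norm (indicator (hc a l) x *\<^sub>R f x)) \<partial>lebesgue) = (\<integral>\<^sup>+x\<in>hc a l. ennreal (norm (f x)) \<partial>lebesgue)"
    by (intro nn_integral_cong) (auto simp: indicator_def)
  show i: "set_integrable lebesgue (hc a l) f"
    unfolding set_integrable_def
  proof (rule integrableI_bounded)
    show "(\<integral>\<^sup>+x. ennreal (norm (indicator (hc a l) x *\<^sub>R f x)) \<partial>lebesgue) < \<infinity>"
      unfolding eq using A(1) by (rule le_less_trans) auto
  qed auto
  have "ennreal (norm (LINT y:hc a l|lebesgue. f y)) \<le> (\<integral>\<^sup>+x. ennreal (norm (indicator (hc a l) x *\<^sub>R f x)) \<partial>lebesgue)"
    unfolding set_lebesgue_integral_def by (rule integral_norm_bound_ennreal) (use i in \<open>simp add: set_integrable_def\<close>)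
  then have "ennreal (norm (LINT y:hc a l|lebesgue. f y)) \<le> ennreal A" unfolding eq using A(1) by (rule order_trans)
  then have "norm (LINT y:hc a l|lebesgue. f y) \<le> A" using A(2) by simp
  moreover have "norm (mean (hc a l) f) * l ^ DIM('a) = norm (LINT y:hc a l|lebesgue. f y)"
    using l by (simp only: mean_def measure_hc less_imp_le norm_scaleR) simp
  ultimately show "norm (mean (hc a l) f) * l ^ DIM('a) \<le> A" by simp
qed

text \<open>Raise the Hoelder bound for the mean to the power \<open>p\<close> and multiply by the
  weight of the cube: exactly the A_p product appears, so the A_p constant itself is the
  bound.\<close>

lemma cell_bound_Ap_pair:
  fixes u v :: "'a::euclidean_space \<Rightarrow> real"
  assumes A: "Ap_pair p u v K"
  shows "cell_bound p u K"
  unfolding cell_bound_def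
proof (intro allI impI)
  fix c :: 'a and r :: real and f :: "'a \<Rightarrow> complex"
  assume r: "0 < r" and [measurable]: "f \<in> borel_measurable lebesgue"
    and fin: "mass (\<lambda>x. norm (f x) powr p * u x) (hc c r) < \<infinity>"
  have p: "p > 1" and u: "loc_fin u" and K: "K > 0"
    and AK: "wt u (hc c r) * wt v (hc c r) powr (p - 1) \<le> K * (r ^ DIM('a)) powr p"
    using A r by (auto simp: Ap_pair_def)
  define F where "F = enn2real (mass (\<lambda>x. norm (f x) powr p * u x) (hc c r))"
  have F: "mass (\<lambda>x. norm (f x) powr p * u x) (hc c r) = ennreal F" "F \<ge> 0"
    using fin by (auto simp: F_def less_top[symmetric])
  let ?V = "wt v (hc c r)" and ?U = "wt u (hc c r)"
  have H: "(\<integral>\<^sup>+x\<in>hc c r. ennreal (norm (f x)) \<partial>lebesgue) \<le> ennreal (F powr (1/p) * ?V powr (1 - 1/p))"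
    using F by (intro Ap_pair_Hoelder[OF A]) auto
  note mb = mean_bound[OF _ r H]
  have "(norm (mean (hc c r) f) * r ^ DIM('a)) powr p \<le> (F powr (1/p) * ?V powr (1 - 1/p)) powr p"
    using mb(2) p r by (intro powr_mono2) auto
  also have "\<dots> = F * ?V powr (p - 1)" using p F by (simp add: powr_mult powr_powr algebra_simps)
  finally have *: "norm (mean (hc c r) f) powr p * (r ^ DIM('a)) powr p \<le> F * ?V powr (p - 1)"
    using r by (simp add: powr_mult)
  have "(norm (mean (hc c r) f) powr p * ?U) * (r ^ DIM('a)) powr p \<le> F * (?U * ?V powr (p - 1))"
    using mult_right_mono[OF *, of ?U] by (simp add: mult_ac)
  also have "\<dots> \<le> F * (K * (r ^ DIM('a)) powr p)" using AK F by (intro mult_left_mono) auto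
  finally have "(norm (mean (hc c r) f) powr p * ?U) * (r ^ DIM('a)) powr p \<le> (K * F) * (r ^ DIM('a)) powr p"
    by (simp add: mult_ac)
  then have "norm (mean (hc c r) f) powr p * ?U \<le> K * F" using r by (simp add: mult_le_cancel_right)
  then have "ennreal (norm (mean (hc c r) f) powr p) * ennreal ?U \<le> ennreal K * ennreal F"
    using K F by (simp add: ennreal_mult[symmetric] ennreal_leI)
  then show "set_integrable lebesgue (hc c r) f \<and>
     ennreal (norm (mean (hc c r) f) powr p) * mass u (hc c r)
       \<le> ennreal K * mass (\<lambda>x. norm (f x) powr p * u x) (hc c r)"
    using mb(1) nn_integral_eq_wt[OF u, of "hc c r" c r] F by simp
qed

lemma cell_bound_1: "cell_bound 1 (\<lambda>_ :: 'a::euclidean_space. 1) 1"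
  unfolding cell_bound_def
proof (intro allI impI)
  fix c :: 'a and r :: real and f :: "'a \<Rightarrow> complex"
  assume r: "0 < r" and [measurable]: "f \<in> borel_measurable lebesgue"
    and fin: "mass (\<lambda>x. norm (f x) powr 1 * 1) (hc c r) < \<infinity>"
  define F where "F = enn2real (\<integral>\<^sup>+x\<in>hc c r. ennreal (norm (f x)) \<partial>lebesgue)"
  have F: "(\<integral>\<^sup>+x\<in>hc c r. ennreal (norm (f x)) \<partial>lebesgue) = ennreal F" "F \<ge> 0"
    using fin by (auto simp: F_def less_top[symmetric])
  have mb: "set_integrable lebesgue (hc c r) f" "norm (mean (hc c r) f) * r ^ DIM('a) \<le> F"
    using F by (auto intro!: mean_bound[OF _ r])
  have "(\<integral>\<^sup>+x\<in>hc c r. ennreal 1 \<partial>lebesgue) = emeasure lebesgue (hc c r)" by simp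
  also have "\<dots> = ennreal (r ^ DIM('a))" using r by (intro emeasure_hc) auto
  finally have e: "(\<integral>\<^sup>+x\<in>hc c r. ennreal 1 \<partial>lebesgue) = ennreal (r ^ DIM('a))" .
  show "set_integrable lebesgue (hc c r) f \<and>
     ennreal (norm (mean (hc c r) f) powr 1) * (\<integral>\<^sup>+x\<in>hc c r. ennreal 1 \<partial>lebesgue)
       \<le> ennreal 1 * mass (\<lambda>x. norm (f x) powr 1 * 1) (hc c r)"
    unfolding e using mb r F by (simp add: ennreal_mult[symmetric] ennreal_leI)
qed

section \<open>Reverse Hoelder inequality\<close>

lemma content_hc: "l \<ge> 0 \<Longrightarrow> measure lborel (hc a l :: 'a::euclidean_space set) = l ^ DIM('a)"
  using measure_hc[of l a] by simp

text \<open>Hoelder for the constant function 1 on \<open>E\<close>, raised to the power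
  \<open>p\<close>. A subset of large Lebesgue measure therefore cannot have small weight.\<close>

lemma Ap_pair_measure_powr_le:
  fixes u v :: "'a::euclidean_space \<Rightarrow> real"
  assumes A: "Ap_pair p u v K" and l: "l > 0" and E: "E \<in> sets lebesgue" "E \<subseteq> hc a l"
  shows "measure lebesgue E powr p \<le> wt u E * wt v (hc a l) powr (p - 1)"
proof -
  have p: "p > 1" and u: "loc_fin u" and v: "loc_fin v" using A by (auto simp: Ap_pair_def)
  have "emeasure lebesgue E \<le> emeasure lebesgue (hc a l)" using E by (intro emeasure_mono) auto
  then have fin: "emeasure lebesgue E \<noteq> \<infinity>" using l by (subst (asm) emeasure_hc) (auto simp: top_unique)
  have "(\<integral>\<^sup>+x\<in>E. ennreal (norm ((\<lambda>_. 1 :: complex) x)) \<partial>lebesgue) \<le> ennreal (wt u E powr (1/p) * wt v E powr (1 - 1/p))"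
    using nn_integral_eq_wt[OF u E] E by (intro Ap_pair_Hoelder[OF A]) auto
  then have "emeasure lebesgue E \<le> ennreal (wt u E powr (1/p) * wt v E powr (1 - 1/p))" using E by simp
  then have "measure lebesgue E \<le> wt u E powr (1/p) * wt v E powr (1 - 1/p)"
    using fin by (subst (asm) emeasure_eq_ennreal_measure) auto
  then have "measure lebesgue E powr p \<le> (wt u E powr (1/p) * wt v E powr (1 - 1/p)) powr p"
    using p by (intro powr_mono2) auto
  also have "\<dots> = wt u E * wt v E powr (p - 1)" using p by (simp add: powr_mult powr_powr algebra_simps)
  also have "\<dots> \<le> wt u E * wt v (hc a l) powr (p - 1)"
    using p wt_mono[OF v E(1) hc_lebesgue E(2) order_refl] by (intro mult_left_mono powr_mono2) auto
  finally show ?thesis .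
qed

lemma Ap_pair_wt_pos:
  assumes A: "Ap_pair p u v K" and l: "l > 0"
  shows "wt u (hc a l) > 0"
proof -
  have "0 < measure lebesgue (hc a l) powr p" using l by (subst measure_hc) auto
  also have "\<dots> \<le> wt u (hc a l) * wt v (hc a l) powr (p - 1)" by (rule Ap_pair_measure_powr_le[OF A l]) auto
  finally have "wt u (hc a l) \<noteq> 0" by auto
  then show ?thesis using wt_nonneg[of u "hc a l"] by linarith
qed

text \<open>The complement of \<open>E\<close> fills at least half of the cube, so by the preceding
  comparison and the A_p bound it carries at least the fraction 1/(2^p K) of the weight.\<close>

lemma Ap_pair_wt_le_of_half:
  fixes u v :: "'a::euclidean_space \<Rightarrow> real"
  assumes A: "Ap_pair p u v K" and l: "l > 0" and E: "E \<in> sets lebesgue" "E \<subseteq> hc a l"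
    and half: "measure lebesgue E \<le> l ^ DIM('a) / 2"
  shows "wt u E \<le> (1 - 1 / (2 powr p * K)) * wt u (hc a l)"
proof -
  have p: "p > 1" and u: "loc_fin u" and K: "K > 0"
    and AK: "wt u (hc a l) * wt v (hc a l) powr (p - 1) \<le> K * (l ^ DIM('a)) powr p"
    using A l by (auto simp: Ap_pair_def)
  let ?U = "wt u (hc a l)" and ?V = "wt v (hc a l)" and ?m = "l ^ DIM('a)"
  have fin: "emeasure lebesgue (hc a l) \<noteq> \<infinity>" using l by (subst emeasure_hc) auto
  have m: "measure lebesgue (hc a l - E) = ?m - measure lebesgue E"
    using measure_Diff[OF fin] E l by (simp add: content_hc)
  have "(?m/2) powr p \<le> measure lebesgue (hc a l - E) powr p"
    using half p l unfolding m by (intro powr_mono2) auto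
  also have "\<dots> \<le> wt u (hc a l - E) * ?V powr (p - 1)" using E by (intro Ap_pair_measure_powr_le[OF A l]) auto
  finally have 1: "?m powr p / 2 powr p \<le> (?U - wt u E) * ?V powr (p - 1)"
    using l wt_Diff[OF u E] by (simp add: powr_divide)
  have "?U * (?m powr p / 2 powr p) \<le> ?U * ((?U - wt u E) * ?V powr (p - 1))"
    by (rule mult_left_mono[OF 1]) simp
  also have "\<dots> = (?U - wt u E) * (?U * ?V powr (p - 1))" by (simp add: mult_ac)
  also have "\<dots> \<le> (?U - wt u E) * (K * ?m powr p)"
    using wt_mono[OF u E(1) hc_lebesgue E(2) order_refl] AK by (intro mult_left_mono) auto
  finally have "(?U / 2 powr p) * ?m powr p \<le> ((?U - wt u E) * K) * ?m powr p" by (simp add: mult_ac)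
  then have "?U / 2 powr p \<le> (?U - wt u E) * K" by (rule mult_right_le_imp_le) (use l in simp)
  then have "?U / (2 powr p * K) \<le> ?U - wt u E" using K by (simp add: field_simps)
  then show ?thesis by (simp add: algebra_simps)
qed

text \<open>The case of the empty set in the unit cube, whose weight is positive.\<close>

lemma Ap_pair_const_le_1:
  assumes A: "Ap_pair p u v K"
  shows "1 / (2 powr p * K) \<le> 1"
proof -
  have "wt u {} \<le> (1 - 1 / (2 powr p * K)) * wt u (hc 0 1)" by (rule Ap_pair_wt_le_of_half[OF A]) auto
  then have "0 \<le> (1 - 1 / (2 powr p * K)) * wt u (hc 0 1)" by (simp add: wt_def)
  then show ?thesis using Ap_pair_wt_pos[OF A, of 1 0] by (simp add: zero_le_mult_iff)
qed

text \<open>The union of the maximal dyadic subcubes, down to depth \<open>n\<close>, that satisfy \<open>P\<close>.\<close>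

primrec stop :: "nat \<Rightarrow> ('a::euclidean_space \<Rightarrow> real \<Rightarrow> bool) \<Rightarrow> 'a \<Rightarrow> real \<Rightarrow> 'a set" where
  "stop 0 P a l = (if P a l then hc a l else {})"
| "stop (Suc n) P a l = (if P a l then hc a l else (\<Union>c\<in>children a l. stop n P c (l/2)))"

lemma stop_sets [measurable]: "stop n P a l \<in> sets lebesgue"
  by (induction n arbitrary: a l) (auto intro!: sets.finite_UN)

lemma stop_subset: "stop n P a l \<subseteq> hc a l"
proof (induction n arbitrary: a l)
  case (Suc n)
  have "stop n P c (l/2) \<subseteq> hc a l" if "c \<in> children a l" for c
    using Suc[of c "l/2"] children_subset[OF that] by blast
  then show ?case by auto
qed auto

lemma disjoint_stop_children: "disjoint_family_on (\<lambda>c. stop n P c (l/2)) (children a l)"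
  using disjoint_hc_children[of l a] stop_subset[of n P _ "l/2"] unfolding disjoint_family_on_def by blast

lemma stop_children_subset: "c \<in> children a l \<Longrightarrow> stop n P c (l/2) \<subseteq> hc a l"
  using stop_subset children_subset by blast

lemma wt_children: 
  assumes "loc_fin u"
  shows "(\<Sum>c\<in>children a l. wt u (hc c (l/2))) = wt u (hc a l)"
  unfolding hc_eq_UN_children[of a l]
  by (rule wt_UN[OF assms finite_children disjoint_hc_children, symmetric, of _ _ a l]) (auto intro: children_subset[THEN subsetD])

lemma wt_stop_children:
  "loc_fin u \<Longrightarrow> (\<Sum>c\<in>children a l. wt u (stop n P c (l/2))) = wt u (\<Union>c\<in>children a l. stop n P c (l/2))"
  by (rule wt_UN[symmetric, where a = a and l = l])
    (auto simp: disjoint_stop_children stop_children_subset[THEN subsetD])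

lemma measure_stop_children:
  "l > 0 \<Longrightarrow> (\<Sum>c\<in>children a l. measure lebesgue (stop n P c (l/2))) = measure lebesgue (\<Union>c\<in>children a l. stop n P c (l/2))"
  by (rule measure_UN_hc[symmetric, where a = a and l = l])
    (auto simp: disjoint_stop_children stop_children_subset[THEN subsetD])

text \<open>The weak type estimate for the dyadic maximal function: the selected cubes are disjoint,
  and on each of them the mean of \<open>u\<close> exceeds \<open>L\<close>.\<close>

lemma measure_stop_le:
  fixes u :: "'a::euclidean_space \<Rightarrow> real"
  assumes u: "loc_fin u" and l: "l > 0"
  shows "L * measure lebesgue (stop n (\<lambda>a l. wt u (hc a l) > L * l ^ DIM('a)) a l)
     \<le> wt u (stop n (\<lambda>a l. wt u (hc a l) > L * l ^ DIM('a)) a l)"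
  using l
proof (induction n arbitrary: a l)
  case 0
  then show ?case by (auto simp: content_hc)
next
  case (Suc n)
  let ?P = "\<lambda>a l. wt u (hc a l) > L * l ^ DIM('a)"
  show ?case
  proof (cases "?P a l")
    case True
    then show ?thesis using Suc.prems by (simp add: content_hc)
  next
    case False
    have "L * measure lebesgue (stop (Suc n) ?P a l) = (\<Sum>c\<in>children a l. L * measure lebesgue (stop n ?P c (l/2)))"
      using False Suc.prems by (simp add: sum_distrib_left[symmetric] measure_stop_children)
    also have "\<dots> \<le> (\<Sum>c\<in>children a l. wt u (stop n ?P c (l/2)))"
      using Suc by (intro sum_mono) auto
    also have "\<dots> = wt u (stop (Suc n) ?P a l)"
      using False by (simp add: wt_stop_children[OF u])
    finally show ?thesis .
  qed
qed

text \<open>By induction on the depth: stop at the first cubes on which the mean exceeds twice the mean over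
  the whole cube. They carry at most the fraction \<open>1 - c\<close> of the weight, and on each of them the
  induction hypothesis applies, with loss at most \<open>(2\<cdot>2\<^sup>d)\<^sup>\<delta>\<close> where \<open>d\<close> is the dimension.\<close>

lemma reverse_Hoelder_dyadic:
  fixes u v :: "'a::euclidean_space \<Rightarrow> real"
  assumes A: "Ap_pair p u v K" and d: "d > 0" and c: "c = 1 / (2 powr p * K)"
    and small: "(2 * 2 ^ DIM('a)) powr d * (1 - c) \<le> 1 - c/2"
    and l: "l > 0"
  shows "(\<Sum>b\<in>grid n a l. wt u (hc b (l/2^n)) * (wt u (hc b (l/2^n)) / (l/2^n) ^ DIM('a)) powr d)
    \<le> 2 powr d * 2 / c * (wt u (hc a l) * (wt u (hc a l) / l ^ DIM('a)) powr d)"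
proof -
  \<comment> \<open>The solution of A0 = 2^d + A0 (1 - c/2), which is the equation that closes the
    induction.\<close>
  define A0 where "A0 = 2 powr d * 2 / c"
  define D where "D = (2::real) ^ DIM('a)"
  define J where "J b r = wt u (hc b r) * (wt u (hc b r) / r ^ DIM('a)) powr d" for b :: 'a and r :: real
  have J0: "J b r \<ge> 0" for b r by (simp add: J_def)
  have u: "loc_fin u" and K: "K > 0" using A by (auto simp: Ap_pair_def)
  have c0: "c > 0" using K by (simp add: c)
  have c1: "c \<le> 1" unfolding c by (rule Ap_pair_const_le_1[OF A])
  have A1: "A0 \<ge> 1"
  proof -
    have "(1::real) * 1 \<le> 2 powr d * (2 / c)" using d c0 c1 by (intro mult_mono ge_one_powr_ge_zero) (auto simp: field_simps)
    then show ?thesis by (simp add: A0_def)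
  qed
  have D: "D \<ge> 1" by (simp add: D_def)
  have lhalf: "(r/2) ^ DIM('a) * D = r ^ DIM('a)" for r :: real by (simp add: D_def power_divide)
  let ?I = "\<lambda>n a l. \<Sum>b\<in>grid n a l. J b (l/2^n)"
  have ISuc: "?I (Suc n) a l = (\<Sum>b\<in>children a l. ?I n b (l/2))" if "l > 0" for n a l
    using sum_grid_Suc[OF that, where h = "\<lambda>d. J d (l/2^Suc n)"] by simp
  \<comment> \<open>One stopping generation at threshold \<open>L\<close>. Final cubes that are
    never covered by the selection have mean at most \<open>L\<close>. A selected cube has mean at
    most \<open>D * L\<close>, since its parent has mean at most \<open>L\<close> and at most
    \<open>D\<close> times its volume; the third premise passes this to the cube at hand. The last
    premise is the induction hypothesis of the outer induction, used at the selected cubes.\<close>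
  have step: "?I m a l \<le> L powr d * wt u (hc a l) + A0 * (D * L) powr d * wt u (stop m (\<lambda>a l. wt u (hc a l) > L * l ^ DIM('a)) a l)"
    if "l > 0" "L > 0" "wt u (hc a l) \<le> D * L * l ^ DIM('a)"
      "\<And>k a l. k \<le> m \<Longrightarrow> l > 0 \<Longrightarrow> ?I k a l \<le> A0 * J a l" for m a l L
    using that
  proof (induction m arbitrary: a l)
    case (0 a l)
    show ?case
    proof (cases "wt u (hc a l) > L * l ^ DIM('a)")
      case True
      have "J a l \<le> wt u (hc a l) * (D * L) powr d"
        unfolding J_def using 0 d by (intro mult_left_mono powr_mono2) (auto simp: field_simps)
      also have "\<dots> \<le> A0 * (wt u (hc a l) * (D * L) powr d)" using A1 mult_right_mono[of 1 A0 "wt u (hc a l) * (D * L) powr d"] by simp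
      finally show ?thesis using True by (simp add: mult_ac add_increasing)
    next
      case False
      have "J a l \<le> wt u (hc a l) * L powr d"
        unfolding J_def using 0 d False by (intro mult_left_mono powr_mono2) (auto simp: field_simps)
      then show ?thesis using False by (simp add: mult_ac wt_def)
    qed
  next
    case (Suc m a l)
    let ?P = "\<lambda>a l. wt u (hc a l) > L * l ^ DIM('a)"
    show ?case
    proof (cases "?P a l")
      case True
      have "J a l \<le> wt u (hc a l) * (D * L) powr d"
        unfolding J_def using Suc.prems d by (intro mult_left_mono powr_mono2) (auto simp: field_simps)
      then have "A0 * J a l \<le> A0 * (wt u (hc a l) * (D * L) powr d)" using A1 by (intro mult_left_mono) auto
      moreover have "?I (Suc m) a l \<le> A0 * J a l" using Suc.prems by blast
      moreover have "stop (Suc m) ?P a l = hc a l" using True by simp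
      moreover have "L powr d * wt u (hc a l) \<ge> 0" by simp
      ultimately show ?thesis by (simp only: mult_ac)
    next
      case False
      have "?I (Suc m) a l = (\<Sum>b\<in>children a l. ?I m b (l/2))" using ISuc Suc.prems by blast
      also have "\<dots> \<le> (\<Sum>b\<in>children a l. L powr d * wt u (hc b (l/2)) + A0 * (D * L) powr d * wt u (stop m ?P b (l/2)))"
      proof (intro sum_mono Suc.IH)
        fix b assume b: "b \<in> children a l"
        have "wt u (hc b (l/2)) \<le> wt u (hc a l)" by (rule wt_mono[OF u]) (use children_subset[OF b] in auto)
        also have "\<dots> \<le> L * l ^ DIM('a)" using False by simp
        also have "\<dots> = D * L * (l/2) ^ DIM('a)" unfolding lhalf[symmetric, of l] by (simp add: mult_ac)
        finally show "wt u (hc b (l/2)) \<le> D * L * (l/2) ^ DIM('a)" .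
      qed (use Suc.prems in auto)
      also have "\<dots> = L powr d * (\<Sum>b\<in>children a l. wt u (hc b (l/2))) + A0 * (D * L) powr d * (\<Sum>b\<in>children a l. wt u (stop m ?P b (l/2)))"
        by (simp add: sum.distrib sum_distrib_left)
      also have "(\<Sum>b\<in>children a l. wt u (hc b (l/2))) = wt u (hc a l)" by (rule wt_children[OF u])
      also have "(\<Sum>b\<in>children a l. wt u (stop m ?P b (l/2))) = wt u (stop (Suc m) ?P a l)"
        using False by (simp add: wt_stop_children[OF u])
      finally show ?thesis .
    qed
  qed
  have "?I n a l \<le> A0 * J a l" if "l > 0" for n a l
    using that
  proof (induction n arbitrary: a l rule: less_induct)
    case (less n a l)
    show ?case
    proof (cases n)
      case 0
      then show ?thesis using mult_right_mono[OF A1 J0[of a l]] by simp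
    next
      case (Suc k)
      let ?U = "wt u (hc a l)"
      have U: "?U > 0" by (rule Ap_pair_wt_pos[OF A less.prems])
      \<comment> \<open>Twice the mean: the cube itself is then not selected, and the weak type
        bound leaves the selected cubes at most half of its volume.\<close>
      define L where "L = 2 * ?U / l ^ DIM('a)"
      have L: "L > 0" using U less.prems by (simp add: L_def)
      have Ll: "L * l ^ DIM('a) = 2 * ?U" using less.prems by (simp add: L_def)
      let ?P = "\<lambda>a l. wt u (hc a l) > L * l ^ DIM('a)"
      have nP: "\<not> ?P a l" using U Ll by simp
      have "?I n a l = (\<Sum>b\<in>children a l. ?I k b (l/2))" using ISuc less.prems Suc by blast
      also have "\<dots> \<le> (\<Sum>b\<in>children a l. L powr d * wt u (hc b (l/2)) + A0 * (D * L) powr d * wt u (stop k ?P b (l/2)))"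
      proof (intro sum_mono step)
        fix b assume b: "b \<in> children a l"
        have "wt u (hc b (l/2)) \<le> wt u (hc a l)" by (rule wt_mono[OF u]) (use children_subset[OF b] in auto)
        also have "\<dots> \<le> L * l ^ DIM('a)" using nP by simp
        also have "\<dots> = D * L * (l/2) ^ DIM('a)" unfolding lhalf[symmetric, of l] by (simp add: mult_ac)
        finally show "wt u (hc b (l/2)) \<le> D * L * (l/2) ^ DIM('a)" .
      qed (use less L Suc in auto)
      also have "\<dots> = L powr d * (\<Sum>b\<in>children a l. wt u (hc b (l/2))) + A0 * (D * L) powr d * (\<Sum>b\<in>children a l. wt u (stop k ?P b (l/2)))"
        by (simp add: sum.distrib sum_distrib_left)
      also have "(\<Sum>b\<in>children a l. wt u (hc b (l/2))) = wt u (hc a l)" by (rule wt_children[OF u])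
      also have "(\<Sum>b\<in>children a l. wt u (stop k ?P b (l/2))) = wt u (stop n ?P a l)"
        using nP Suc by (simp add: wt_stop_children[OF u])
      finally have 1: "?I n a l \<le> L powr d * ?U + A0 * (D * L) powr d * wt u (stop n ?P a l)" .
      have "L * measure lebesgue (stop n ?P a l) \<le> wt u (stop n ?P a l)" by (rule measure_stop_le[OF u less.prems])
      also have "\<dots> \<le> ?U" by (rule wt_mono[OF u stop_sets hc_lebesgue stop_subset order_refl])
      also have "\<dots> = L * (l ^ DIM('a) / 2)" using Ll by simp
      finally have "measure lebesgue (stop n ?P a l) \<le> l ^ DIM('a) / 2" using L by (simp add: mult_le_cancel_left)
      then have "wt u (stop n ?P a l) \<le> (1 - c) * ?U"
        unfolding c by (intro Ap_pair_wt_le_of_half[OF A less.prems]) (auto simp: stop_subset)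
      then have "A0 * (D * L) powr d * wt u (stop n ?P a l) \<le> A0 * (D * L) powr d * ((1 - c) * ?U)"
        using A1 by (intro mult_left_mono) auto
      with 1 have 2: "?I n a l \<le> L powr d * ?U + A0 * (D * L) powr d * ((1 - c) * ?U)" by linarith
      have Ld: "L powr d = 2 powr d * (?U / l ^ DIM('a)) powr d"
        using less.prems by (simp add: L_def powr_mult[symmetric])
      have DLd: "(D * L) powr d = (2 * D) powr d * (?U / l ^ DIM('a)) powr d"
        using less.prems D by (simp add: L_def powr_mult[symmetric] mult_ac)
      have "L powr d * ?U + A0 * (D * L) powr d * ((1 - c) * ?U) = (2 powr d + A0 * ((2 * D) powr d * (1 - c))) * J a l"
        unfolding Ld DLd J_def by (simp add: algebra_simps)
      also have "\<dots> \<le> (2 powr d + A0 * (1 - c/2)) * J a l"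
        using small A1 J0 unfolding D_def[symmetric] by (intro mult_right_mono add_left_mono mult_left_mono) auto
      also have "2 powr d + A0 * (1 - c/2) = A0" using c0 by (simp add: A0_def field_simps)
      finally show ?thesis using 2 by linarith
    qed
  qed
  from this[OF l] show ?thesis by (simp add: J_def A0_def)
qed

section \<open>From dyadic sums to integrals of powers of the weight\<close>

lemma hc_mono:
  assumes "l \<le> l'"
  shows "hc a l \<subseteq> hc a l'"
proof
  fix x assume x: "x \<in> hc a l"
  have "a \<bullet> b \<le> x \<bullet> b \<and> x \<bullet> b < a \<bullet> b + l'" if "b \<in> Basis" for b
  proof -
    have "a \<bullet> b \<le> x \<bullet> b" "x \<bullet> b < a \<bullet> b + l" using x that by (auto simp: hc_def)
    then show ?thesis using assms by linarith
  qed
  then show "x \<in> hc a l'" by (simp add: hc_def)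
qed

lemma set_nn_integral_1_hc:
  fixes a :: "'a::euclidean_space"
  assumes l: "l > 0"
  shows "(\<integral>\<^sup>+x\<in>hc a l. ennreal 1 \<partial>lebesgue) = ennreal (l ^ DIM('a))"
proof -
  have "(\<integral>\<^sup>+x\<in>hc a l. ennreal 1 \<partial>lebesgue) = emeasure lebesgue (hc a l)" by simp
  also have "\<dots> = ennreal (l ^ DIM('a))" using l by (intro emeasure_hc) auto
  finally show ?thesis .
qed

lemma loc_fin_1: "loc_fin (\<lambda>_ :: 'a::euclidean_space. 1)"
  unfolding loc_fin_def
proof (intro conjI allI)
  fix a :: 'a and l :: real
  have "hc a l \<subseteq> hc a (max 1 l)" by (rule hc_mono) simp
  then show "(\<integral>\<^sup>+x\<in>hc a l. ennreal 1 \<partial>lebesgue) < \<infinity>"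
    by (rule set_nn_integral_less_top_mono[rotated]) (subst set_nn_integral_1_hc, auto)
qed auto

text \<open>The averaging operators act on complex functions; this evaluates them on a weight
  embedded into the complex numbers and cut off to a set containing the cell.\<close>

lemma mean_of_real:
  fixes u :: "'a::euclidean_space \<Rightarrow> real"
  assumes u: "loc_fin u" and R: "hc c r \<subseteq> Q" and r: "r > 0"
  shows "mean (hc c r) (\<lambda>x. complex_of_real (u x * indicator Q x)) = complex_of_real (wt u (hc c r) / r ^ DIM('a))"
proof -
  have [measurable]: "u \<in> borel_measurable lebesgue" using loc_finD[OF u] by simp
  have "(LINT y:hc c r|lebesgue. complex_of_real (u y * indicator Q y)) = (LINT y|lebesgue. complex_of_real (u y * indicator (hc c r) y))"
    unfolding set_lebesgue_integral_def using R by (intro Bochner_Integration.integral_cong) (auto simp: indicator_def)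
  also have "\<dots> = complex_of_real (LINT y|lebesgue. u y * indicator (hc c r) y)" by (rule integral_complex_of_real)
  also have "(LINT y|lebesgue. u y * indicator (hc c r) y) = enn2real (\<integral>\<^sup>+y. ennreal (u y * indicator (hc c r) y) \<partial>lebesgue)"
    using loc_finD(2)[OF u] by (intro integral_eq_nn_integral) (auto elim!: eventually_mono)
  also have "(\<integral>\<^sup>+y. ennreal (u y * indicator (hc c r) y) \<partial>lebesgue) = (\<integral>\<^sup>+y\<in>hc c r. ennreal (u y) \<partial>lebesgue)"
    by (intro nn_integral_cong) (auto simp: indicator_def)
  also have "\<dots> = ennreal (wt u (hc c r))" by (rule nn_integral_eq_wt[OF u]) auto
  finally show ?thesis using r by (simp add: mean_def content_hc scaleR_conv_of_real divide_inverse mult.commute)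
qed

text \<open>Fatou, along a subsequence on which the dyadic averages converge almost everywhere.\<close>

lemma nn_integral_powr_le_dyadic:
  fixes u :: "'a::euclidean_space \<Rightarrow> real"
  assumes u: "loc_fin u" and s: "s > 0" and l: "l > 0"
    and B: "\<And>n. (\<Sum>c\<in>grid n a l. (wt u (hc c (l/2^n)) / (l/2^n) ^ DIM('a)) powr s * (l/2^n) ^ DIM('a)) \<le> B"
  shows "mass (\<lambda>x. u x powr s) (hc a l) \<le> ennreal B"
proof -
  have [measurable]: "u \<in> borel_measurable lebesgue" and u0: "AE x in lebesgue. 0 \<le> u x"
    using loc_finD[OF u] by auto
  define f where "f x = complex_of_real (u x * indicator (hc a l) x)" for x
  have fm[measurable]: "f \<in> borel_measurable lebesgue" unfolding f_def by measurable
  define T where "T n x = dyavg n a l f x" for n x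
  have Tm[measurable]: "T n \<in> borel_measurable lebesgue" for n unfolding T_def by measurable
  have "(\<integral>\<^sup>+x. ennreal (norm (f x) powr 1 * 1) \<partial>lebesgue) = mass u (hc a l)"
    using u0 by (intro nn_integral_cong_AE) (auto elim!: eventually_mono simp: f_def indicator_def)
  then have ffin: "(\<integral>\<^sup>+x. ennreal (norm (f x) powr 1 * 1) \<partial>lebesgue) < \<infinity>" using loc_finD(3)[OF u] by simp
  have "(\<lambda>i. l / 2 ^ i) \<longlonglongrightarrow> 0" by (rule LIMSEQ_divide_realpow_zero) simp
  then have lim: "(\<lambda>n. \<integral>\<^sup>+x\<in>hc a l. ennreal (norm (T n x - f x) powr 1 * 1) \<partial>lebesgue) \<longlonglongrightarrow> 0"
    unfolding T_def using l by (intro dyavg_tendsto[OF loc_fin_1 _ cell_bound_1 _ fm ffin]) auto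
  have eq: "mass (\<lambda>x. norm (T n x - f x) powr 1 * 1) (hc a l) = (\<integral>\<^sup>+x. ennreal (norm (T n x - f x)) \<partial>lebesgue)" for n
    by (intro nn_integral_cong) (auto simp: T_def f_def dyavg_outside indicator_def)
  have "\<exists>r. strict_mono r \<and> (AE x in lebesgue. (\<lambda>n. T (r n) x) \<longlonglongrightarrow> f x)"
  proof -
    have lim': "(\<lambda>n. \<integral>\<^sup>+x. ennreal (norm (T n x - f x)) \<partial>lebesgue) \<longlonglongrightarrow> 0" using lim unfolding eq .
    \<comment> \<open>The passage from convergence in L^1 to almost everywhere convergence of a
      subsequence asks for integrable terms; dropping the first \<open>N\<close> makes every
      integral less than 1.\<close>
    from ennreal_tendsto_0D[OF this, of 1] obtain N where N: "\<And>n. n \<ge> N \<Longrightarrow> (\<integral>\<^sup>+x. ennreal (norm (T n x - f x)) \<partial>lebesgue) < 1"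
      by (auto simp: eventually_sequentially)
    have int: "integrable lebesgue (\<lambda>x. T (n + N) x - f x)" for n
      using N[of "n + N"] by (intro integrableI_bounded) (auto intro: order.strict_trans)
    have "(\<lambda>n. \<integral>\<^sup>+x. ennreal (norm (T (n + N) x - f x)) \<partial>lebesgue) \<longlonglongrightarrow> 0"
      using lim' by (rule LIMSEQ_ignore_initial_segment)
    then have "(\<lambda>n. enn2real (\<integral>\<^sup>+x. ennreal (norm (T (n + N) x - f x)) \<partial>lebesgue)) \<longlonglongrightarrow> enn2real 0"
      by (intro tendsto_enn2real) auto
    moreover have "enn2real (\<integral>\<^sup>+x. ennreal (norm (T (n + N) x - f x)) \<partial>lebesgue) = (LINT x|lebesgue. norm (T (n + N) x - f x))" for n
      by (rule integral_eq_nn_integral[symmetric]) auto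
    ultimately have "(\<lambda>n. LINT x|lebesgue. norm (T (n + N) x - f x)) \<longlonglongrightarrow> 0" by simp
    from tendsto_L1_AE_subseq[OF int this]
    obtain r where r: "strict_mono r" "AE x in lebesgue. (\<lambda>n. T (r n + N) x - f x) \<longlonglongrightarrow> 0" by auto
    show ?thesis
    proof (intro exI[of _ "\<lambda>n. r n + N"] conjI)
      show "strict_mono (\<lambda>n. r n + N)" using r(1) by (simp add: strict_mono_def)
      show "AE x in lebesgue. (\<lambda>n. T (r n + N) x) \<longlonglongrightarrow> f x" using r(2) by eventually_elim (simp add: LIM_zero_iff)
    qed
  qed
  then obtain r where r: "AE x in lebesgue. (\<lambda>n. T (r n) x) \<longlonglongrightarrow> f x" by auto
  have Tint: "(\<integral>\<^sup>+x. ennreal (norm (T n x) powr s * 1) \<partial>lebesgue) \<le> ennreal B" for n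
  proof -
    have rn: "l/2^n > 0" using l by simp
    have "(\<integral>\<^sup>+x. ennreal (norm (T n x) powr s * 1) \<partial>lebesgue)
       = (\<Sum>c\<in>grid n a l. ennreal (norm (mean (hc c (l/2^n)) f) powr s) * (\<integral>\<^sup>+x\<in>hc c (l/2^n). ennreal 1 \<partial>lebesgue))"
      unfolding T_def by (rule nn_integral_dyavg_powr[OF _ s]) auto
    also have "\<dots> = (\<Sum>c\<in>grid n a l. ennreal ((wt u (hc c (l/2^n)) / (l/2^n) ^ DIM('a)) powr s * (l/2^n) ^ DIM('a)))"
    proof (intro sum.cong refl)
      fix c assume c: "c \<in> grid n a l"
      have m: "mean (hc c (l/2^n)) f = complex_of_real (wt u (hc c (l/2^n)) / (l/2^n) ^ DIM('a))"
        unfolding f_def by (rule mean_of_real[OF u grid_subset[OF c] rn])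
      have "norm (mean (hc c (l/2^n)) f) = wt u (hc c (l/2^n)) / (l/2^n) ^ DIM('a)"
        unfolding m norm_of_real using rn by (intro abs_of_nonneg divide_nonneg_nonneg) auto
      then show "ennreal (norm (mean (hc c (l/2^n)) f) powr s) * (\<integral>\<^sup>+x\<in>hc c (l/2^n). ennreal 1 \<partial>lebesgue)
        = ennreal ((wt u (hc c (l/2^n)) / (l/2^n) ^ DIM('a)) powr s * (l/2^n) ^ DIM('a))"
        unfolding set_nn_integral_1_hc[OF rn] using rn by (simp only: ennreal_mult[symmetric] powr_ge_zero zero_le_power less_imp_le)
    qed
    also have "\<dots> = ennreal (\<Sum>c\<in>grid n a l. (wt u (hc c (l/2^n)) / (l/2^n) ^ DIM('a)) powr s * (l/2^n) ^ DIM('a))"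
      using rn by (intro sum_ennreal) auto
    also have "\<dots> \<le> ennreal B" by (intro ennreal_leI B)
    finally show ?thesis .
  qed
  have "mass (\<lambda>x. u x powr s) (hc a l) = (\<integral>\<^sup>+x. liminf (\<lambda>n. ennreal (norm (T (r n) x) powr s * 1)) \<partial>lebesgue)"
    using r u0
  proof (intro nn_integral_cong_AE, eventually_elim)
    case (elim x)
    have "(\<lambda>n. norm (T (r n) x) powr s * 1) \<longlonglongrightarrow> norm (f x) powr s * 1"
      using elim s by (intro tendsto_intros tendsto_powr2) auto
    then have "(\<lambda>n. ennreal (norm (T (r n) x) powr s * 1)) \<longlonglongrightarrow> ennreal (norm (f x) powr s * 1)"
      by (rule tendsto_ennrealI)
    then have "liminf (\<lambda>n. ennreal (norm (T (r n) x) powr s * 1)) = ennreal (norm (f x) powr s * 1)"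
      by (intro lim_imp_Liminf) auto
    also have "\<dots> = ennreal (u x powr s) * indicator (hc a l) x" using elim s by (auto simp: f_def indicator_def)
    finally show ?case by simp
  qed
  also have "\<dots> \<le> liminf (\<lambda>n. \<integral>\<^sup>+x. ennreal (norm (T (r n) x) powr s * 1) \<partial>lebesgue)"
    by (rule nn_integral_liminf) auto
  also have "\<dots> \<le> limsup (\<lambda>n. \<integral>\<^sup>+x. ennreal (norm (T (r n) x) powr s * 1) \<partial>lebesgue)"
    by (rule Liminf_le_Limsup) auto
  also have "\<dots> \<le> ennreal B" using Tint by (intro Limsup_bounded always_eventually) auto
  finally show ?thesis .
qed

lemma reverse_Hoelder:
  fixes u v :: "'a::euclidean_space \<Rightarrow> real"
  assumes A: "Ap_pair p u v K"
  obtains d0 where "d0 > 0"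
    "\<And>d. 0 < d \<Longrightarrow> d \<le> d0 \<Longrightarrow> \<exists>C\<ge>0. \<forall>a l. 0 < l \<longrightarrow>
       (mass (\<lambda>x. u x powr (1 + d)) (hc a l)) \<le> ennreal (C * (l ^ DIM('a) * (wt u (hc a l) / l ^ DIM('a)) powr (1 + d)))"
proof -
  define c where "c = 1 / (2 powr p * K)"
  have u: "loc_fin u" and K: "K > 0" using A by (auto simp: Ap_pair_def)
  have c0: "c > 0" using K by (simp add: c_def)
  have c1: "c \<le> 1" unfolding c_def by (rule Ap_pair_const_le_1[OF A])
  define D where "D = (2::real) * 2 ^ DIM('a)"
  have "(1::real) \<le> 2 ^ DIM('a)" by simp
  then have D: "D > 1" unfolding D_def by linarith
  \<comment> \<open>So that \<open>D powr d0 = 1 + c/2\<close>, and (1 + c/2)(1 - c) \<le> 1 - c/2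
    is the smallness that the dyadic estimate asks for.\<close>
  define d0 where "d0 = log D (1 + c/2)"
  have d0: "d0 > 0" using D c0 by (simp add: d0_def)
  have Dd0: "D powr d0 = 1 + c/2" using D c0 by (simp add: d0_def)
  have "\<exists>C\<ge>0. \<forall>a l. 0 < l \<longrightarrow>
       (mass (\<lambda>x. u x powr (1 + d)) (hc a l)) \<le> ennreal (C * (l ^ DIM('a) * (wt u (hc a l) / l ^ DIM('a)) powr (1 + d)))"
    if d: "0 < d" "d \<le> d0" for d
  proof (intro exI[of _ "2 powr d * 2 / c"] conjI allI impI)
    show "0 \<le> 2 powr d * 2 / c" using c0 by simp
    have "D powr d * (1 - c) \<le> D powr d0 * (1 - c)" using D d c1 by (intro mult_right_mono powr_mono) auto
    also have "\<dots> = 1 - c/2 - c*c/2" unfolding Dd0 by (simp add: ring_distribs)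
    also have "\<dots> \<le> 1 - c/2" by simp
    finally have small: "D powr d * (1 - c) \<le> 1 - c/2" .
    fix a :: 'a and l :: real assume l: "0 < l"
    have e: "(x / m) powr (1 + d) * m = x * (x / m) powr d" if "x \<ge> 0" "m > 0" for x m :: real
      using that by (cases "x = 0") (auto simp: powr_add)
    have "mass (\<lambda>x. u x powr (1 + d)) (hc a l) \<le> ennreal (2 powr d * 2 / c * (wt u (hc a l) * (wt u (hc a l) / l ^ DIM('a)) powr d))"
    proof (rule nn_integral_powr_le_dyadic[OF u _ l])
      show "(\<Sum>b\<in>grid n a l. (wt u (hc b (l/2^n)) / (l/2^n) ^ DIM('a)) powr (1 + d) * (l/2^n) ^ DIM('a))
         \<le> 2 powr d * 2 / c * (wt u (hc a l) * (wt u (hc a l) / l ^ DIM('a)) powr d)" for n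
      proof -
        have "(\<Sum>b\<in>grid n a l. (wt u (hc b (l/2^n)) / (l/2^n) ^ DIM('a)) powr (1 + d) * (l/2^n) ^ DIM('a))
          = (\<Sum>b\<in>grid n a l. wt u (hc b (l/2^n)) * (wt u (hc b (l/2^n)) / (l/2^n) ^ DIM('a)) powr d)"
          using l by (intro sum.cong refl e) auto
        also have "\<dots> \<le> 2 powr d * 2 / c * (wt u (hc a l) * (wt u (hc a l) / l ^ DIM('a)) powr d)"
          by (rule reverse_Hoelder_dyadic[OF A d(1) c_def small[unfolded D_def] l])
        finally show ?thesis .
      qed
    qed (use d in auto)
    also have "wt u (hc a l) * (wt u (hc a l) / l ^ DIM('a)) powr d = l ^ DIM('a) * (wt u (hc a l) / l ^ DIM('a)) powr (1 + d)"
      using e[of "wt u (hc a l)" "l ^ DIM('a)"] l by (simp add: mult.commute)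
    finally show "mass (\<lambda>x. u x powr (1 + d)) (hc a l) \<le> ennreal (2 powr d * 2 / c * (l ^ DIM('a) * (wt u (hc a l) / l ^ DIM('a)) powr (1 + d)))" .
  qed
  with d0 show ?thesis by (rule that)
qed

section \<open>Perturbation of weights\<close>

lemma conj_exp_diff: "p > 1 \<Longrightarrow> 1 - conj_exp p = - 1 / (p - 1)"
  by (simp add: conj_exp_def field_simps)

lemma loc_finI:
  fixes u :: "'a::euclidean_space \<Rightarrow> real"
  assumes "u \<in> borel_measurable lebesgue" "AE x in lebesgue. 0 \<le> u x"
    "\<And>a l. 0 < l \<Longrightarrow> (mass u (hc a l)) < \<infinity>"
  shows "loc_fin u"
  unfolding loc_fin_def
proof (intro conjI allI)
  fix a :: 'a and l
  have "hc a l \<subseteq> hc a (max 1 l)" by (rule hc_mono) simp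
  then show "mass u (hc a l) < \<infinity>"
    by (rule set_nn_integral_less_top_mono[rotated]) (rule assms(3), simp)
qed (use assms in auto)

lemma int_over_cube: "int_over g (cube a l) = mass g (hc a l)"
  unfolding int_over_def by (rule nn_integral_cube_eq_hc)

lemma avg_cube:
  fixes a :: "'a::euclidean_space"
  assumes "loc_fin g" "l > 0"
  shows "avg g (cube a l) = wt g (hc a l) / l ^ DIM('a)"
  unfolding avg_def int_over_cube using nn_integral_eq_wt[OF assms(1), of "hc a l" a l] assms(2)
  by (subst measure_cube) auto

lemma Ap_imp_Ap_pair:
  fixes w :: "'a::euclidean_space \<Rightarrow> real"
  assumes p: "1 < p" and w: "Ap p w"
  obtains K where "Ap_pair p w (\<lambda>x. w x powr (- 1 / (p - 1))) K"
proof -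
  let ?v = "\<lambda>x. w x powr (- 1 / (p - 1))"
  from w obtain C where C: "\<And>Q. is_cube Q \<Longrightarrow> int_over w Q < \<infinity>"
     "\<And>Q. is_cube Q \<Longrightarrow> int_over ?v Q < \<infinity>"
     "\<And>Q. is_cube Q \<Longrightarrow> avg w Q * avg ?v Q powr (p - 1) \<le> C"
    and wm[measurable]: "w \<in> borel_measurable lebesgue" and wp: "AE x in lebesgue. w x > 0"
    unfolding Ap_def conj_exp_diff[OF p] weight_def by blast
  have lw: "loc_fin w"
  proof (rule loc_finI)
    show "mass w (hc a l) < \<infinity>" if "0 < l" for a l
      using C(1)[of "cube a l"] that unfolding int_over_cube is_cube_def by blast
  qed (use wp in \<open>auto elim: eventually_mono\<close>)
  have lv: "loc_fin ?v"
  proof (rule loc_finI)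
    show "mass ?v (hc a l) < \<infinity>" if "0 < l" for a l
      using C(2)[of "cube a l"] that unfolding int_over_cube is_cube_def by blast
  qed auto
  \<comment> \<open>The maximum with 1 supplies the positivity of the constant.\<close>
  have "Ap_pair p w ?v (max C 1)"
    unfolding Ap_pair_def
  proof (intro conjI allI impI lw lv p)
    show "AE x in lebesgue. 1 \<le> w x * ?v x powr (p - 1)"
      using wp
    proof eventually_elim
      case (elim x)
      have "?v x powr (p - 1) = w x powr (- 1)" using p by (simp add: powr_powr)
      also have "\<dots> = 1 / w x" using elim by (simp add: powr_minus_divide)
      finally show ?case using elim by simp
    qed
    show "0 < max C 1" by simp
    fix a :: 'a and l :: real assume l: "0 < l"
    let ?m = "l ^ DIM('a)"
    have m: "?m > 0" using l by simp
    have "avg w (cube a l) * avg ?v (cube a l) powr (p - 1) \<le> C" using l by (intro C(3)) (auto simp: is_cube_def)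
    then have "(wt w (hc a l) / ?m) * (wt ?v (hc a l) / ?m) powr (p - 1) \<le> C"
      using avg_cube[OF lw l] avg_cube[OF lv l] by simp
    moreover have "(wt w (hc a l) / ?m) * (wt ?v (hc a l) / ?m) powr (p - 1) = wt w (hc a l) * wt ?v (hc a l) powr (p - 1) / ?m powr p"
      using m by (simp add: powr_divide powr_diff)
    ultimately have "wt w (hc a l) * wt ?v (hc a l) powr (p - 1) / ?m powr p \<le> C" by (simp only:)
    then have "wt w (hc a l) * wt ?v (hc a l) powr (p - 1) \<le> C * ?m powr p" using m l by (subst (asm) pos_divide_le_eq) auto
    also have "\<dots> \<le> max C 1 * ?m powr p" by (intro mult_right_mono) auto
    finally show "wt w (hc a l) * wt ?v (hc a l) powr (p - 1) \<le> max C 1 * ?m powr p" .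
  qed
  then show ?thesis by (rule that)
qed

text \<open>Both conditions on the pair are raised to the power 1/(p-1). The point is to obtain the
  reverse Hoelder inequality for the dual weight as well.\<close>

lemma Ap_pair_dual:
  fixes u v :: "'a::euclidean_space \<Rightarrow> real"
  assumes A: "Ap_pair p u v K"
  shows "Ap_pair (p / (p - 1)) v u (K powr (1 / (p - 1)))"
proof -
  have p: "p > 1" and u: "loc_fin u" and v: "loc_fin v" and K: "K > 0" using A by (auto simp: Ap_pair_def)
  have pe: "p / (p - 1) - 1 = 1 / (p - 1)" using p by (simp add: field_simps)
  have uv: "AE x in lebesgue. 1 \<le> u x * v x powr (p - 1)" using A by (auto simp: Ap_pair_def)
  show ?thesis
    unfolding Ap_pair_def pe
  proof (intro conjI allI impI u v)
    show "1 < p / (p - 1)" using p by simp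
    show "AE x in lebesgue. 1 \<le> v x * u x powr (1 / (p - 1))"
      using uv loc_finD(2)[OF u] loc_finD(2)[OF v]
    proof eventually_elim
      case (elim x)
      then have "1 \<le> (u x * v x powr (p - 1)) powr (1 / (p - 1))" using p by (intro ge_one_powr_ge_zero) auto
      then show ?case using elim p by (simp add: powr_mult powr_powr mult.commute)
    qed
    show "0 < K powr (1 / (p - 1))" using K by simp
    fix a :: 'a and l :: real assume l: "0 < l"
    let ?m = "l ^ DIM('a)"
    have "wt u (hc a l) * wt v (hc a l) powr (p - 1) \<le> K * ?m powr p" using A l by (auto simp: Ap_pair_def)
    then have "(wt u (hc a l) * wt v (hc a l) powr (p - 1)) powr (1 / (p - 1)) \<le> (K * ?m powr p) powr (1 / (p - 1))"
      using p by (intro powr_mono2) auto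
    then show "wt v (hc a l) * wt u (hc a l) powr (1 / (p - 1)) \<le> K powr (1 / (p - 1)) * ?m powr (p / (p - 1))"
      using p K l by (simp add: powr_mult powr_powr mult.commute)
  qed
qed

lemma Ap_pair_avg_le:
  fixes u v :: "'a::euclidean_space \<Rightarrow> real"
  assumes A: "Ap_pair p u v K" and l: "0 < l"
  shows "(wt u (hc a l) / l ^ DIM('a)) * (wt v (hc a l) / l ^ DIM('a)) powr (p - 1) \<le> K"
proof -
  let ?m = "l ^ DIM('a)"
  have m: "?m > 0" using l by simp
  have "wt u (hc a l) * wt v (hc a l) powr (p - 1) \<le> K * ?m powr p" using A l by (auto simp: Ap_pair_def)
  moreover have "(wt u (hc a l) / ?m) * (wt v (hc a l) / ?m) powr (p - 1) = wt u (hc a l) * wt v (hc a l) powr (p - 1) / ?m powr p"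
    using m by (simp add: powr_divide powr_diff)
  ultimately show ?thesis using l by (simp add: divide_le_eq)
qed

text \<open>Hoelder with exponents \<open>x\<close> and \<open>y\<close> for f^(1+d) and g. The
  reverse Hoelder hypothesis, with \<open>A\<close> in the role of the mean of \<open>f\<close>,
  undoes the gain 1 + d, so that the mean of the product is controlled by powers of the two
  means.\<close>

lemma product_avg_le:
  fixes f g F :: "'a::euclidean_space \<Rightarrow> real"
  assumes f: "loc_fin f" and g: "loc_fin g" and l: "l > 0" and d: "d > 0" and xy: "x > 0" "y > 0" "x + y = 1" and C: "C \<ge> 0"
    and RH: "(\<integral>\<^sup>+t\<in>hc a l. ennreal (f t powr (1 + d)) \<partial>lebesgue) \<le> ennreal (C * (l ^ DIM('a) * A powr (1 + d)))"
    and F: "AE t in lebesgue. F t = f t powr ((1 + d) * x) * g t powr y"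
  shows "(\<integral>\<^sup>+t\<in>hc a l. ennreal (F t) \<partial>lebesgue)
     \<le> ennreal (l ^ DIM('a) * (C powr x * A powr ((1 + d) * x) * (wt g (hc a l) / l ^ DIM('a)) powr y))"
proof -
  have [measurable]: "f \<in> borel_measurable lebesgue" "g \<in> borel_measurable lebesgue"
    using loc_finD(1)[OF f] loc_finD(1)[OF g] by auto
  let ?m = "l ^ DIM('a)" and ?G = "wt g (hc a l)"
  have m: "?m > 0" using l by simp
  have "(\<integral>\<^sup>+t\<in>hc a l. ennreal (F t) \<partial>lebesgue) = (\<integral>\<^sup>+t\<in>hc a l. ennreal ((f t powr (1 + d)) powr x * g t powr y) \<partial>lebesgue)"
    using F by (intro nn_integral_cong_AE) (auto elim!: eventually_mono simp: powr_powr)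
  also have "\<dots> \<le> ennreal ((C * (?m * A powr (1 + d))) powr x * ?G powr y)"
  proof (rule set_nn_integral_Hoelder_le[OF _ _ _ _ _ xy RH])
    show "(\<integral>\<^sup>+t\<in>hc a l. ennreal (g t) \<partial>lebesgue) \<le> ennreal ?G" using nn_integral_eq_wt[OF g, of "hc a l" a l] by simp
  qed (use loc_finD(2)[OF g] C l in auto)
  also have "(C * (?m * A powr (1 + d))) powr x * ?G powr y = ?m * (C powr x * A powr ((1 + d) * x) * (?G / ?m) powr y)"
  proof -
    have a1: "?m powr x * ?m powr y = ?m" using m xy by (subst powr_add[symmetric]) simp
    have a2: "?G powr y = ?m powr y * (?G / ?m) powr y" using l by (simp add: powr_mult[symmetric])
    have a3: "(C * (?m * A powr (1 + d))) powr x = C powr x * ?m powr x * A powr ((1 + d) * x)"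
      using m C by (simp add: powr_mult powr_powr)
    have "(C * (?m * A powr (1 + d))) powr x * ?G powr y = (C powr x * ?m powr x * A powr ((1 + d) * x)) * (?m powr y * (?G / ?m) powr y)"
      by (rule arg_cong2[OF a3 a2])
    also have "\<dots> = (?m powr x * ?m powr y) * (C powr x * A powr ((1 + d) * x) * (?G / ?m) powr y)"
      by (simp only: mult_ac)
    finally show ?thesis unfolding a1 .
  qed
  finally show ?thesis .
qed

text \<open>The A_p product increases with both means, so upper bounds \<open>X\<close> and
  \<open>Y\<close> for them suffice, provided that \<open>M\<close> is the same for all
  cubes.\<close>

lemma Ap_weightI:
  fixes u :: "'a::euclidean_space \<Rightarrow> real"
  assumes p: "1 < p" and [measurable]: "u \<in> borel_measurable lebesgue" and pos: "AE x in lebesgue. u x > 0"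
    and M: "\<And>a l. 0 < l \<Longrightarrow> \<exists>X Y. 0 \<le> X \<and> 0 \<le> Y \<and>
      (mass u (hc a l)) \<le> ennreal (l ^ DIM('a) * X) \<and>
      (mass (\<lambda>x. u x powr (- 1 / (p - 1))) (hc a l)) \<le> ennreal (l ^ DIM('a) * Y) \<and> X * Y powr (p - 1) \<le> M"
  shows "Ap p u"
proof -
  let ?v = "\<lambda>x. u x powr (- 1 / (p - 1))"
  have fin: "mass u (hc a l) < \<infinity>" "mass ?v (hc a l) < \<infinity>" if "0 < l" for a l
    using M[OF that, of a] by (auto intro: le_less_trans)
  have lu: "loc_fin u" by (rule loc_finI) (use fin pos in \<open>auto elim: eventually_mono\<close>)
  have lv: "loc_fin ?v" by (rule loc_finI) (use fin in auto)
  show ?thesis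
    unfolding Ap_def conj_exp_diff[OF p]
  proof (intro conjI exI[of _ M] allI impI)
    show "weight u"
      unfolding weight_def
    proof (intro conjI allI impI)
      fix S :: "'a set" assume S: "compact S"
      then obtain n where n: "S \<subseteq> big_cube n" using bounded_subset_big_cube compact_imp_bounded by blast
      have Sl[measurable]: "S \<in> sets lebesgue" using S by (simp add: borel_compact sets_completionI_sets)
      show "set_integrable lebesgue S u"
        unfolding set_integrable_def
      proof (rule integrableI_bounded)
        have "(\<integral>\<^sup>+x. ennreal (norm (indicat_real S x *\<^sub>R u x)) \<partial>lebesgue) = mass u S"
          using pos by (intro nn_integral_cong_AE) (auto elim!: eventually_mono simp: indicator_def)
        also have "\<dots> < \<infinity>"
          by (rule set_nn_integral_less_top_mono[OF loc_finD(3)[OF lu] n[unfolded big_cube_def]])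
        finally show "(\<integral>\<^sup>+x. ennreal (norm (indicat_real S x *\<^sub>R u x)) \<partial>lebesgue) < \<infinity>" .
      qed auto
    qed (use pos in auto)
    fix Q :: "'a set" assume "is_cube Q"
    then obtain a l where l: "l > 0" and Q: "Q = cube a l" by (auto simp: is_cube_def)
    show "int_over u Q < \<infinity>" "int_over ?v Q < \<infinity>" unfolding Q int_over_cube using fin[OF l] by auto
    obtain X Y where XY: "0 \<le> X" "0 \<le> Y" "X * Y powr (p - 1) \<le> M"
      "mass u (hc a l) \<le> ennreal (l ^ DIM('a) * X)"
      "mass ?v (hc a l) \<le> ennreal (l ^ DIM('a) * Y)" using M[OF l, of a] by blast
    have 1: "wt u (hc a l) / l ^ DIM('a) \<le> X"
    proof -
      have "ennreal (wt u (hc a l)) \<le> ennreal (l ^ DIM('a) * X)"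
        using XY(4) unfolding nn_integral_eq_wt[OF lu hc_lebesgue order_refl] .
      then have "wt u (hc a l) \<le> l ^ DIM('a) * X" using XY(1,2) l by (subst (asm) ennreal_le_iff) auto
      then show ?thesis using l by (simp add: pos_divide_le_eq mult.commute)
    qed
    have 2: "wt ?v (hc a l) / l ^ DIM('a) \<le> Y"
    proof -
      have "ennreal (wt ?v (hc a l)) \<le> ennreal (l ^ DIM('a) * Y)"
        using XY(5) unfolding nn_integral_eq_wt[OF lv hc_lebesgue order_refl] .
      then have "wt ?v (hc a l) \<le> l ^ DIM('a) * Y" using XY(1,2) l by (subst (asm) ennreal_le_iff) auto
      then show ?thesis using l by (simp add: pos_divide_le_eq mult.commute)
    qed
    have "avg u Q * avg ?v Q powr (p - 1) \<le> X * Y powr (p - 1)"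
      unfolding Q avg_cube[OF lu l] avg_cube[OF lv l] using 1 2 p l XY by (intro mult_mono powr_mono2) auto
    with XY(3) show "avg u Q * avg ?v Q powr (p - 1) \<le> M" by linarith
  qed
qed

text \<open>Hoelder splits \<open>s\<^bsup>1/(1-\<alpha>)\<^esup> w\<^bsup>-\<alpha>/(1-\<alpha>)\<^esup>\<close> into \<open>s\<^bsup>1+\<delta>\<^esup>\<close> and \<open>w\<^bsup>-1/(q-1)\<^esup>\<close>, and its dual weight into
  \<open>(s\<^bsup>-1/(p-1)\<^esup>)\<^bsup>1+\<delta>'\<^esup>\<close> and \<open>w\<close>; here \<open>1 + \<delta> = 1/(1 - \<alpha> q)\<close> and \<open>1 + \<delta>' = (p - 1)/(p - 1 - \<alpha> q)\<close>, which
  the reverse Hoelder inequality admits for small \<open>\<alpha>\<close>.\<close>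

lemma Ap_extrapolate:
  fixes s w :: "'a::euclidean_space \<Rightarrow> real"
  assumes p: "1 < p" and q: "1 < q" and s: "Ap p s" and w: "Ap q w"
  obtains e where "e > 0" "\<And>\<alpha>. 0 < \<alpha> \<Longrightarrow> \<alpha> < e \<Longrightarrow> \<alpha> < 1 \<and> 1 < (p - \<alpha> * q) / (1 - \<alpha>) \<and>
     Ap ((p - \<alpha> * q) / (1 - \<alpha>)) (\<lambda>x. s x powr (1 / (1 - \<alpha>)) * w x powr (- \<alpha> / (1 - \<alpha>)))"
proof -
  define v where "v x = s x powr (- 1 / (p - 1))" for x
  define z where "z x = w x powr (- 1 / (q - 1))" for x
  obtain K where A: "Ap_pair p s v K" unfolding v_def using Ap_imp_Ap_pair[OF p s] .
  obtain K' where B: "Ap_pair q w z K'" unfolding z_def using Ap_imp_Ap_pair[OF q w] .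
  have ls: "loc_fin s" and lv: "loc_fin v" and lw: "loc_fin w" and lz: "loc_fin z" and K: "K > 0" and K': "K' > 0"
    using A B by (auto simp: Ap_pair_def)
  have [measurable]: "s \<in> borel_measurable lebesgue" "w \<in> borel_measurable lebesgue"
    using loc_finD(1)[OF ls] loc_finD(1)[OF lw] by auto
  have sp: "AE x in lebesgue. s x > 0" and wp: "AE x in lebesgue. w x > 0" using s w by (auto simp: Ap_def weight_def)
  obtain d1 where d1: "d1 > 0" "\<And>d. 0 < d \<Longrightarrow> d \<le> d1 \<Longrightarrow> \<exists>C\<ge>0. \<forall>a l. 0 < l \<longrightarrow>
       (mass (\<lambda>x. s x powr (1 + d)) (hc a l)) \<le> ennreal (C * (l ^ DIM('a) * (wt s (hc a l) / l ^ DIM('a)) powr (1 + d)))"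
    using reverse_Hoelder[OF A] by blast
  obtain d2 where d2: "d2 > 0" "\<And>d. 0 < d \<Longrightarrow> d \<le> d2 \<Longrightarrow> \<exists>C\<ge>0. \<forall>a l. 0 < l \<longrightarrow>
       (mass (\<lambda>x. v x powr (1 + d)) (hc a l)) \<le> ennreal (C * (l ^ DIM('a) * (wt v (hc a l) / l ^ DIM('a)) powr (1 + d)))"
    using reverse_Hoelder[OF Ap_pair_dual[OF A]] by blast
  \<comment> \<open>With k = \<alpha> q the excess exponents will be k/(1-k) and k/(p-1-k). They
    stay below \<open>d1\<close> and \<open>d2\<close> when k is below d1/(1+d1) and d2(p-1)/(1+d2);
    the division by \<open>q\<close> turns this into a bound on \<alpha>.\<close>
  define e where "e = min (d1 / (1 + d1)) (d2 * (p - 1) / (1 + d2)) / q"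
  have e: "e > 0" using d1 d2 p q by (simp add: e_def)
  show ?thesis
  proof (rule that[OF e])
    fix \<alpha> :: real assume \<alpha>: "0 < \<alpha>" "\<alpha> < e"
    define k where "k = \<alpha> * q"
    have k: "k > 0" "k < d1 / (1 + d1)" "k < d2 * (p - 1) / (1 + d2)"
      using \<alpha> q by (auto simp: k_def e_def pos_less_divide_eq)
    have "d1 / (1 + d1) < 1" using d1 by simp
    then have k1: "k < 1" using k by linarith
    have "d2 * (p - 1) / (1 + d2) < p - 1" using d2 p by (simp add: field_simps)
    then have k2: "k < p - 1" using k by linarith
    have "\<alpha> < k" using \<alpha> q by (simp add: k_def)
    define \<beta> where "\<beta> = 1 - \<alpha>"
    have \<beta>: "\<beta> > 0" using \<open>\<alpha> < k\<close> k1 by (simp add: \<beta>_def)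
    \<comment> \<open>The numerator of p_1 - 1: with \<beta> = 1 - \<alpha> one has p_1 - 1 =
      D/\<beta>.\<close>
    define D where "D = p - 1 - \<alpha> * (q - 1)"
    have Dk: "D - \<alpha> = p - 1 - k" by (simp add: D_def k_def algebra_simps)
    have D: "D > 0" using k2 \<alpha> Dk by linarith
    define p1 where "p1 = (p - \<alpha> * q) / \<beta>"
    have p1D: "p1 - 1 = D / \<beta>" using \<beta> by (simp add: p1_def D_def \<beta>_def field_simps)
    have "D / \<beta> > 0" using D \<beta> by simp
    then have p1: "p1 > 1" using p1D by linarith
    define s1 where "s1 x = s x powr (1 / \<beta>) * w x powr (- \<alpha> / \<beta>)" for x
    define da where "da = 1 / (1 - k) - 1"
    define db where "db = (p - 1) / (p - 1 - k) - 1"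
    have da: "0 < da" "da \<le> d1"
    proof -
      have eq: "da = k / (1 - k)" using k1 by (simp add: da_def field_simps)
      show "0 < da" unfolding eq using k k1 by simp
      have "k * (1 + d1) < d1" using k(2) d1(1) by (simp add: pos_less_divide_eq)
      then have "k \<le> d1 * (1 - k)" by (simp add: algebra_simps)
      then show "da \<le> d1" unfolding eq using k1 by (simp add: pos_divide_le_eq)
    qed
    have db: "0 < db" "db \<le> d2"
    proof -
      have eq: "db = k / (p - 1 - k)" using k2 by (simp add: db_def field_simps)
      show "0 < db" unfolding eq using k k2 by simp
      have "k * (1 + d2) < d2 * (p - 1)" using k(3) d2(1) by (simp add: pos_less_divide_eq)
      then have "k \<le> d2 * (p - 1 - k)" by (simp add: algebra_simps)
      then show "db \<le> d2" unfolding eq using k2 by (simp add: pos_divide_le_eq)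
    qed
    obtain C1 where C1: "C1 \<ge> 0" "\<And>a l. 0 < l \<Longrightarrow> (mass (\<lambda>x. s x powr (1 + da)) (hc a l)) \<le> ennreal (C1 * (l ^ DIM('a) * (wt s (hc a l) / l ^ DIM('a)) powr (1 + da)))"
      using d1(2)[OF da] by blast
    obtain C2 where C2: "C2 \<ge> 0" "\<And>a l. 0 < l \<Longrightarrow> (mass (\<lambda>x. v x powr (1 + db)) (hc a l)) \<le> ennreal (C2 * (l ^ DIM('a) * (wt v (hc a l) / l ^ DIM('a)) powr (1 + db)))"
      using d2(2)[OF db] by blast
    \<comment> \<open>The Hoelder exponents for \<open>s1\<close>: (1 + da) x1 = 1/\<beta> is the
      power of \<open>s\<close>, and z^y1 is the power -\<alpha>/\<beta> of \<open>w\<close>. They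
      add up to 1 because (1 - \<alpha> q) + \<alpha> (q - 1) = 1 - \<alpha>.\<close>
    define x1 where "x1 = (1 - k) / \<beta>"
    define y1 where "y1 = \<alpha> * (q - 1) / \<beta>"
    have xy1: "x1 > 0" "y1 > 0" "x1 + y1 = 1"
      using k1 \<beta> \<alpha> q by (auto simp: x1_def y1_def k_def \<beta>_def add_divide_distrib[symmetric] algebra_simps)
    have dx1: "(1 + da) * x1 = 1 / \<beta>" using k1 by (simp add: da_def x1_def)
    \<comment> \<open>The Hoelder exponents for the dual weight of \<open>s1\<close>, which is
      s^(-1/D) w^(\<alpha>/D), that is v^((p-1)/D) w^y2.\<close>
    define x2 where "x2 = (D - \<alpha>) / D"
    define y2 where "y2 = \<alpha> / D"
    have xy2: "x2 > 0" "y2 > 0" "x2 + y2 = 1"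
    proof -
      show "x2 > 0" unfolding x2_def Dk using k2 D by (intro divide_pos_pos) auto
      show "y2 > 0" "x2 + y2 = 1" using D \<alpha> by (auto simp: x2_def y2_def add_divide_distrib[symmetric])
    qed
    have dx2: "(1 + db) * x2 = (p - 1) / D" unfolding x2_def Dk using k2 by (simp add: db_def)
    have "Ap p1 s1"
    proof (rule Ap_weightI[OF p1])
      show "s1 \<in> borel_measurable lebesgue" unfolding s1_def by measurable
      show "AE x in lebesgue. s1 x > 0" using sp wp by eventually_elim (simp add: s1_def)
      fix a :: 'a and l :: real assume l: "0 < l"
      let ?m = "l ^ DIM('a)"
      define S V W Z where "S = wt s (hc a l) / ?m" and "V = wt v (hc a l) / ?m" and "W = wt w (hc a l) / ?m" and "Z = wt z (hc a l) / ?m"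
      have nn: "S \<ge> 0" "V \<ge> 0" "W \<ge> 0" "Z \<ge> 0" using l by (auto simp: S_def V_def W_def Z_def)
      define X where "X = C1 powr x1 * S powr (1 / \<beta>) * Z powr y1"
      define Y where "Y = C2 powr x2 * V powr ((p - 1) / D) * W powr y2"
      have SV: "S * V powr (p - 1) \<le> K" unfolding S_def V_def by (rule Ap_pair_avg_le[OF A l])
      have WZ: "W * Z powr (q - 1) \<le> K'" unfolding W_def Z_def by (rule Ap_pair_avg_le[OF B l])
      have "mass s1 (hc a l) \<le> ennreal (?m * (C1 powr x1 * S powr ((1 + da) * x1) * Z powr y1))"
        unfolding S_def Z_def
      proof (rule product_avg_le[OF ls lz l da(1) xy1 C1(1) C1(2)[OF l]])
        show "AE t in lebesgue. s1 t = s t powr ((1 + da) * x1) * z t powr y1"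
          using sp wp by eventually_elim (use q in \<open>auto simp: s1_def z_def dx1 powr_powr y1_def\<close>)
      qed
      then have 1: "mass s1 (hc a l) \<le> ennreal (?m * X)" unfolding X_def dx1 .
      have "mass (\<lambda>x. s1 x powr (- 1 / (p1 - 1))) (hc a l) \<le> ennreal (?m * (C2 powr x2 * V powr ((1 + db) * x2) * W powr y2))"
        unfolding V_def W_def
      proof (rule product_avg_le[OF lv lw l db(1) xy2 C2(1) C2(2)[OF l]])
        show "AE t in lebesgue. s1 t powr (- 1 / (p1 - 1)) = v t powr ((1 + db) * x2) * w t powr y2"
          using sp wp
        proof eventually_elim
          case (elim t)
          have "s1 t powr (- 1 / (p1 - 1)) = s t powr (1 / \<beta> * (- 1 / (D / \<beta>))) * w t powr (- \<alpha> / \<beta> * (- 1 / (D / \<beta>)))"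
            unfolding s1_def p1D by (simp only: powr_mult powr_ge_zero powr_powr)
          also have "1 / \<beta> * (- 1 / (D / \<beta>)) = - 1 / (p - 1) * ((p - 1) / D)" using p \<beta> D by (simp add: field_simps)
          also have "- \<alpha> / \<beta> * (- 1 / (D / \<beta>)) = y2" using \<beta> D by (simp add: field_simps y2_def)
          finally show ?case unfolding v_def dx2 powr_powr .
        qed
      qed
      then have 2: "mass (\<lambda>x. s1 x powr (- 1 / (p1 - 1))) (hc a l) \<le> ennreal (?m * Y)" unfolding Y_def dx2 .
      have "Y powr (p1 - 1) = C2 powr (x2 * (D / \<beta>)) * V powr ((p - 1) / D * (D / \<beta>)) * W powr (y2 * (D / \<beta>))"
        unfolding Y_def p1D by (simp only: powr_mult powr_ge_zero powr_powr mult_nonneg_nonneg)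
      also have "(p - 1) / D * (D / \<beta>) = (p - 1) * (1 / \<beta>)" using D by simp
      also have "y2 * (D / \<beta>) = \<alpha> / \<beta>" using D by (simp add: y2_def)
      finally have Yp: "Y powr (p1 - 1) = C2 powr (x2 * (D / \<beta>)) * V powr ((p - 1) * (1 / \<beta>)) * W powr (\<alpha> / \<beta>)" .
      have y1': "y1 = (q - 1) * (\<alpha> / \<beta>)" by (simp add: y1_def)
      \<comment> \<open>The powers combine to the A_p product of \<open>s\<close> and the A_q
        product of \<open>w\<close>. Since \<open>w\<close> enters \<open>s1\<close> with a negative
        exponent, its dual comes from the mean of \<open>s1\<close> and \<open>w\<close> itself from
        the mean of the dual weight.\<close>
      have "X * Y powr (p1 - 1) = C1 powr x1 * C2 powr (x2 * (D / \<beta>)) * ((S * V powr (p - 1)) powr (1 / \<beta>) * (W * Z powr (q - 1)) powr (\<alpha> / \<beta>))"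
        unfolding Yp X_def y1' using nn by (simp add: powr_mult powr_powr)
      also have "\<dots> \<le> C1 powr x1 * C2 powr (x2 * (D / \<beta>)) * (K powr (1 / \<beta>) * K' powr (\<alpha> / \<beta>))"
        using SV WZ nn \<beta> \<alpha> by (intro mult_left_mono mult_mono powr_mono2) auto
      finally have 3: "X * Y powr (p1 - 1) \<le> C1 powr x1 * C2 powr (x2 * (D / \<beta>)) * (K powr (1 / \<beta>) * K' powr (\<alpha> / \<beta>))" .
      have "X \<ge> 0" "Y \<ge> 0" by (auto simp: X_def Y_def)
      with 1 2 3 show "\<exists>X Y. 0 \<le> X \<and> 0 \<le> Y \<and>
         (mass s1 (hc a l)) \<le> ennreal (?m * X) \<and>
         (mass (\<lambda>x. s1 x powr (- 1 / (p1 - 1))) (hc a l)) \<le> ennreal (?m * Y) \<and>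
         X * Y powr (p1 - 1) \<le> C1 powr x1 * C2 powr (x2 * (D / \<beta>)) * (K powr (1 / \<beta>) * K' powr (\<alpha> / \<beta>))" by blast
    qed
    then show "\<alpha> < 1 \<and> 1 < (p - \<alpha> * q) / (1 - \<alpha>) \<and>
     Ap ((p - \<alpha> * q) / (1 - \<alpha>)) (\<lambda>x. s x powr (1 / (1 - \<alpha>)) * w x powr (- \<alpha> / (1 - \<alpha>)))"
      using p1 \<beta> unfolding p1_def s1_def \<beta>_def by simp
  qed
qed

section \<open>Real interpolation with change of measure\<close>

lemma sigma_finite_lebesgue: "sigma_finite_measure (lebesgue :: 'a::euclidean_space measure)"
proof
  show "\<exists>A. countable A \<and> A \<subseteq> sets lebesgue \<and> \<Union>A = space (lebesgue :: 'a measure) \<and> (\<forall>a\<in>A. emeasure lebesgue a \<noteq> \<infinity>)"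
  proof (intro exI[of _ "range big_cube"] conjI ballI)
    have "x \<in> \<Union>(range big_cube)" for x :: 'a using bounded_subset_big_cube[of "{x}"] by auto
    then show "\<Union>(range big_cube) = space (lebesgue :: 'a measure)" by auto
    fix A :: "'a set" assume "A \<in> range big_cube"
    then obtain n where "A = hc (- (2^n) *\<^sub>R One) (2 * 2^n)" by (auto simp: big_cube_def)
    then show "emeasure lebesgue A \<noteq> \<infinity>"
      using emeasure_hc[of "2 * 2^n" "- (2^n) *\<^sub>R (One :: 'a)"] by simp
  qed auto
qed

text \<open>The kernel identity at each point, followed by Tonelli. An integrated geometric mean is
  thereby controlled by the integrals of \<open>min (B x) (t * C x)\<close> for all t > 0, which
  respond to a decomposition depending on t.\<close>

lemma nn_integral_powr_eq_min:
  fixes B C :: "'b \<Rightarrow> real"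
  assumes sf: "sigma_finite_measure M" and [measurable]: "B \<in> borel_measurable M" "C \<in> borel_measurable M"
    and B0: "AE x in M. 0 \<le> B x" and C0: "AE x in M. 0 \<le> C x" and ab: "0 < a" "0 < b" "a + b = 1"
  shows "(\<integral>\<^sup>+x. ennreal ((1/a + 1/b) * (B x powr a * C x powr b)) \<partial>M)
    = (\<integral>\<^sup>+t. (\<integral>\<^sup>+x. ennreal (min (B x) (t * C x)) \<partial>M) * (ennreal (t powr (- b - 1)) * indicator {0..} t) \<partial>lborel)"
proof -
  interpret pair_sigma_finite M "lborel :: real measure"
    using sf sigma_finite_lborel by (simp add: pair_sigma_finite_def)
  have "(\<integral>\<^sup>+x. ennreal ((1/a + 1/b) * (B x powr a * C x powr b)) \<partial>M)
     = (\<integral>\<^sup>+x. (\<integral>\<^sup>+t. ennreal (min (B x) (t * C x) * t powr (- b - 1)) * indicator {0..} t \<partial>lborel) \<partial>M)"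
    using B0 C0 by (intro nn_integral_cong_AE, eventually_elim) (simp only: nn_integral_min_powr[OF _ _ ab])
  also have "\<dots> = (\<integral>\<^sup>+t. (\<integral>\<^sup>+x. ennreal (min (B x) (t * C x) * t powr (- b - 1)) * indicator {0..} t \<partial>M) \<partial>lborel)"
    by (rule Fubini'[symmetric]) measurable
  also have "\<dots> = (\<integral>\<^sup>+t. (\<integral>\<^sup>+x. ennreal (min (B x) (t * C x)) * (ennreal (t powr (- b - 1)) * indicator {0..} t) \<partial>M) \<partial>lborel)"
    by (intro nn_integral_cong) (simp add: ennreal_mult'' mult.assoc)
  also have "\<dots> = (\<integral>\<^sup>+t. (\<integral>\<^sup>+x. ennreal (min (B x) (t * C x)) \<partial>M) * (ennreal (t powr (- b - 1)) * indicator {0..} t) \<partial>lborel)"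
    by (intro nn_integral_cong nn_integral_multc) measurable
  finally show ?thesis .
qed

text \<open>For each \<open>t\<close> cut \<open>f\<close> where \<open>E |f|\<^sup>q w\<close> exceeds \<open>t N |f|\<^bsup>p\<^sub>1\<^esup> s\<^sub>1\<close>; this bounds the integral of
  \<open>min (|S f|\<^sup>q w) (t |S f|\<^bsup>p\<^sub>1\<^esup> l\<^sub>1)\<close>, and integrating over \<open>t\<close> recovers the powers.\<close>

lemma interpolate_operator:
  fixes S :: "('b \<Rightarrow> complex) \<Rightarrow> 'b \<Rightarrow> complex" and w s1 l1 :: "'b \<Rightarrow> real"
  assumes sf: "sigma_finite_measure M"
    and [measurable]: "w \<in> borel_measurable M" "s1 \<in> borel_measurable M" "l1 \<in> borel_measurable M"
      "s \<in> borel_measurable M" "l \<in> borel_measurable M"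
    and pos: "AE x in M. 0 \<le> w x" "AE x in M. 0 \<le> s1 x" "AE x in M. 0 \<le> l1 x"
    and s: "AE x in M. s x = w x powr a * s1 x powr b" and l: "AE x in M. l x = w x powr a * l1 x powr b"
    and ab: "0 < a" "0 < b" "a + b = 1" and q: "0 < q" and p1: "0 < p1" and p: "p = a * q + b * p1"
    and E: "E > 0" and N: "N > 0"
    and S0: "\<And>g. g \<in> borel_measurable M \<Longrightarrow> (modular M q w g) < \<infinity> \<Longrightarrow>
       S g \<in> borel_measurable M \<and> modular M q w (S g) \<le> ennreal E * modular M q w g"
    and S1: "\<And>g. g \<in> borel_measurable M \<Longrightarrow> (modular M p1 s1 g) < \<infinity> \<Longrightarrow>
       S g \<in> borel_measurable M \<and> modular M p1 l1 (S g) \<le> ennreal N * modular M p1 s1 g"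
    and Sadd: "\<And>g h. g \<in> borel_measurable M \<Longrightarrow> h \<in> borel_measurable M \<Longrightarrow>
       (modular M q w g) < \<infinity> \<Longrightarrow> (modular M p1 s1 h) < \<infinity> \<Longrightarrow>
       S (\<lambda>x. g x + h x) = (\<lambda>x. S g x + S h x)"
    and f[measurable]: "f \<in> borel_measurable M" and Sf[measurable]: "S f \<in> borel_measurable M"
    and fin: "modular M p s f < \<infinity>"
  shows "modular M p l (S f)
     \<le> ennreal (2 powr max q p1 * (E powr a * N powr b)) * modular M p s f"
proof -
  \<comment> \<open>The constant of the kernel identity. It occurs on both sides of the final
    estimate and cancels.\<close>
  define \<kappa> where "\<kappa> = 1/a + 1/b"
  have \<kappa>: "\<kappa> > 0" using ab by (simp add: \<kappa>_def add_pos_pos)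
  define Mx where "Mx = 2 powr max q p1"
  have Mx: "Mx > 0" by (simp add: Mx_def)
  define B where "B x = norm (S f x) powr q * w x" for x
  define C where "C x = norm (S f x) powr p1 * l1 x" for x
  define bb where "bb x = norm (f x) powr q * w x" for x
  define cc where "cc x = norm (f x) powr p1 * s1 x" for x
  have [measurable]: "B \<in> borel_measurable M" "C \<in> borel_measurable M" "bb \<in> borel_measurable M" "cc \<in> borel_measurable M"
    unfolding B_def C_def bb_def cc_def by measurable
  have nn: "AE x in M. 0 \<le> bb x" "AE x in M. 0 \<le> cc x" "AE x in M. 0 \<le> B x" "AE x in M. 0 \<le> C x"
    unfolding B_def C_def bb_def cc_def using pos(1) pos(2) pos(1) pos(3) by (eventually_elim, simp)+
  have split: "(r powr q * y) powr a * (r powr p1 * z) powr b = r powr p * (y powr a * z powr b)"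
    if "r \<ge> 0" "y \<ge> 0" "z \<ge> 0" for r y z :: real
    using that by (simp add: powr_mult powr_powr p powr_add mult_ac)
  have fa: "AE x in M. bb x powr a * cc x powr b = norm (f x) powr p * s x"
    using pos s by eventually_elim (simp add: bb_def cc_def split)
  have Sfa: "AE x in M. B x powr a * C x powr b = norm (S f x) powr p * l x"
    using pos l by eventually_elim (simp add: B_def C_def split)
  have key: "(\<integral>\<^sup>+x. ennreal (min (B x) (t * C x)) \<partial>M) \<le> ennreal Mx * (\<integral>\<^sup>+x. ennreal (min (E * bb x) (t * (N * cc x))) \<partial>M)"
    if t: "t > 0" for t
  proof -
    \<comment> \<open>The cut follows the smaller of the two terms E bb and t N cc, so that the
      endpoint bounds for the two pieces add up exactly to the integral of their minimum.\<close>
    define f0 where "f0 x = (if E * bb x \<le> t * (N * cc x) then f x else 0)" for x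
    define f1 where "f1 x = (if E * bb x \<le> t * (N * cc x) then 0 else f x)" for x
    have [measurable]: "f0 \<in> borel_measurable M" "f1 \<in> borel_measurable M"
      unfolding f0_def f1_def by measurable
    \<comment> \<open>Where \<open>f0\<close> is nonzero, bb \<le> (t N/E) cc; writing bb = bb^a
      bb^b and applying this to the second factor bounds bb by a multiple of |f|^p s. The piece
      \<open>f1\<close> is treated symmetrically.\<close>
    have "modular M q w f0 \<le> (\<integral>\<^sup>+x. ennreal ((t * N / E) powr b) * ennreal (norm (f x) powr p * s x) \<partial>M)"
      using nn(1,2) fa
    proof (intro nn_integral_mono_AE, eventually_elim)
      case (elim x)
      show ?case
      proof (cases "E * bb x \<le> t * (N * cc x)")
        case True
        then have "bb x \<le> (t * N / E) * cc x" using E by (simp add: field_simps)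
        then have "bb x powr b \<le> ((t * N / E) * cc x) powr b" using elim ab by (intro powr_mono2) auto
        then have "bb x powr a * bb x powr b \<le> bb x powr a * ((t * N / E) powr b * cc x powr b)"
          unfolding powr_mult[of "t * N / E" "cc x" b] by (intro mult_left_mono) auto
        moreover have "bb x powr a * bb x powr b = bb x" using elim ab by (subst powr_add[symmetric]) auto
        ultimately have "bb x \<le> (t * N / E) powr b * (norm (f x) powr p * s x)" unfolding elim(6)[symmetric] by (simp add: mult_ac)
        then show ?thesis using True by (simp add: f0_def ennreal_mult'[symmetric] ennreal_leI bb_def)
      qed (use q in \<open>simp add: f0_def\<close>)
    qed
    also have "\<dots> < \<infinity>" using fin by (simp add: nn_integral_cmult ennreal_mult_less_top)
    finally have fin0: "modular M q w f0 < \<infinity>" .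
    have "modular M p1 s1 f1 \<le> (\<integral>\<^sup>+x. ennreal ((E / (t * N)) powr a) * ennreal (norm (f x) powr p * s x) \<partial>M)"
      using nn(1,2) fa
    proof (intro nn_integral_mono_AE, eventually_elim)
      case (elim x)
      show ?case
      proof (cases "E * bb x \<le> t * (N * cc x)")
        case False
        then have "cc x \<le> (E / (t * N)) * bb x" using t N by (simp add: field_simps)
        then have "cc x powr a \<le> ((E / (t * N)) * bb x) powr a" using elim ab by (intro powr_mono2) auto
        then have "cc x powr a * cc x powr b \<le> ((E / (t * N)) powr a * bb x powr a) * cc x powr b"
          unfolding powr_mult[of "E / (t * N)" "bb x" a] by (intro mult_right_mono) auto
        moreover have "cc x powr a * cc x powr b = cc x" using elim ab by (subst powr_add[symmetric]) auto
        ultimately have "cc x \<le> (E / (t * N)) powr a * (norm (f x) powr p * s x)" unfolding elim(6)[symmetric] by (simp add: mult_ac)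
        then show ?thesis using False by (simp add: f1_def ennreal_mult'[symmetric] ennreal_leI cc_def)
      qed (use p1 in \<open>simp add: f1_def\<close>)
    qed
    also have "\<dots> < \<infinity>" using fin by (simp add: nn_integral_cmult ennreal_mult_less_top)
    finally have fin1: "modular M p1 s1 f1 < \<infinity>" .
    have ff: "f = (\<lambda>x. f0 x + f1 x)" by (auto simp: f0_def f1_def)
    have Sff: "S f x = S f0 x + S f1 x" for x
      using fun_cong[OF Sadd[of f0 f1]] fin0 fin1 by (simp add: ff[symmetric])
    have [measurable]: "S f0 \<in> borel_measurable M" "S f1 \<in> borel_measurable M" using S0[OF _ fin0] S1[OF _ fin1] by auto
    have "(\<integral>\<^sup>+x. ennreal (min (B x) (t * C x)) \<partial>M)
       \<le> (\<integral>\<^sup>+x. ennreal Mx * (ennreal (norm (S f0 x) powr q * w x) + ennreal t * ennreal (norm (S f1 x) powr p1 * l1 x)) \<partial>M)"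
      using pos
    proof (intro nn_integral_mono_AE, eventually_elim)
      case (elim x)
      have M2: "2 powr q \<le> Mx" "2 powr p1 \<le> Mx" unfolding Mx_def by (auto intro!: powr_mono)
      \<comment> \<open>The value of S f is at most twice the larger of the two pieces in norm; the
        minimum is estimated by its entry belonging to that piece.\<close>
      have "min (B x) (t * C x) \<le> Mx * (norm (S f0 x) powr q * w x + t * (norm (S f1 x) powr p1 * l1 x))"
      proof (cases "norm (S f1 x) \<le> norm (S f0 x)")
        case True
        then have "norm (S f x) \<le> 2 * norm (S f0 x)" unfolding Sff using norm_triangle_ineq[of "S f0 x" "S f1 x"] by linarith
        then have "norm (S f x) powr q \<le> (2 * norm (S f0 x)) powr q" using q by (intro powr_mono2) auto
        also have "\<dots> \<le> Mx * norm (S f0 x) powr q" using M2 by (simp add: powr_mult mult_right_mono)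
        finally have "B x \<le> (Mx * norm (S f0 x) powr q) * w x" unfolding B_def using elim by (intro mult_right_mono) auto
        moreover have "0 \<le> Mx * (t * (norm (S f1 x) powr p1 * l1 x))" using Mx t elim by (intro mult_nonneg_nonneg) auto
        ultimately show ?thesis by (simp add: distrib_left mult.assoc)
      next
        case False
        then have "norm (S f x) \<le> 2 * norm (S f1 x)" unfolding Sff using norm_triangle_ineq[of "S f0 x" "S f1 x"] by linarith
        then have "norm (S f x) powr p1 \<le> (2 * norm (S f1 x)) powr p1" using p1 by (intro powr_mono2) auto
        also have "\<dots> \<le> Mx * norm (S f1 x) powr p1" using M2 by (simp add: powr_mult mult_right_mono)
        finally have "C x \<le> (Mx * norm (S f1 x) powr p1) * l1 x" unfolding C_def using elim by (intro mult_right_mono) auto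
        then have "t * C x \<le> t * ((Mx * norm (S f1 x) powr p1) * l1 x)" using t by (intro mult_left_mono) auto
        moreover have "0 \<le> Mx * (norm (S f0 x) powr q * w x)" using Mx elim by (intro mult_nonneg_nonneg) auto
        ultimately have "t * C x \<le> Mx * (norm (S f0 x) powr q * w x) + t * ((Mx * norm (S f1 x) powr p1) * l1 x)" by linarith
        also have "\<dots> = Mx * (norm (S f0 x) powr q * w x + t * (norm (S f1 x) powr p1 * l1 x))" by (simp add: algebra_simps)
        finally show ?thesis by linarith
      qed
      then have "ennreal (min (B x) (t * C x)) \<le> ennreal (Mx * (norm (S f0 x) powr q * w x + t * (norm (S f1 x) powr p1 * l1 x)))"
        by (rule ennreal_leI)
      also have "\<dots> = ennreal Mx * (ennreal (norm (S f0 x) powr q * w x) + ennreal t * ennreal (norm (S f1 x) powr p1 * l1 x))"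
        using Mx t elim by (simp add: ennreal_mult ennreal_plus)
      finally show ?case .
    qed
    also have "\<dots> = ennreal Mx * (modular M q w (S f0) + ennreal t * modular M p1 l1 (S f1))"
      by (simp add: nn_integral_cmult nn_integral_add)
    also have "\<dots> \<le> ennreal Mx * (ennreal E * modular M q w f0 + ennreal t * (ennreal N * modular M p1 s1 f1))"
      using S0[OF _ fin0] S1[OF _ fin1] by (intro mult_left_mono add_mono) auto
    also have "\<dots> = ennreal Mx * (\<integral>\<^sup>+x. ennreal E * ennreal (norm (f0 x) powr q * w x) + ennreal t * (ennreal N * ennreal (norm (f1 x) powr p1 * s1 x)) \<partial>M)"
      by (simp add: nn_integral_cmult nn_integral_add)
    also have "(\<integral>\<^sup>+x. ennreal E * ennreal (norm (f0 x) powr q * w x) + ennreal t * (ennreal N * ennreal (norm (f1 x) powr p1 * s1 x)) \<partial>M)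
       = (\<integral>\<^sup>+x. ennreal (min (E * bb x) (t * (N * cc x))) \<partial>M)"
    proof (intro nn_integral_cong)
      fix x
      show "ennreal E * ennreal (norm (f0 x) powr q * w x) + ennreal t * (ennreal N * ennreal (norm (f1 x) powr p1 * s1 x)) = ennreal (min (E * bb x) (t * (N * cc x)))"
        using E N t q p1 by (cases "E * bb x \<le> t * (N * cc x)") (auto simp: f0_def f1_def bb_def cc_def ennreal_mult'[symmetric] min_def)
    qed
    finally show ?thesis .
  qed
  have "ennreal \<kappa> * modular M p l (S f) = (\<integral>\<^sup>+x. ennreal (\<kappa> * (B x powr a * C x powr b)) \<partial>M)"
  proof -
    have "(\<integral>\<^sup>+x. ennreal (\<kappa> * (B x powr a * C x powr b)) \<partial>M) = (\<integral>\<^sup>+x. ennreal \<kappa> * ennreal (norm (S f x) powr p * l x) \<partial>M)"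
      using Sfa by (intro nn_integral_cong_AE, eventually_elim) (use \<kappa> in \<open>simp add: ennreal_mult'\<close>)
    then show ?thesis by (simp add: nn_integral_cmult)
  qed
  also have "\<dots> = (\<integral>\<^sup>+t. (\<integral>\<^sup>+x. ennreal (min (B x) (t * C x)) \<partial>M) * (ennreal (t powr (- b - 1)) * indicator {0..} t) \<partial>lborel)"
    unfolding \<kappa>_def using nn by (intro nn_integral_powr_eq_min[OF sf _ _ _ _ ab]) auto
  also have "\<dots> \<le> (\<integral>\<^sup>+t. ennreal Mx * ((\<integral>\<^sup>+x. ennreal (min (E * bb x) (t * (N * cc x))) \<partial>M) * (ennreal (t powr (- b - 1)) * indicator {0..} t)) \<partial>lborel)"
  proof (intro nn_integral_mono)
    fix t :: real
    show "(\<integral>\<^sup>+x. ennreal (min (B x) (t * C x)) \<partial>M) * (ennreal (t powr (- b - 1)) * indicator {0..} t)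
      \<le> ennreal Mx * ((\<integral>\<^sup>+x. ennreal (min (E * bb x) (t * (N * cc x))) \<partial>M) * (ennreal (t powr (- b - 1)) * indicator {0..} t))"
    proof (cases "t > 0")
      case True
      from mult_right_mono[OF key[OF True], of "ennreal (t powr (- b - 1)) * indicator {0..} t"]
      show ?thesis by (simp add: mult.assoc)
    qed (auto simp: indicator_def)
  qed
  also have "\<dots> = ennreal Mx * (\<integral>\<^sup>+t. (\<integral>\<^sup>+x. ennreal (min (E * bb x) (t * (N * cc x))) \<partial>M) * (ennreal (t powr (- b - 1)) * indicator {0..} t) \<partial>lborel)"
  proof (rule nn_integral_cmult)
    interpret sigma_finite_measure M by (rule sf)
    show "(\<lambda>t. (\<integral>\<^sup>+x. ennreal (min (E * bb x) (t * (N * cc x))) \<partial>M) * (ennreal (t powr (- b - 1)) * indicator {0..} t)) \<in> borel_measurable lborel"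
      by measurable
  qed
  also have "(\<integral>\<^sup>+t. (\<integral>\<^sup>+x. ennreal (min (E * bb x) (t * (N * cc x))) \<partial>M) * (ennreal (t powr (- b - 1)) * indicator {0..} t) \<partial>lborel)
     = (\<integral>\<^sup>+x. ennreal (\<kappa> * ((E * bb x) powr a * (N * cc x) powr b)) \<partial>M)"
  proof -
    have "AE x in M. 0 \<le> E * bb x" using nn(1) by eventually_elim (use E in simp)
    moreover have "AE x in M. 0 \<le> N * cc x" using nn(2) by eventually_elim (use N in simp)
    ultimately show ?thesis
      unfolding \<kappa>_def by (intro nn_integral_powr_eq_min[OF sf _ _ _ _ ab, symmetric]) auto
  qed
  also have "\<dots> = (\<integral>\<^sup>+x. ennreal (\<kappa> * (E powr a * N powr b)) * ennreal (norm (f x) powr p * s x) \<partial>M)"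
    using fa nn(1,2)
  proof (intro nn_integral_cong_AE, eventually_elim)
    case (elim x)
    have "\<kappa> * ((E * bb x) powr a * (N * cc x) powr b) = \<kappa> * (E powr a * N powr b) * (bb x powr a * cc x powr b)"
      using elim E N by (simp add: powr_mult mult_ac)
    then show ?case using \<kappa> by (simp only: elim(4) ennreal_mult' mult_nonneg_nonneg powr_ge_zero less_imp_le)
  qed
  also have "\<dots> = ennreal (\<kappa> * (E powr a * N powr b)) * modular M p s f"
    by (simp add: nn_integral_cmult)
  finally have "ennreal \<kappa> * modular M p l (S f)
     \<le> ennreal \<kappa> * (ennreal (Mx * (E powr a * N powr b)) * modular M p s f)"
    using \<kappa> Mx by (simp add: ennreal_mult mult_ac)
  then show ?thesis unfolding Mx_def
    using \<kappa> by (subst (asm) ennreal_mult_le_mult_iff) auto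
qed

section \<open>Averaging operators on weighted spaces\<close>

lemma LpD:
  assumes "f \<in> Lp p w"
  shows "f \<in> borel_measurable lebesgue" "Lp_int p w f < \<infinity>"
  using assms by (auto simp: Lp_def)

lemma Lp_norm_le_imp_Lp_int_le:
  assumes f: "f \<in> Lp p w" and p: "p > 0" and N: "Lp_norm p w f \<le> N"
  shows "Lp_int p w f \<le> ennreal (N powr p)"
proof -
  define X where "X = enn2real (Lp_int p w f)"
  have X: "Lp_int p w f = ennreal X" "X \<ge> 0" using LpD(2)[OF f] by (auto simp: X_def less_top[symmetric])
  have "X = (X powr (1/p)) powr p" using X p by (simp add: powr_powr)
  also have "\<dots> \<le> N powr p" using N p by (intro powr_mono2) (auto simp: Lp_norm_def X_def)
  finally show ?thesis unfolding X by (rule ennreal_leI)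
qed

lemma Lp_int_tendsto_0_imp_Lp_norm:
  assumes "(\<lambda>n. Lp_int p w (f n)) \<longlonglongrightarrow> 0" "p > 0"
  shows "(\<lambda>n. Lp_norm p w (f n)) \<longlonglongrightarrow> 0"
proof -
  have "(\<lambda>n. enn2real (Lp_int p w (f n))) \<longlonglongrightarrow> enn2real 0" using assms(1) by (intro tendsto_enn2real) auto
  then have "(\<lambda>n. enn2real (Lp_int p w (f n)) powr (1/p)) \<longlonglongrightarrow> 0"
    using assms(2) by (intro tendsto_zero_powrI[where b = "1/p"]) auto
  then show ?thesis by (simp add: Lp_norm_def)
qed

lemma Lp_norm_tendsto_0_imp_Lp_int:
  assumes f: "\<And>n. f n \<in> Lp p w" and lim: "(\<lambda>n. Lp_norm p w (f n)) \<longlonglongrightarrow> 0" and p: "p > 0"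
  shows "(\<lambda>n. Lp_int p w (f n)) \<longlonglongrightarrow> 0"
proof (rule ennreal_tendsto_0I)
  fix e :: real assume e: "e > 0"
  have "\<forall>\<^sub>F n in sequentially. Lp_norm p w (f n) < e powr (1/p)" using order_tendstoD(2)[OF lim] e by simp
  then show "\<forall>\<^sub>F n in sequentially. Lp_int p w (f n) \<le> ennreal e"
  proof eventually_elim
    case (elim n)
    then have "Lp_int p w (f n) \<le> ennreal ((e powr (1/p)) powr p)" by (intro Lp_norm_le_imp_Lp_int_le[OF f p]) simp
    then show ?case using e p by (simp add: powr_powr)
  qed
qed

lemma Lp_int_add_le:
  assumes "loc_fin w" "p > 0" "f \<in> borel_measurable lebesgue" "g \<in> borel_measurable lebesgue"
  shows "Lp_int p w (\<lambda>x. f x + g x) \<le> ennreal (2 powr p) * (Lp_int p w f + Lp_int p w g)"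
  unfolding Lp_int_def using assms loc_finD[OF assms(1)] by (intro nn_integral_norm_add_powr_le) auto

lemma Lp_int_minus: "Lp_int p w (\<lambda>x. f x - g x) = Lp_int p w (\<lambda>x. g x - f x)"
  unfolding Lp_int_def by (simp add: norm_minus_commute)

lemma Lp_int_diff_le:
  assumes "loc_fin w" "p > 0" "f \<in> borel_measurable lebesgue" "g \<in> borel_measurable lebesgue"
  shows "Lp_int p w (\<lambda>x. f x - g x) \<le> ennreal (2 powr p) * (Lp_int p w f + Lp_int p w g)"
proof -
  have "Lp_int p w (\<lambda>x. f x - g x) = Lp_int p w (\<lambda>x. f x + - g x)" by simp
  also have "\<dots> \<le> ennreal (2 powr p) * (Lp_int p w f + Lp_int p w (\<lambda>x. - g x))"
    using assms by (intro Lp_int_add_le) auto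
  also have "Lp_int p w (\<lambda>x. - g x) = Lp_int p w g" by (simp add: Lp_int_def)
  finally show ?thesis .
qed

lemma Lp_diff:
  assumes "loc_fin w" "p > 0" "f \<in> Lp p w" "g \<in> Lp p w"
  shows "(\<lambda>x. f x - g x) \<in> Lp p w"
proof -
  have "Lp_int p w (\<lambda>x. f x - g x) \<le> ennreal (2 powr p) * (Lp_int p w f + Lp_int p w g)"
    using assms by (intro Lp_int_diff_le) (auto simp: Lp_def)
  also have "\<dots> < \<infinity>" using assms by (simp add: Lp_def ennreal_mult_less_top)
  finally show ?thesis using assms by (auto simp: Lp_def)
qed

lemma Lp_int_scale:
  assumes "loc_fin w" "f \<in> borel_measurable lebesgue"
  shows "Lp_int p w (\<lambda>x. c * f x) = ennreal (norm c powr p) * Lp_int p w f"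
proof -
  have [measurable]: "w \<in> borel_measurable lebesgue" "f \<in> borel_measurable lebesgue" using loc_finD[OF assms(1)] assms by auto
  have "Lp_int p w (\<lambda>x. c * f x) = (\<integral>\<^sup>+x. ennreal (norm c powr p) * ennreal (norm (f x) powr p * w x) \<partial>lebesgue)"
    unfolding Lp_int_def by (intro nn_integral_cong) (simp add: norm_mult powr_mult ennreal_mult'[symmetric] mult.assoc)
  then show ?thesis by (simp add: nn_integral_cmult Lp_int_def)
qed

lemma bounded_op_Lp_int:
  assumes b: "bounded_op T p s l" and p: "p > 0"
  obtains N where "N > 0" "\<And>f. f \<in> Lp p s \<Longrightarrow> T f \<in> Lp p l" "\<And>f. f \<in> Lp p s \<Longrightarrow> Lp_int p l (T f) \<le> ennreal N * Lp_int p s f"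
proof -
  obtain C where C: "\<And>f. f \<in> Lp p s \<Longrightarrow> T f \<in> Lp p l" "\<And>f. f \<in> Lp p s \<Longrightarrow> Lp_norm p l (T f) \<le> C * Lp_norm p s f"
    using b unfolding bounded_op_def by blast
  \<comment> \<open>Boundedness provides a real \<open>C\<close> of unknown sign; the maximum makes
    the resulting constant positive.\<close>
  define C' where "C' = max C 1"
  show ?thesis
  proof (rule that)
    show "C' powr p > 0" by (simp add: C'_def)
    fix f assume f: "f \<in> Lp p s"
    show "T f \<in> Lp p l" by (rule C(1)[OF f])
    define X where "X = enn2real (Lp_int p s f)"
    have X: "Lp_int p s f = ennreal X" "X \<ge> 0" using LpD(2)[OF f] by (auto simp: X_def less_top[symmetric])
    have "Lp_norm p l (T f) \<le> C * Lp_norm p s f" by (rule C(2)[OF f])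
    also have "\<dots> \<le> C' * Lp_norm p s f" unfolding C'_def by (intro mult_right_mono) (auto simp: Lp_norm_def)
    also have "Lp_norm p s f = X powr (1/p)" by (simp add: Lp_norm_def X_def)
    finally have "Lp_int p l (T f) \<le> ennreal ((C' * X powr (1/p)) powr p)"
      by (intro Lp_norm_le_imp_Lp_int_le[OF C(1)[OF f] p])
    also have "(C' * X powr (1/p)) powr p = C' powr p * X" using X p by (simp add: powr_mult powr_powr C'_def)
    finally show "Lp_int p l (T f) \<le> ennreal (C' powr p) * Lp_int p s f" unfolding X using X(2) by (simp add: ennreal_mult)
  qed
qed

text \<open>One index drives two limits: the cubes with sides 2 * 2^n exhaust the space, while 2n
  subdivisions leave the mesh 2/2^n, which tends to 0. The values are step functions on finitely
  many cells.\<close>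

definition dyproj :: "nat \<Rightarrow> ('a::euclidean_space \<Rightarrow> complex) \<Rightarrow> 'a \<Rightarrow> complex" where
  "dyproj n = dyavg (2 * n) (- (2^n) *\<^sub>R One) (2 * 2^n)"

section \<open>Linearity, uniform bounds and strong convergence of the averaging projections\<close>

lemma dyproj_measurable [measurable]: "dyproj n f \<in> borel_measurable lebesgue"
  unfolding dyproj_def by measurable

lemma dyproj_outside: "x \<notin> big_cube n \<Longrightarrow> dyproj n f x = 0"
  unfolding dyproj_def big_cube_def by (rule dyavg_outside)

lemma Lp_set_integrable:
  assumes A: "Ap_pair p u v K" and f: "f \<in> Lp p u" and r: "r > 0"
  shows "set_integrable lebesgue (hc c r) f"
proof (rule cell_boundD(1)[OF cell_bound_Ap_pair[OF A] r LpD(1)[OF f]])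
  show "mass (\<lambda>x. norm (f x) powr p * u x) (hc c r) < \<infinity>"
    by (rule set_nn_integral_less_top_mono[OF _ subset_UNIV]) (use LpD(2)[OF f] in \<open>simp add: Lp_int_def\<close>)
qed

lemma dyproj_diff:
  assumes "\<And>c r. 0 < r \<Longrightarrow> set_integrable lebesgue (hc c r) f" "\<And>c r. 0 < r \<Longrightarrow> set_integrable lebesgue (hc c r) g"
  shows "dyproj n (\<lambda>x. f x - g x) x = dyproj n f x - dyproj n g x"
  unfolding dyproj_def by (rule dyavg_diff) (use assms in auto)

lemma dyproj_add:
  assumes "\<And>c r. 0 < r \<Longrightarrow> set_integrable lebesgue (hc c r) f" "\<And>c r. 0 < r \<Longrightarrow> set_integrable lebesgue (hc c r) g"
  shows "dyproj n (\<lambda>x. f x + g x) x = dyproj n f x + dyproj n g x"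
  using dyproj_diff[of "\<lambda>x. f x + g x" g n x] assms by (simp add: set_integral_add)

text \<open>In contrast to additivity, this extends to functions not integrable on the cells, whose
  means are 0 by convention.\<close>

lemma dyproj_scale: "dyproj n (\<lambda>x. c * f x) x = c * dyproj n f x"
  unfolding dyproj_def dyavg_def mean_def by (simp add: sum_distrib_left if_distrib[of "\<lambda>z. c * z"] cong: if_cong)

lemma dyproj_bound:
  assumes A: "Ap_pair p u v K" and f: "f \<in> Lp p u"
  shows "Lp_int p u (dyproj n f) \<le> ennreal K * Lp_int p u f"
proof -
  have p: "p > 1" and u: "loc_fin u" using A by (auto simp: Ap_pair_def)
  have le: "(\<integral>\<^sup>+x\<in>hc (- (2^n) *\<^sub>R One) (2 * 2^n). ennreal (norm (f x) powr p * u x) \<partial>lebesgue) \<le> Lp_int p u f"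
    unfolding Lp_int_def by (intro nn_integral_mono) (auto simp: indicator_def)
  have "Lp_int p u (dyproj n f) \<le> ennreal K * (\<integral>\<^sup>+x\<in>hc (- (2^n) *\<^sub>R One) (2 * 2^n). ennreal (norm (f x) powr p * u x) \<partial>lebesgue)"
    using p le LpD[OF f] loc_finD(1)[OF u] unfolding Lp_int_def dyproj_def
    by (intro dyavg_bound[OF cell_bound_Ap_pair[OF A]]) (auto intro: le_less_trans)
  also have "\<dots> \<le> ennreal K * Lp_int p u f" using le by (rule mult_left_mono) auto
  finally show ?thesis .
qed

lemma diff_dyproj_bound:
  assumes A: "Ap_pair p u v K" and f: "f \<in> Lp p u"
  shows "Lp_int p u (\<lambda>x. f x - dyproj n f x) \<le> ennreal (2 powr p * (1 + K)) * Lp_int p u f"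
proof -
  have p: "p > 1" and u: "loc_fin u" and K: "K > 0" using A by (auto simp: Ap_pair_def)
  have "Lp_int p u (\<lambda>x. f x - dyproj n f x) \<le> ennreal (2 powr p) * (Lp_int p u f + Lp_int p u (dyproj n f))"
    using p LpD(1)[OF f] by (intro Lp_int_diff_le[OF u]) auto
  also have "\<dots> \<le> ennreal (2 powr p) * (Lp_int p u f + ennreal K * Lp_int p u f)"
    by (intro mult_left_mono add_left_mono dyproj_bound[OF A f]) auto
  also have "\<dots> = ennreal (2 powr p * (1 + K)) * Lp_int p u f"
    using K by (simp add: ennreal_mult ennreal_plus distrib_right mult.assoc del: ennreal_plus) (simp add: ennreal_plus distrib_right)
  finally show ?thesis .
qed

text \<open>On the growing cube the error is that of dyadic averages with vanishing mesh; outside,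
  the projection is 0 and the error is the tail of \<open>f\<close>, which vanishes by dominated
  convergence.\<close>

lemma dyproj_tendsto:
  assumes A: "Ap_pair p u v K" and f: "f \<in> Lp p u"
  shows "(\<lambda>n. Lp_int p u (\<lambda>x. f x - dyproj n f x)) \<longlonglongrightarrow> 0"
proof -
  have p: "p > 1" and u: "loc_fin u" and K: "K > 0" using A by (auto simp: Ap_pair_def)
  have [measurable]: "u \<in> borel_measurable lebesgue" "f \<in> borel_measurable lebesgue" and u0: "AE x in lebesgue. 0 \<le> u x"
    using loc_finD[OF u] LpD[OF f] by auto
  have fin: "modular lebesgue p u f < \<infinity>" using LpD(2)[OF f] by (simp add: Lp_int_def)
  have "(\<lambda>n. 2 / 2^n :: real) \<longlonglongrightarrow> 0" by (rule LIMSEQ_divide_realpow_zero) simp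
  moreover have "2 * 2^n / 2^(2*n) = (2 / 2^n :: real)" for n
  proof -
    have e: "(2::real)^(2*n) = 2^n * 2^n" by (simp only: mult_2 power_add)
    show ?thesis unfolding e by (simp add: field_simps)
  qed
  ultimately have "(\<lambda>n. 2 * 2^n / 2^(2*n) :: real) \<longlonglongrightarrow> 0" by simp
  then have 1: "(\<lambda>n. \<integral>\<^sup>+x\<in>big_cube n. ennreal (norm (dyproj n f x - f x) powr p * u x) \<partial>lebesgue) \<longlonglongrightarrow> 0"
    unfolding dyproj_def big_cube_def using p K by (intro dyavg_tendsto[OF u _ cell_bound_Ap_pair[OF A] _ _ fin]) auto
  have "(\<lambda>n. \<integral>\<^sup>+x\<in>- big_cube n. ennreal (norm (f x) powr p * u x) \<partial>lebesgue) \<longlonglongrightarrow> (\<integral>\<^sup>+x. 0 \<partial>(lebesgue :: 'a measure))"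
  proof (rule nn_integral_dominated_convergence[where w = "\<lambda>x. ennreal (norm (f x) powr p * u x)"])
    show "AE x in lebesgue. (\<lambda>n. ennreal (norm (f x) powr p * u x) * indicator (- big_cube n) x) \<longlonglongrightarrow> 0"
    proof (intro AE_I2 tendsto_eventually)
      fix x :: 'a
      obtain n where n: "x \<in> big_cube n" using bounded_subset_big_cube[of "{x}"] by auto
      show "\<forall>\<^sub>F k in sequentially. ennreal (norm (f x) powr p * u x) * indicator (- big_cube k) x = 0"
        using eventually_ge_at_top[of n] by eventually_elim (use big_cube_mono n in \<open>auto simp: indicator_def\<close>)
    qed
  qed (use fin in \<open>auto simp: indicator_def\<close>)
  then have 2: "(\<lambda>n. \<integral>\<^sup>+x\<in>- big_cube n. ennreal (norm (f x) powr p * u x) \<partial>lebesgue) \<longlonglongrightarrow> 0" by simp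
  have eq: "Lp_int p u (\<lambda>x. f x - dyproj n f x) = mass (\<lambda>x. norm (dyproj n f x - f x) powr p * u x) (big_cube n)
      + (\<integral>\<^sup>+x\<in>- big_cube n. ennreal (norm (f x) powr p * u x) \<partial>lebesgue)" for n
  proof -
    have "Lp_int p u (\<lambda>x. f x - dyproj n f x) = (\<integral>\<^sup>+x. ennreal (norm (dyproj n f x - f x) powr p * u x) * indicator (big_cube n) x
        + ennreal (norm (f x) powr p * u x) * indicator (- big_cube n) x \<partial>lebesgue)"
      unfolding Lp_int_def by (intro nn_integral_cong) (auto simp: indicator_def dyproj_outside norm_minus_commute)
    then show ?thesis by (simp add: nn_integral_add)
  qed
  show ?thesis unfolding eq using tendsto_add[OF 1 2] by simp
qed

text \<open>Uniformly bounded operators that tend to 0 pointwise tend to 0 uniformly on relatively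
  compact sets, here the image of the unit ball. In sequential form: counterexamples for every n,
  normalised, have images converging along a subsequence to some \<open>g\<close>, and the error at
  \<open>g\<close> tends to 0.\<close>

lemma compact_op_diff_dyproj:
  assumes A: "Ap_pair q w z K" and T: "compact_op T q w w" and b: "bounded_op T q w w"
    and scale: "\<And>c f. f \<in> Lp q w \<Longrightarrow> T (\<lambda>x. c * f x) = (\<lambda>x. c * T f x)" and E: "E > 0"
  obtains n where "\<And>f. f \<in> Lp q w \<Longrightarrow> Lp_int q w (\<lambda>x. T f x - dyproj n (T f) x) \<le> ennreal E * Lp_int q w f"
proof (rule ccontr)
  assume "\<not> thesis"
  with that have "\<forall>n. \<exists>f. f \<in> Lp q w \<and> \<not> Lp_int q w (\<lambda>x. T f x - dyproj n (T f) x) \<le> ennreal E * Lp_int q w f" by blast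
  then obtain f where f: "\<And>n. f n \<in> Lp q w" and
    fE: "\<And>n. \<not> Lp_int q w (\<lambda>x. T (f n) x - dyproj n (T (f n)) x) \<le> ennreal E * Lp_int q w (f n)" by metis
  have q: "q > 1" and w: "loc_fin w" and K: "K > 0" using A by (auto simp: Ap_pair_def)
  obtain N where N: "N > 0" "\<And>f. f \<in> Lp q w \<Longrightarrow> T f \<in> Lp q w" "\<And>f. f \<in> Lp q w \<Longrightarrow> Lp_int q w (T f) \<le> ennreal N * Lp_int q w f"
    using bounded_op_Lp_int[OF b] q by auto
  define X where "X n = enn2real (Lp_int q w (f n))" for n
  have X: "Lp_int q w (f n) = ennreal (X n)" "X n \<ge> 0" for n using LpD(2)[OF f[of n]] by (auto simp: X_def less_top[symmetric])
  \<comment> \<open>A counterexample cannot have modular 0. Such a function need only vanish almost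
    everywhere, so boundedness of \<open>T\<close> is what shows that its image has modular 0
    too.\<close>
  have Xp: "X n > 0" for n
  proof (rule ccontr)
    assume "\<not> X n > 0"
    then have X0: "Lp_int q w (f n) = 0" using X[of n] by auto
    have "Lp_int q w (T (f n)) = 0" using N(3)[OF f[of n]] X0 by simp
    then have "Lp_int q w (\<lambda>x. T (f n) x - dyproj n (T (f n)) x) = 0"
      using diff_dyproj_bound[OF A N(2)[OF f[of n]], of n] by simp
    then show False using fE[of n] by simp
  qed
  \<comment> \<open>The factor that normalises the modular of \<open>f n\<close> to 1.\<close>
  define c where "c n = complex_of_real (X n powr (- 1 / q))" for n
  have cq: "norm (c n) powr q = 1 / X n" for n
  proof -
    have "norm (c n) = X n powr (- 1 / q)" by (simp only: c_def norm_of_real abs_of_nonneg powr_ge_zero)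
    then have "norm (c n) powr q = X n powr (- 1)" using q by (simp only: powr_powr) simp
    then show ?thesis using Xp[of n] by (simp only: powr_minus_divide) simp
  qed
  define F where "F n x = c n * f n x" for n x
  have FI: "Lp_int q w (F n) = 1" for n
    unfolding F_def using Lp_int_scale[OF w LpD(1)[OF f[of n]]] Xp[of n] by (simp add: cq X ennreal_mult'[symmetric])
  have "F n \<in> borel_measurable lebesgue" for n unfolding F_def using LpD(1)[OF f[of n]] by auto
  then have F: "F n \<in> Lp q w" for n using FI[of n] by (auto simp: Lp_def)
  have "Lp_norm q w (F n) \<le> 1" for n by (simp add: Lp_norm_def FI)
  then obtain r g where r: "strict_mono r" and g: "g \<in> Lp q w"
    and lim: "(\<lambda>n. Lp_norm q w (\<lambda>x. T (F (r n)) x - g x)) \<longlonglongrightarrow> 0"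
    using T F unfolding compact_op_def by blast
  have d: "(\<lambda>x. T (F n) x - g x) \<in> Lp q w" for n using q by (intro Lp_diff[OF w]) (auto intro: N F g)
  have TFE: "Lp_int q w (\<lambda>x. T (F n) x - dyproj n (T (F n)) x) \<ge> ennreal E" for n
  proof -
    have "T (F n) = (\<lambda>x. c n * T (f n) x)" unfolding F_def by (rule scale[OF f])
    then have "(\<lambda>x. T (F n) x - dyproj n (T (F n)) x) = (\<lambda>x. c n * (T (f n) x - dyproj n (T (f n)) x))"
      by (simp add: dyproj_scale algebra_simps)
    then have "Lp_int q w (\<lambda>x. T (F n) x - dyproj n (T (F n)) x) = ennreal (1 / X n) * Lp_int q w (\<lambda>x. T (f n) x - dyproj n (T (f n)) x)"
      using Lp_int_scale[OF w, of "\<lambda>x. T (f n) x - dyproj n (T (f n)) x" q "c n"] LpD(1)[OF N(2)[OF f[of n]]] by (simp add: cq)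
    also have "\<dots> \<ge> ennreal (1 / X n) * (ennreal E * ennreal (X n))"
      using fE[of n] by (intro mult_left_mono) (auto simp: X)
    also have "ennreal (1 / X n) * (ennreal E * ennreal (X n)) = ennreal E" using Xp[of n] E by (simp add: ennreal_mult[symmetric])
    finally show ?thesis .
  qed
  \<comment> \<open>Upper bound for the error at \<open>T (F (r n))\<close>, split into the distance
    to \<open>g\<close> and the error at \<open>g\<close>. It tends to 0 although it is always at
    least \<open>E\<close>.\<close>
  define R where "R n = ennreal (2 powr q) * (ennreal (2 powr q * (1 + K)) * Lp_int q w (\<lambda>x. T (F (r n)) x - g x) + Lp_int q w (\<lambda>x. g x - dyproj (r n) g x))" for n
  have le: "ennreal E \<le> R n" for n
  proof -
    have "(\<lambda>x. T (F (r n)) x - dyproj (r n) (T (F (r n))) x) = (\<lambda>x. ((\<lambda>x. T (F (r n)) x - g x) x - dyproj (r n) (\<lambda>x. T (F (r n)) x - g x) x) + (g x - dyproj (r n) g x))"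
      using dyproj_diff[of "T (F (r n))" g "r n"] Lp_set_integrable[OF A N(2)[OF F]] Lp_set_integrable[OF A g] by auto
    then have "Lp_int q w (\<lambda>x. T (F (r n)) x - dyproj (r n) (T (F (r n))) x)
       \<le> ennreal (2 powr q) * (Lp_int q w (\<lambda>x. (\<lambda>x. T (F (r n)) x - g x) x - dyproj (r n) (\<lambda>x. T (F (r n)) x - g x) x) + Lp_int q w (\<lambda>x. g x - dyproj (r n) g x))"
      using q LpD(1)[OF d] LpD(1)[OF g] by (simp only:) (intro Lp_int_add_le[OF w], auto)
    also have "\<dots> \<le> R n" unfolding R_def by (intro mult_left_mono add_right_mono diff_dyproj_bound[OF A d]) auto
    finally show ?thesis using TFE[of "r n"] by (rule order_trans[rotated])
  qed
  have "(\<lambda>n. Lp_int q w (\<lambda>x. T (F (r n)) x - g x)) \<longlonglongrightarrow> 0"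
    using d lim q by (intro Lp_norm_tendsto_0_imp_Lp_int) auto
  moreover have "(\<lambda>n. Lp_int q w (\<lambda>x. g x - dyproj (r n) g x)) \<longlonglongrightarrow> 0"
    using LIMSEQ_subseq_LIMSEQ[OF dyproj_tendsto[OF A g] r] by (simp add: o_def)
  ultimately have "R \<longlonglongrightarrow> ennreal (2 powr q) * (ennreal (2 powr q * (1 + K)) * 0 + 0)"
    unfolding R_def by (intro tendsto_add ennreal_tendsto_cmult) auto
  then have "R \<longlonglongrightarrow> 0" by simp
  from eventually_happens[OF ennreal_tendsto_0D[OF this E]] obtain n where "R n < ennreal E" by auto
  then show False using le[of n] by simp
qed

section \<open>Compactness\<close>

text \<open>The Riesz-Fischer argument for modulars: a rapidly Cauchy subsequence converges almost
  everywhere, and Fatou compares the whole sequence with its limit. Positivity of \<open>w\<close>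
  is what turns weighted bounds into pointwise ones.\<close>

lemma Lp_complete:
  fixes H :: "nat \<Rightarrow> 'a::euclidean_space \<Rightarrow> complex"
  assumes w: "loc_fin w" and wp: "AE x in lebesgue. 0 < w x" and p: "p > 0" and H: "\<And>k. H k \<in> Lp p w"
    and cauchy: "\<And>e::real. e > 0 \<Longrightarrow> \<exists>K. \<forall>k\<ge>K. \<forall>m\<ge>K. Lp_int p w (\<lambda>x. H k x - H m x) \<le> ennreal e"
  obtains g where "g \<in> Lp p w" "(\<lambda>k. Lp_int p w (\<lambda>x. H k x - g x)) \<longlonglongrightarrow> 0"
proof -
  have Hm[measurable]: "H k \<in> borel_measurable lebesgue" for k using LpD(1)[OF H] .
  have wm[measurable]: "w \<in> borel_measurable lebesgue" using loc_finD(1)[OF w] .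
  \<comment> \<open>The factor (2^j)^(-p) pays for multiplying the j-th difference by 2^j, and
    (1/2)^j makes the sum converge; so almost everywhere the differences are O(2^(-j)).\<close>
  define \<epsilon> where "\<epsilon> j = (1/2) ^ j * (2 ^ j) powr (- p)" for j :: nat
  have \<epsilon>: "\<epsilon> j > 0" for j by (simp add: \<epsilon>_def)
  obtain \<tau> where \<tau>: "\<And>j k m. k \<ge> \<tau> j \<Longrightarrow> m \<ge> \<tau> j \<Longrightarrow> Lp_int p w (\<lambda>x. H k x - H m x) \<le> ennreal (\<epsilon> j)"
    using cauchy[OF \<epsilon>] by metis
  \<comment> \<open>Partial sums give a monotone choice of indices that still dominates
    \<open>\<tau>\<close>.\<close>
  define t where "t j = (\<Sum>i\<le>j. \<tau> i)" for j
  have t\<tau>: "t j \<ge> \<tau> j" for j unfolding t_def by (rule member_le_sum) auto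
  have tm: "t j \<le> t (Suc j)" for j by (simp add: t_def)
  have dj: "Lp_int p w (\<lambda>x. H (t (Suc j)) x - H (t j) x) \<le> ennreal (\<epsilon> j)" for j
    using t\<tau>[of j] tm[of j] by (intro \<tau>) auto
  define D where "D j x = ennreal ((2 ^ j) powr p) * ennreal (norm (H (t (Suc j)) x - H (t j) x) powr p * w x)" for j x
  have [measurable]: "D j \<in> borel_measurable lebesgue" for j unfolding D_def by measurable
  have "(\<integral>\<^sup>+x. (\<Sum>j. D j x) \<partial>lebesgue) = (\<Sum>j. \<integral>\<^sup>+x. D j x \<partial>lebesgue)" by (rule nn_integral_suminf) measurable
  also have "\<dots> \<le> (\<Sum>j. ennreal ((1/2) ^ j))"
  proof (rule suminf_le)
    fix j
    have "(\<integral>\<^sup>+x. D j x \<partial>lebesgue) = ennreal ((2 ^ j) powr p) * Lp_int p w (\<lambda>x. H (t (Suc j)) x - H (t j) x)"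
      unfolding D_def Lp_int_def by (rule nn_integral_cmult) measurable
    also have "\<dots> \<le> ennreal ((2 ^ j) powr p) * ennreal (\<epsilon> j)" by (intro mult_left_mono dj) auto
    also have "\<dots> = ennreal ((1/2) ^ j)"
      by (simp add: ennreal_mult'[symmetric] \<epsilon>_def powr_minus)
    finally show "(\<integral>\<^sup>+x. D j x \<partial>lebesgue) \<le> ennreal ((1/2) ^ j)" .
  qed auto
  also have "\<dots> = ennreal (\<Sum>j. (1/2) ^ j)" by (rule suminf_ennreal2) (auto intro: summable_geometric)
  also have "\<dots> < \<infinity>" by simp
  finally have "AE x in lebesgue. (\<Sum>j. D j x) \<noteq> \<infinity>"
    by (intro nn_integral_noteq_infinite) auto
  then have conv: "AE x in lebesgue. convergent (\<lambda>j. H (t j) x)"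
    using wp
  proof eventually_elim
    case (elim x)
    define b where "b = enn2real (\<Sum>j. D j x)"
    have b: "(\<Sum>j. D j x) = ennreal b" "b \<ge> 0" using elim by (auto simp: b_def less_top[symmetric])
    have bound: "norm (H (t (Suc j)) x - H (t j) x) \<le> (b / w x) powr (1/p) * (1/2) ^ j" for j
    proof -
      let ?n = "norm (H (t (Suc j)) x - H (t j) x)"
      have "D j x \<le> ennreal b" unfolding b(1)[symmetric]
        using sum_le_suminf[of "\<lambda>j. D j x" "{j}"] by simp
      then have "ennreal ((2 ^ j) powr p * (?n powr p * w x)) \<le> ennreal b" by (simp add: D_def ennreal_mult')
      then have "(2 ^ j) powr p * (?n powr p * w x) \<le> b" using b(2) by simp
      then have "(2 ^ j * ?n) powr p \<le> b / w x" using elim by (simp add: powr_mult pos_le_divide_eq mult.assoc)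
      then have "((2 ^ j * ?n) powr p) powr (1/p) \<le> (b / w x) powr (1/p)" using p by (intro powr_mono2) auto
      then have "2 ^ j * ?n \<le> (b / w x) powr (1/p)" using p by (simp add: powr_powr)
      then show ?thesis by (simp add: field_simps power_divide)
    qed
    have "summable (\<lambda>j. H (t (Suc j)) x - H (t j) x)"
      by (rule summable_comparison_test'[of "\<lambda>j. (b / w x) powr (1/p) * (1/2) ^ j" 0])
        (use bound in \<open>auto intro!: summable_mult summable_geometric\<close>)
    then have "convergent (\<lambda>n. \<Sum>j<n. H (t (Suc j)) x - H (t j) x)" by (simp add: summable_iff_convergent)
    then have "convergent (\<lambda>n. H (t n) x - H (t 0) x)" unfolding sum_lessThan_telescope[of "\<lambda>j. H (t j) x"] .
    then have "convergent (\<lambda>n. (H (t n) x - H (t 0) x) + H (t 0) x)" by (intro convergent_add convergent_const)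
    then show ?case by simp
  qed
  define g where "g x = lim (\<lambda>j. H (t j) x)" for x
  have gm[measurable]: "g \<in> borel_measurable lebesgue" unfolding g_def by measurable
  have Hg: "Lp_int p w (\<lambda>x. H k x - g x) \<le> ennreal e"
    if e: "\<And>j. j \<ge> J \<Longrightarrow> Lp_int p w (\<lambda>x. H k x - H (t j) x) \<le> ennreal e" for k J e
  proof -
    have "Lp_int p w (\<lambda>x. H k x - g x) = (\<integral>\<^sup>+x. liminf (\<lambda>j. ennreal (norm (H k x - H (t j) x) powr p * w x)) \<partial>lebesgue)"
      unfolding Lp_int_def using conv
    proof (intro nn_integral_cong_AE, eventually_elim)
      case (elim x)
      then have "(\<lambda>j. H (t j) x) \<longlonglongrightarrow> g x" unfolding g_def by (simp add: convergent_LIMSEQ_iff)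
      then have "(\<lambda>j. norm (H k x - H (t j) x) powr p * w x) \<longlonglongrightarrow> norm (H k x - g x) powr p * w x"
        using p by (intro tendsto_intros tendsto_powr2) auto
      then have "(\<lambda>j. ennreal (norm (H k x - H (t j) x) powr p * w x)) \<longlonglongrightarrow> ennreal (norm (H k x - g x) powr p * w x)"
        by (rule tendsto_ennrealI)
      then show ?case by (intro lim_imp_Liminf[symmetric]) auto
    qed
    also have "\<dots> \<le> liminf (\<lambda>j. \<integral>\<^sup>+x. ennreal (norm (H k x - H (t j) x) powr p * w x) \<partial>lebesgue)"
      by (rule nn_integral_liminf) measurable
    also have "\<dots> \<le> limsup (\<lambda>j. \<integral>\<^sup>+x. ennreal (norm (H k x - H (t j) x) powr p * w x) \<partial>lebesgue)"
      by (rule Liminf_le_Limsup) auto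
    also have "\<dots> \<le> ennreal e"
      using e unfolding Lp_int_def by (intro Limsup_bounded) (auto simp: eventually_sequentially)
    finally show ?thesis .
  qed
  have small: "Lp_int p w (\<lambda>x. H k x - g x) \<le> ennreal (\<epsilon> i)" if "k \<ge> \<tau> i" for k i
  proof (rule Hg[of i])
    fix j assume "j \<ge> i"
    then have "t j \<ge> t i" unfolding t_def by (intro sum_mono2) auto
    then show "Lp_int p w (\<lambda>x. H k x - H (t j) x) \<le> ennreal (\<epsilon> i)" using that t\<tau>[of i] by (intro \<tau>) auto
  qed
  have \<epsilon>_le: "\<epsilon> i \<le> (1/2) ^ i" for i
  proof -
    have "(2 ^ i :: real) powr (- p) \<le> 1" using p by (subst powr_minus) (simp add: inverse_le_1_iff ge_one_powr_ge_zero)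
    then have "(1/2) ^ i * (2 ^ i) powr (- p) \<le> (1/2 :: real) ^ i * 1" by (intro mult_left_mono) auto
    then show ?thesis by (simp add: \<epsilon>_def)
  qed
  have lim: "(\<lambda>k. Lp_int p w (\<lambda>x. H k x - g x)) \<longlonglongrightarrow> 0"
  proof (rule ennreal_tendsto_0I)
    fix e :: real assume "e > 0"
    then obtain i where i: "(1/2) ^ i < e" using real_arch_pow_inv[of e "1/2"] by auto
    show "\<forall>\<^sub>F k in sequentially. Lp_int p w (\<lambda>x. H k x - g x) \<le> ennreal e"
      using eventually_ge_at_top[of "\<tau> i"]
    proof eventually_elim
      case (elim k)
      have "Lp_int p w (\<lambda>x. H k x - g x) \<le> ennreal (\<epsilon> i)" by (rule small[OF elim])
      also have "\<dots> \<le> ennreal e" using \<epsilon>_le[of i] i by (intro ennreal_leI) simp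
      finally show ?case .
    qed
  qed
  have "g \<in> Lp p w"
  proof -
    let ?k = "\<tau> 0"
    have "(\<lambda>x. H ?k x - g x) \<in> Lp p w"
      unfolding Lp_def using le_less_trans[OF small[of 0 ?k]] by auto
    then have "(\<lambda>x. H ?k x - (H ?k x - g x)) \<in> Lp p w" by (rule Lp_diff[OF w p H])
    moreover have "(\<lambda>x. H ?k x - (H ?k x - g x)) = g" by auto
    ultimately show ?thesis by (simp only:)
  qed
  then show ?thesis using lim by (rule that)
qed

text \<open>Bolzano-Weierstrass with a diagonal argument over an enumeration of \<open>I\<close>, in
  which repetitions do no harm.\<close>

lemma bounded_family_convergent_subseq:
  fixes X :: "'i \<Rightarrow> nat \<Rightarrow> 'b::heine_borel"
  assumes I: "countable I" and b: "\<And>i. i \<in> I \<Longrightarrow> bounded (range (X i))"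
  obtains r where "strict_mono r" "\<And>i. i \<in> I \<Longrightarrow> convergent (\<lambda>k. X i (r k))"
proof (cases "I = {}")
  case True
  then show ?thesis using that[of id] by (simp add: strict_mono_def)
next
  case False
  define e where "e n = from_nat_into I n" for n
  have e: "e n \<in> I" for n unfolding e_def using False by (rule from_nat_into)
  interpret subseqs "\<lambda>n s. convergent (\<lambda>k. X (e n) (s k))"
  proof
    fix n and s :: "nat \<Rightarrow> nat" assume "strict_mono s"
    have "bounded (range (X (e n) \<circ> s))" by (rule bounded_subset[OF b[OF e[of n]]]) auto
    from bounded_imp_convergent_subsequence[OF this]
    obtain l r where "strict_mono r" "((X (e n) \<circ> s) \<circ> r) \<longlonglongrightarrow> l" by blast
    then show "\<exists>r'. strict_mono r' \<and> convergent (\<lambda>k. X (e n) ((s \<circ> r') k))"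
      by (intro exI[of _ r]) (auto simp: convergent_def o_def)
  qed
  show ?thesis
  proof (rule that[OF subseq_diagseq])
    fix i assume "i \<in> I"
    then obtain n where n: "i = e n" using from_nat_into_surj[OF I] unfolding e_def by metis
    \<comment> \<open>Only from index \<open>Suc n\<close> on is the diagonal sequence a subsequence
      of the n-th one; the initial segment is discarded afterwards.\<close>
    have "convergent (\<lambda>k. X (e n) ((diagseq \<circ> ((+) (Suc n))) k))"
    proof (rule diagseq_holds)
      fix r s :: "nat \<Rightarrow> nat" and n assume "strict_mono r" "convergent (\<lambda>k. X (e n) (s k))"
      then show "convergent (\<lambda>k. X (e n) ((s \<circ> r) k))" using convergent_subseq_convergent[of "\<lambda>k. X (e n) (s k)" r] by (simp add: o_def)
    qed
    then have "convergent (\<lambda>k. X (e n) (diagseq (k + Suc n)))" by (simp add: o_def add.commute)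
    then show "convergent (\<lambda>k. X i (diagseq k))"
      unfolding n by (subst (asm) convergent_ignore_initial_segment)
  qed
qed

text \<open>The finite rank of the projections enters here. The means of \<open>h k\<close> over any
  one cell are bounded numbers, and the cells of all generations are countably many, so one
  subsequence makes all means converge. Every projection of it is then Cauchy, and uniform
  approximation makes the subsequence itself Cauchy.\<close>

lemma precompact_of_dyproj:
  fixes h :: "nat \<Rightarrow> 'a::euclidean_space \<Rightarrow> complex"
  assumes A: "Ap_pair p u v K" and h: "\<And>k. h k \<in> Lp p u" and N: "\<And>k. Lp_int p u (h k) \<le> ennreal N" "N \<ge> 0"
    and unif: "\<And>e::real. e > 0 \<Longrightarrow> \<exists>n. \<forall>k. Lp_int p u (\<lambda>x. h k x - dyproj n (h k) x) \<le> ennreal e"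
  obtains r g where "strict_mono r" "g \<in> Lp p u" "(\<lambda>k. Lp_int p u (\<lambda>x. h (r k) x - g x)) \<longlonglongrightarrow> 0"
proof -
  have p: "p > 1" and u: "loc_fin u" and K: "K > 0" and uv: "AE x in lebesgue. 1 \<le> u x * v x powr (p - 1)"
    using A by (auto simp: Ap_pair_def)
  have um[measurable]: "u \<in> borel_measurable lebesgue" using loc_finD(1)[OF u] .
  have up: "AE x in lebesgue. 0 < u x"
    using uv loc_finD(2)[OF u]
  proof eventually_elim
    case (elim x)
    then have "u x \<noteq> 0" by auto
    then show ?case using elim by simp
  qed
  have hm[measurable]: "h k \<in> borel_measurable lebesgue" for k using LpD(1)[OF h] .
  define cell where "cell n c = hc c (2 * 2^n / 2^(2*n))" for n :: nat and c :: 'a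
  define G where "G n = grid (2*n) (- (2^n) *\<^sub>R (One :: 'a)) (2 * 2^n)" for n
  define I where "I = Sigma UNIV G"
  have "countable I" unfolding I_def G_def by (intro countable_SIGMA) (auto intro: countable_finite)
  moreover have "bounded (range (\<lambda>k. mean (cell n c) (h k)))" for n c
  proof -
    let ?R = "cell n c"
    have r: "2 * 2^n / 2^(2*n) > (0::real)" by simp
    have U: "wt u ?R > 0" unfolding cell_def by (rule Ap_pair_wt_pos[OF A r])
    have "norm (mean ?R (h k)) \<le> (K * N / wt u ?R) powr (1/p)" for k
    proof -
      have le: "mass (\<lambda>x. norm (h k x) powr p * u x) ?R \<le> Lp_int p u (h k)"
        unfolding Lp_int_def by (intro nn_integral_mono) (auto simp: indicator_def)
      have "ennreal (norm (mean ?R (h k)) powr p) * mass u ?R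
         \<le> ennreal K * mass (\<lambda>x. norm (h k x) powr p * u x) ?R"
        unfolding cell_def by (rule cell_boundD(2)[OF cell_bound_Ap_pair[OF A] r hm]) (use le LpD(2)[OF h[of k]] in \<open>auto simp: cell_def intro: le_less_trans\<close>)
      also have "\<dots> \<le> ennreal K * ennreal N" using le N(1)[of k] by (intro mult_left_mono) (auto intro: order_trans)
      also have "mass u ?R = ennreal (wt u ?R)"
        unfolding cell_def by (rule nn_integral_eq_wt[OF u]) auto
      finally have "norm (mean ?R (h k)) powr p * wt u ?R \<le> K * N"
        using K N(2) by (simp add: ennreal_mult[symmetric])
      then have "norm (mean ?R (h k)) powr p \<le> K * N / wt u ?R" using U by (simp add: pos_le_divide_eq)
      then have "(norm (mean ?R (h k)) powr p) powr (1/p) \<le> (K * N / wt u ?R) powr (1/p)" using p by (intro powr_mono2) auto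
      then show ?thesis using p by (simp add: powr_powr)
    qed
    then show ?thesis by (auto simp: bounded_iff)
  qed
  ultimately obtain r where r: "strict_mono r" and conv: "\<And>i. i \<in> I \<Longrightarrow> convergent (\<lambda>k. mean (cell (fst i) (snd i)) (h (r k)))"
    using bounded_family_convergent_subseq[of I "\<lambda>i k. mean (cell (fst i) (snd i)) (h k)"] by auto
  have int: "set_integrable lebesgue (hc c s) (h k)" if "0 < s" for c s k by (rule Lp_set_integrable[OF A h that])
  have dyproj_cauchy: "\<exists>L. \<forall>k\<ge>L. \<forall>m\<ge>L. Lp_int p u (dyproj n (\<lambda>x. h (r k) x - h (r m) x)) \<le> ennreal e" if e: "e > 0" for n and e :: real
  proof -
    define U where "U = (\<Sum>c\<in>G n. wt u (cell n c))"
    have U: "U \<ge> 0" unfolding U_def by (intro sum_nonneg) auto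
    \<comment> \<open>Means that differ by less than \<open>d\<close> on cells of total weight
      \<open>U\<close> give projections with modular distance at most d^p U \<le> e.\<close>
    define d where "d = (e / (U + 1)) powr (1/p)"
    have d: "d > 0" using e U by (simp add: d_def)
    have dp: "d powr p = e / (U + 1)" using e U p by (simp add: d_def powr_powr)
    have "\<exists>L. \<forall>k\<ge>L. \<forall>m\<ge>L. norm (mean (cell n c) (h (r k)) - mean (cell n c) (h (r m))) < d" if "c \<in> G n" for c
      using convergent_Cauchy[OF conv[of "(n, c)"]] that d unfolding I_def Cauchy_iff by auto
    then obtain L where L: "\<And>c k m. c \<in> G n \<Longrightarrow> k \<ge> L c \<Longrightarrow> m \<ge> L c \<Longrightarrow> norm (mean (cell n c) (h (r k)) - mean (cell n c) (h (r m))) < d"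
      by metis
    have "finite (G n)" by (simp add: G_def)
    have "Lp_int p u (dyproj n (\<lambda>x. h (r k) x - h (r m) x)) \<le> ennreal e" if km: "k \<ge> Max (insert 0 (L ` G n))" "m \<ge> Max (insert 0 (L ` G n))" for k m
    proof -
      have "Lp_int p u (dyproj n (\<lambda>x. h (r k) x - h (r m) x))
        = (\<Sum>c\<in>G n. ennreal (norm (mean (cell n c) (\<lambda>x. h (r k) x - h (r m) x)) powr p) * mass u (cell n c))"
        unfolding Lp_int_def dyproj_def G_def cell_def using p by (intro nn_integral_dyavg_powr) auto
      also have "\<dots> \<le> (\<Sum>c\<in>G n. ennreal (d powr p * wt u (cell n c)))"
      proof (intro sum_mono)
        fix c assume c: "c \<in> G n"
        have Lc: "L c \<le> Max (insert 0 (L ` G n))" using \<open>finite (G n)\<close> c by (intro Max_ge) auto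
        have "mean (cell n c) (\<lambda>x. h (r k) x - h (r m) x) = mean (cell n c) (h (r k)) - mean (cell n c) (h (r m))"
          unfolding cell_def by (intro mean_diff int) auto
        then have "norm (mean (cell n c) (\<lambda>x. h (r k) x - h (r m) x)) < d" using L[OF c, of k m] Lc km by simp
        then have "norm (mean (cell n c) (\<lambda>x. h (r k) x - h (r m) x)) powr p \<le> d powr p" using p by (intro powr_mono2) auto
        moreover have "mass u (cell n c) = ennreal (wt u (cell n c))"
          unfolding cell_def by (rule nn_integral_eq_wt[OF u]) auto
        ultimately show "ennreal (norm (mean (cell n c) (\<lambda>x. h (r k) x - h (r m) x)) powr p) * mass u (cell n c)
           \<le> ennreal (d powr p * wt u (cell n c))"
          by (simp add: ennreal_mult[symmetric] ennreal_leI mult_right_mono)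
      qed
      also have "\<dots> = ennreal (d powr p * U)" unfolding U_def sum_distrib_left by (intro sum_ennreal) auto
      also have "d powr p * U \<le> e"
      proof -
        have "d powr p * U = e * (U / (U + 1))" unfolding dp by simp
        also have "\<dots> \<le> e * 1" using e U by (intro mult_left_mono) auto
        finally show ?thesis by simp
      qed
      finally show ?thesis by (simp add: ennreal_leI order_trans)
    qed
    then show ?thesis by blast
  qed
  have cauchy: "\<exists>L. \<forall>k\<ge>L. \<forall>m\<ge>L. Lp_int p u (\<lambda>x. h (r k) x - h (r m) x) \<le> ennreal e" if e: "e > 0" for e :: real
  proof -
    define t where "t = 2 powr p"
    have t: "t > 0" by (simp add: t_def)
    \<comment> \<open>Three errors of size \<open>d\<close> under two nested quasi-triangle
      inequalities amount to t (d + t (d + d)) = e.\<close>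
    define d where "d = e / (t + 2 * t * t)"
    have T: "t + 2 * t * t > 0" using t by (simp add: add_pos_pos)
    have d: "d > 0" using e T by (simp add: d_def)
    obtain n where n: "\<And>k. Lp_int p u (\<lambda>x. h k x - dyproj n (h k) x) \<le> ennreal d" using unif[OF d] by blast
    obtain L where L: "\<And>k m. k \<ge> L \<Longrightarrow> m \<ge> L \<Longrightarrow> Lp_int p u (dyproj n (\<lambda>x. h (r k) x - h (r m) x)) \<le> ennreal d" using dyproj_cauchy[OF d] by blast
    have "Lp_int p u (\<lambda>x. h (r k) x - h (r m) x) \<le> ennreal e" if km: "k \<ge> L" "m \<ge> L" for k m
    proof -
      let ?k = "r k" and ?m = "r m"
      have "(\<lambda>x. h ?k x - h ?m x) = (\<lambda>x. (h ?k x - dyproj n (h ?k) x) + (dyproj n (\<lambda>x. h ?k x - h ?m x) x + (dyproj n (h ?m) x - h ?m x)))"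
        using dyproj_diff[of "h ?k" "h ?m" n] int by auto
      then have "Lp_int p u (\<lambda>x. h ?k x - h ?m x) = Lp_int p u (\<lambda>x. (h ?k x - dyproj n (h ?k) x) + (dyproj n (\<lambda>x. h ?k x - h ?m x) x + (dyproj n (h ?m) x - h ?m x)))"
        by (rule arg_cong)
      also have "\<dots> \<le> ennreal t * (Lp_int p u (\<lambda>x. h ?k x - dyproj n (h ?k) x) + Lp_int p u (\<lambda>x. dyproj n (\<lambda>x. h ?k x - h ?m x) x + (dyproj n (h ?m) x - h ?m x)))"
        unfolding t_def using p by (intro Lp_int_add_le[OF u]) auto
      also have "\<dots> \<le> ennreal t * (Lp_int p u (\<lambda>x. h ?k x - dyproj n (h ?k) x) + ennreal t * (Lp_int p u (dyproj n (\<lambda>x. h ?k x - h ?m x)) + Lp_int p u (\<lambda>x. dyproj n (h ?m) x - h ?m x)))"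
        unfolding t_def using p by (intro mult_left_mono add_left_mono Lp_int_add_le[OF u]) auto
      also have "\<dots> \<le> ennreal t * (ennreal d + ennreal t * (ennreal d + ennreal d))"
        using n[of ?k] n[of ?m] L[OF km] by (intro mult_left_mono add_mono) (auto simp: Lp_int_minus[of p u "dyproj n (h ?m)"])
      also have "\<dots> = ennreal (t * (d + t * (d + d)))"
        using t d by (simp add: ennreal_mult[symmetric] ennreal_plus[symmetric] del: ennreal_plus)
      also have "t * (d + t * (d + d)) = (t + 2 * t * t) * d" by (simp add: algebra_simps)
      also have "\<dots> = e" using T by (simp add: d_def)
      finally show ?thesis .
    qed
    then show ?thesis by blast
  qed
  obtain g where "g \<in> Lp p u" "(\<lambda>k. Lp_int p u (\<lambda>x. h (r k) x - g x)) \<longlonglongrightarrow> 0"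
    using Lp_complete[OF u up, of p "\<lambda>k. h (r k)"] p h cauchy by auto
  with r show ?thesis by (rule that)
qed

theorem theorem1p1:
  fixes T :: "('a::euclidean_space \<Rightarrow> complex) \<Rightarrow> ('a \<Rightarrow> complex)"
    and V :: "('a \<Rightarrow> complex) set"
    and q :: real and w :: "'a \<Rightarrow> real"
  assumes V_add: "\<And>f g. f \<in> V \<Longrightarrow> g \<in> V \<Longrightarrow> (\<lambda>x. f x + g x) \<in> V"
    and V_scale: "\<And>c f. f \<in> V \<Longrightarrow> (\<lambda>x. c * f x) \<in> V"
    and V_contains: "\<And>p s. 1 < p \<Longrightarrow> Ap p s \<Longrightarrow> Lp p s \<subseteq> V"
    and T_add: "\<And>f g. f \<in> V \<Longrightarrow> g \<in> V \<Longrightarrow> T (\<lambda>x. f x + g x) = (\<lambda>x. T f x + T g x)"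
    and T_scale: "\<And>c f. f \<in> V \<Longrightarrow> T (\<lambda>x. c * f x) = (\<lambda>x. c * T f x)"
    and T_bdd: "\<And>p s l. 1 < p \<Longrightarrow> Ap p s \<Longrightarrow> Ap p l \<Longrightarrow> bounded_op T p s l"
    and q: "1 < q" and w: "Ap q w"
    and T_cpt: "compact_op T q w w"
  shows "\<forall>p s l. 1 < p \<longrightarrow> Ap p s \<longrightarrow> Ap p l \<longrightarrow> compact_op T p s l"
proof (intro allI impI)
  fix p :: real and s l :: "'a \<Rightarrow> real"
  assume p: "1 < p" and s: "Ap p s" and l: "Ap p l"
  obtain e1 where e1: "e1 > 0" "\<And>\<alpha>. 0 < \<alpha> \<Longrightarrow> \<alpha> < e1 \<Longrightarrow> \<alpha> < 1 \<and> 1 < (p - \<alpha> * q) / (1 - \<alpha>) \<and>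
     Ap ((p - \<alpha> * q) / (1 - \<alpha>)) (\<lambda>x. s x powr (1 / (1 - \<alpha>)) * w x powr (- \<alpha> / (1 - \<alpha>)))"
    using Ap_extrapolate[OF p q s w] by blast
  obtain e2 where e2: "e2 > 0" "\<And>\<alpha>. 0 < \<alpha> \<Longrightarrow> \<alpha> < e2 \<Longrightarrow> \<alpha> < 1 \<and> 1 < (p - \<alpha> * q) / (1 - \<alpha>) \<and>
     Ap ((p - \<alpha> * q) / (1 - \<alpha>)) (\<lambda>x. l x powr (1 / (1 - \<alpha>)) * w x powr (- \<alpha> / (1 - \<alpha>)))"
    using Ap_extrapolate[OF p q l w] by blast
  \<comment> \<open>The same parameter has to serve both weights, since the near endpoint L^q(w) and
    the exponent \<open>p1\<close> are shared by source and target.\<close>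
  define a where "a = min e1 e2 / 2"
  define b where "b = 1 - a"
  define p1 where "p1 = (p - a * q) / b"
  define s1 where "s1 x = s x powr (1 / b) * w x powr (- a / b)" for x
  define l1 where "l1 x = l x powr (1 / b) * w x powr (- a / b)" for x
  have a: "0 < a" "a < e1" "a < e2" using e1 e2 by (auto simp: a_def)
  have b: "0 < b" "a + b = 1" using e1(2)[OF a(1,2)] by (auto simp: b_def)
  have p1: "1 < p1" and s1: "Ap p1 s1" and l1: "Ap p1 l1"
    using e1(2)[OF a(1,2)] e2(2)[OF a(1,3)] unfolding p1_def s1_def l1_def b_def by auto
  have pe: "p = a * q + b * p1" using b by (simp add: p1_def)
  obtain Kw where Aw: "Ap_pair q w (\<lambda>x. w x powr (- 1 / (q - 1))) Kw" using Ap_imp_Ap_pair[OF q w] .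
  obtain Kl where Al: "Ap_pair p l (\<lambda>x. l x powr (- 1 / (p - 1))) Kl" using Ap_imp_Ap_pair[OF p l] .
  obtain Kl1 where Al1: "Ap_pair p1 l1 (\<lambda>x. l1 x powr (- 1 / (p1 - 1))) Kl1" using Ap_imp_Ap_pair[OF p1 l1] .
  obtain Ks where As: "Ap_pair p s (\<lambda>x. s x powr (- 1 / (p - 1))) Ks" using Ap_imp_Ap_pair[OF p s] .
  obtain Ks1 where As1: "Ap_pair p1 s1 (\<lambda>x. s1 x powr (- 1 / (p1 - 1))) Ks1" using Ap_imp_Ap_pair[OF p1 s1] .
  have lw: "loc_fin w" and ll: "loc_fin l" and ll1: "loc_fin l1" and ls: "loc_fin s" and ls1: "loc_fin s1" and Kl1: "Kl1 > 0"
    using Aw Al Al1 As As1 by (auto simp: Ap_pair_def)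
  have wp: "AE x in lebesgue. w x > 0" and sp: "AE x in lebesgue. s x > 0" and lp: "AE x in lebesgue. l x > 0"
    using w s l by (auto simp: Ap_def weight_def)
  \<comment> \<open>Inverts the definition of the perturbed weights: each given weight is the
    geometric mean of \<open>w\<close> and its perturbation.\<close>
  have recover: "AE x in lebesgue. f x = w x powr a * (f x powr (1 / b) * w x powr (- a / b)) powr b"
    if "AE x in lebesgue. f x > 0" for f :: "'a \<Rightarrow> real"
    using that wp
  proof eventually_elim
    case (elim x)
    have "(f x powr (1 / b) * w x powr (- a / b)) powr b = f x * w x powr (- a)"
      using elim b by (simp add: powr_mult powr_powr)
    moreover have "w x powr a * w x powr (- a) = 1" using elim by (simp add: powr_minus)
    ultimately show ?case by simp
  qed
  obtain N1 where N1: "N1 > 0" "\<And>f. f \<in> Lp p1 s1 \<Longrightarrow> T f \<in> Lp p1 l1"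
    "\<And>f. f \<in> Lp p1 s1 \<Longrightarrow> Lp_int p1 l1 (T f) \<le> ennreal N1 * Lp_int p1 s1 f"
    using bounded_op_Lp_int[OF T_bdd[OF p1 s1 l1]] p1 by auto
  obtain Np where Np: "Np > 0" "\<And>f. f \<in> Lp p s \<Longrightarrow> T f \<in> Lp p l"
    "\<And>f. f \<in> Lp p s \<Longrightarrow> Lp_int p l (T f) \<le> ennreal Np * Lp_int p s f"
    using bounded_op_Lp_int[OF T_bdd[OF p s l]] p by auto
  have Tw: "T f \<in> Lp q w" if "f \<in> Lp q w" for f using T_cpt that by (auto simp: compact_op_def)
  \<comment> \<open>Bound for T - P_n T at the far endpoint: that of \<open>T\<close> times that of
    I - P_n on the target. It is independent of n, hence may be fixed before
    \<open>E\<close>.\<close>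
  define N where "N = 2 powr p1 * (1 + Kl1) * N1"
  have N: "N > 0" using Kl1 N1(1) by (simp add: N_def)
  define c where "c = 2 powr max q p1 * N powr b"
  have c: "c > 0" using N by (simp add: c_def)
  have unif: "\<exists>n. \<forall>f\<in>Lp p s. Lp_int p l (\<lambda>x. T f x - dyproj n (T f) x) \<le> ennreal e * Lp_int p s f" if e: "e > 0" for e :: real
  proof -
    \<comment> \<open>Chosen so that the interpolated constant
      \<open>2 powr max q p1 * (E powr a * N powr b)\<close> equals \<open>e\<close>.\<close>
    define E where "E = (e / c) powr (1 / a)"
    have E: "E > 0" using e c by (simp add: E_def)
    have Ea: "E powr a = e / c" using e c a by (simp add: E_def powr_powr)
    have scale: "T (\<lambda>x. c * f x) = (\<lambda>x. c * T f x)" if "f \<in> Lp q w" for c f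
      using T_scale V_contains[OF q w] that by blast
    obtain n where n: "\<And>f. f \<in> Lp q w \<Longrightarrow> Lp_int q w (\<lambda>x. T f x - dyproj n (T f) x) \<le> ennreal E * Lp_int q w f"
      using compact_op_diff_dyproj[OF Aw T_cpt T_bdd[OF q w w] scale E] by blast
    have "Lp_int p l (\<lambda>x. T f x - dyproj n (T f) x) \<le> ennreal e * Lp_int p s f" if f: "f \<in> Lp p s" for f
    proof -
      have "modular lebesgue p l (\<lambda>x. T f x - dyproj n (T f) x)
        \<le> ennreal (2 powr max q p1 * (E powr a * N powr b)) * modular lebesgue p s f"
      proof (rule interpolate_operator[where S = "\<lambda>f x. T f x - dyproj n (T f) x" and w = w and ?s1.0 = s1 and ?l1.0 = l1])
        show "sigma_finite_measure (lebesgue :: 'a measure)" by (rule sigma_finite_lebesgue)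
        show "w \<in> borel_measurable lebesgue" "s1 \<in> borel_measurable lebesgue" "l1 \<in> borel_measurable lebesgue"
          "s \<in> borel_measurable lebesgue" "l \<in> borel_measurable lebesgue"
          "AE x in lebesgue. 0 \<le> w x" "AE x in lebesgue. 0 \<le> s1 x" "AE x in lebesgue. 0 \<le> l1 x"
          using loc_finD[OF lw] loc_finD[OF ls] loc_finD[OF ll] loc_finD[OF ls1] loc_finD[OF ll1] by auto
        show "AE x in lebesgue. s x = w x powr a * s1 x powr b" unfolding s1_def by (rule recover[OF sp])
        show "AE x in lebesgue. l x = w x powr a * l1 x powr b" unfolding l1_def by (rule recover[OF lp])
        show "0 < a" "0 < b" "a + b = 1" "0 < q" "0 < p1" "p = a * q + b * p1" "E > 0" "N > 0"
          using a b q p1 pe E N by auto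
        show "f \<in> borel_measurable lebesgue" "modular lebesgue p s f < \<infinity>"
          using LpD[OF f] by (auto simp: Lp_int_def)
        show "(\<lambda>x. T f x - dyproj n (T f) x) \<in> borel_measurable lebesgue" using LpD(1)[OF Np(2)[OF f]] by auto
      next
        fix g :: "'a \<Rightarrow> complex"
        assume "g \<in> borel_measurable lebesgue" "modular lebesgue q w g < \<infinity>"
        then have g: "g \<in> Lp q w" by (simp add: Lp_def Lp_int_def)
        show "(\<lambda>x. T g x - dyproj n (T g) x) \<in> borel_measurable lebesgue \<and>
          (modular lebesgue q w (\<lambda>x. T g x - dyproj n (T g) x)) \<le> ennreal E * modular lebesgue q w g"
          using n[OF g] LpD(1)[OF Tw[OF g]] unfolding Lp_int_def by auto
      next
        fix g :: "'a \<Rightarrow> complex"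
        assume "g \<in> borel_measurable lebesgue" "modular lebesgue p1 s1 g < \<infinity>"
        then have g: "g \<in> Lp p1 s1" by (simp add: Lp_def Lp_int_def)
        have "Lp_int p1 l1 (\<lambda>x. T g x - dyproj n (T g) x) \<le> ennreal (2 powr p1 * (1 + Kl1)) * Lp_int p1 l1 (T g)"
          by (rule diff_dyproj_bound[OF Al1 N1(2)[OF g]])
        also have "\<dots> \<le> ennreal (2 powr p1 * (1 + Kl1)) * (ennreal N1 * Lp_int p1 s1 g)"
          by (intro mult_left_mono N1(3)[OF g]) auto
        also have "\<dots> = ennreal N * Lp_int p1 s1 g"
          unfolding N_def using Kl1 N1(1) by (simp add: ennreal_mult mult.assoc)
        finally show "(\<lambda>x. T g x - dyproj n (T g) x) \<in> borel_measurable lebesgue \<and>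
          (modular lebesgue p1 l1 (\<lambda>x. T g x - dyproj n (T g) x)) \<le> ennreal N * modular lebesgue p1 s1 g"
          using LpD(1)[OF N1(2)[OF g]] unfolding Lp_int_def by auto
      next
        fix g h :: "'a \<Rightarrow> complex"
        assume "g \<in> borel_measurable lebesgue" "h \<in> borel_measurable lebesgue"
          "modular lebesgue q w g < \<infinity>" "modular lebesgue p1 s1 h < \<infinity>"
        then have g: "g \<in> Lp q w" and h: "h \<in> Lp p1 s1" by (auto simp: Lp_def Lp_int_def)
        \<comment> \<open>The two summands lie in different weighted spaces; additivity is available
          because both are contained in the common domain \<open>V\<close>.\<close>
        have Tgh: "T (\<lambda>x. g x + h x) = (\<lambda>x. T g x + T h x)"
          using T_add V_contains[OF q w] V_contains[OF p1 s1] g h by blast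
        have "dyproj n (\<lambda>x. T g x + T h x) y = dyproj n (T g) y + dyproj n (T h) y" for y
          by (rule dyproj_add) (use Lp_set_integrable[OF Aw Tw[OF g]] Lp_set_integrable[OF Al1 N1(2)[OF h]] in auto)
        then show "(\<lambda>x. T (\<lambda>x. g x + h x) x - dyproj n (T (\<lambda>x. g x + h x)) x) = (\<lambda>x. T g x - dyproj n (T g) x + (T h x - dyproj n (T h) x))"
          unfolding Tgh by auto
      qed
      also have "2 powr max q p1 * (E powr a * N powr b) = e" unfolding Ea using N by (simp add: c_def)
      finally show ?thesis unfolding Lp_int_def .
    qed
    then show ?thesis by blast
  qed
  show "compact_op T p s l"
    unfolding compact_op_def
  proof (intro conjI ballI allI impI)
    show "T f \<in> Lp p l" if "f \<in> Lp p s" for f by (rule Np(2)[OF that])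
    fix F :: "nat \<Rightarrow> 'a \<Rightarrow> complex"
    assume "\<forall>n. F n \<in> Lp p s \<and> Lp_norm p s (F n) \<le> 1"
    then have F: "\<And>n. F n \<in> Lp p s" and F1: "\<And>n. Lp_norm p s (F n) \<le> 1" by auto
    have FI: "Lp_int p s (F n) \<le> 1" for n
      using Lp_norm_le_imp_Lp_int_le[OF F _ F1] p by simp
    obtain r g where r: "strict_mono r" "g \<in> Lp p l" and lim: "(\<lambda>k. Lp_int p l (\<lambda>x. T (F (r k)) x - g x)) \<longlonglongrightarrow> 0"
    proof (rule precompact_of_dyproj[OF Al Np(2)[OF F]])
      show "Lp_int p l (T (F k)) \<le> ennreal Np" for k
      proof -
        have "Lp_int p l (T (F k)) \<le> ennreal Np * Lp_int p s (F k)" by (rule Np(3)[OF F])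
        also have "\<dots> \<le> ennreal Np * 1" by (intro mult_left_mono FI) auto
        finally show ?thesis by simp
      qed
      show "0 \<le> Np" using Np(1) by simp
      fix e :: real assume "e > 0"
      then obtain n where n: "\<And>f. f \<in> Lp p s \<Longrightarrow> Lp_int p l (\<lambda>x. T f x - dyproj n (T f) x) \<le> ennreal e * Lp_int p s f" using unif by blast
      have "Lp_int p l (\<lambda>x. T (F k) x - dyproj n (T (F k)) x) \<le> ennreal e" for k
      proof -
        have "Lp_int p l (\<lambda>x. T (F k) x - dyproj n (T (F k)) x) \<le> ennreal e * Lp_int p s (F k)" by (rule n[OF F])
        also have "\<dots> \<le> ennreal e * 1" by (intro mult_left_mono FI) auto
        finally show ?thesis by simp
      qed
      then show "\<exists>n. \<forall>k. Lp_int p l (\<lambda>x. T (F k) x - dyproj n (T (F k)) x) \<le> ennreal e" by blast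
    qed
    have "(\<lambda>k. Lp_norm p l (\<lambda>x. T (F (r k)) x - g x)) \<longlonglongrightarrow> 0"
      using Lp_int_tendsto_0_imp_Lp_norm[OF lim] p by simp
    with r show "\<exists>r g. strict_mono r \<and> g \<in> Lp p l \<and> (\<lambda>n. Lp_norm p l (\<lambda>x. T (F (r n)) x - g x)) \<longlonglongrightarrow> 0"
      by blast
  qed
qed

end
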